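(* Let $M$ and $N$ be von Neumann algebras with separable predual, equipped with faithful normal states $\varphi$ and $\rho$ respectively. The collection of state-preserving ucp maps from $(M,\varphi)$ to $(N,\rho)$, identified with their restrictions to the unit ball $M_1$, is a closed subspace of $1\text{-}\mathrm{Lip}_1(M_\varphi,N_\rho)$, and therefore forms a Polish space. Furthermore, the set of $(\varphi,\rho)$-Markov maps is closed therein, hence is Polish as well.
   Context: A ucp map is a unital completely positive linear map; $\Phi:M\to N$ is state-preserving if $\rho\circ\Phi=\varphi$. $M_1,N_1$ are the operator-norm closed unit balls; $\|x\|_{2,\varphi}=\varphi(x^*x)^{1/2}$ and $\|y\|_{2,\rho}=\rho(y^*y)^{1/2}$. $1\text{-}\mathrm{Lip}_1(M_\varphi,N_\rho)$ is the space of all $1$-Lipschitz maps (not necessarily linear) from the metric space $(M_1,\|\cdot\|_{2,\varphi})$ to $(N_1,\|\cdot\|_{2,\rho})$, with the topology of pointwise convergence. State-preserving ucp maps are contractive for the operator norm and the $2$-norms (Kadison–Schwarz), so their restrictions to $M_1$ lie in this space, and a linear map is determined by its restriction to $M_1$. A state-preserving ucp map $\Phi$ is a $(\varphi,\rho)$-Markov map if $\Phi\circ\sigma_t^\varphi=\sigma_t^\rho\circ\Phi$ for all $t\in\mathbb{R}$, where $\sigma^\varphi,\sigma^\rho$ are the modular automorphism groups of $\varphi,\rho$. *)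

theory Defs
  imports "HOL-Analysis.Analysis"
begin

section \<open>Complex vector spaces, complex Hilbert spaces and their operators\<close>

class complex_vector = real_vector +
  fixes scaleC :: "complex \<Rightarrow> 'a \<Rightarrow> 'a" (infixr "*\<^sub>C" 75)
  assumes scaleC_add_right: "a *\<^sub>C (x + y) = a *\<^sub>C x + a *\<^sub>C y"
    and scaleC_add_left: "(a + b) *\<^sub>C x = a *\<^sub>C x + b *\<^sub>C x"
    and scaleC_scaleC: "a *\<^sub>C (b *\<^sub>C x) = (a * b) *\<^sub>C x"
    and scaleR_eq_scaleC: "r *\<^sub>R x = complex_of_real r *\<^sub>C x"

text \<open>The complex inner product is linear in the first variable; the norm, the metric and the
  topology are those of the underlying real Hilbert space, whose inner product is its real part.\<close>

class complex_hilbert_space = complex_vector + real_inner + complete_space +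
  fixes cinner :: "'a \<Rightarrow> 'a \<Rightarrow> complex"
  assumes cinner_add_left: "cinner (x + y) z = cinner x z + cinner y z"
    and cinner_scaleC_left: "cinner (a *\<^sub>C x) y = a * cinner x y"
    and cinner_commute: "cinner x y = cnj (cinner y x)"
    and inner_eq_Re_cinner: "x \<bullet> y = Re (cinner x y)"

instantiation complex :: complex_hilbert_space
begin

definition "scaleC_complex = (\<lambda>a x :: complex. a * x)"

definition "cinner_complex = (\<lambda>x y :: complex. x * cnj y)"

instance
  by standard
    (simp_all add: scaleC_complex_def cinner_complex_def algebra_simps scaleR_conv_of_real
      inner_complex_def)

end

lemma norm_scaleC: "norm (a *\<^sub>C (x :: 'a :: complex_hilbert_space)) = cmod a * norm x"
proof -
  have im: "Im (cinner x x) = 0"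
    using arg_cong[OF cinner_commute[of x x], of Im] by simp
  have "cinner (a *\<^sub>C x) (a *\<^sub>C x) = a * cnj a * cinner x x"
    using cinner_commute[of x "a *\<^sub>C x"] cinner_commute[of x x]
    by (simp add: cinner_scaleC_left)
  then have "(norm (a *\<^sub>C x))\<^sup>2 = (cmod a * norm x)\<^sup>2"
    using im by (simp add: power2_norm_eq_inner inner_eq_Re_cinner power_mult_distrib
        complex_norm_square[symmetric] flip: of_real_power)
  then show ?thesis
    by simp
qed

lemma bounded_linear_scaleC:
  "bounded_linear (\<lambda>x :: 'a :: complex_hilbert_space. a *\<^sub>C x)"
  by (rule bounded_linear_intro[where K = "cmod a"])
    (simp_all add: scaleC_add_right scaleR_eq_scaleC scaleC_scaleC norm_scaleC mult.commute)

instantiation blinfun :: (real_normed_vector, complex_hilbert_space) complex_vector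
begin

definition scaleC_blinfun :: "complex \<Rightarrow> 'a \<Rightarrow>\<^sub>L 'b \<Rightarrow> 'a \<Rightarrow>\<^sub>L 'b" where
  "scaleC_blinfun a T = Blinfun (\<lambda>x. a *\<^sub>C blinfun_apply T x)"

lemma scaleC_blinfun_apply: "blinfun_apply (a *\<^sub>C T) x = a *\<^sub>C blinfun_apply T x"
  for T :: "'a \<Rightarrow>\<^sub>L 'b"
  unfolding scaleC_blinfun_def
  by (simp add: bounded_linear_Blinfun_apply
      bounded_linear_compose[OF bounded_linear_scaleC blinfun.bounded_linear_right])

instance
  by standard
    (auto intro!: blinfun_eqI simp: scaleC_blinfun_apply blinfun.add_left blinfun.scaleR_left
      scaleC_add_right scaleC_add_left scaleC_scaleC scaleR_eq_scaleC)

end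

text \<open>The bounded real-linear operators \<^typ>\<open>'h \<Rightarrow>\<^sub>L 'h\<close> carry the operator norm; \<open>bounded_ops\<close> is the
  subset of complex-linear ones, i.e. \<open>B(H)\<close>.\<close>

definition bounded_ops :: "('h::complex_hilbert_space \<Rightarrow>\<^sub>L 'h) set" where
  "bounded_ops = {T. \<forall>a x. blinfun_apply T (a *\<^sub>C x) = a *\<^sub>C blinfun_apply T x}"

definition adj :: "('h::complex_hilbert_space \<Rightarrow>\<^sub>L 'h) \<Rightarrow> ('h \<Rightarrow>\<^sub>L 'h)" where
  "adj T = (THE S. \<forall>x y. cinner (blinfun_apply T x) y = cinner x (blinfun_apply S y))"

definition clinear_on :: "'a::complex_vector set \<Rightarrow> ('a \<Rightarrow> 'b::complex_vector) \<Rightarrow> bool" where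
  "clinear_on M f \<longleftrightarrow>
     (\<forall>x\<in>M. \<forall>y\<in>M. f (x + y) = f x + f y) \<and> (\<forall>a. \<forall>x\<in>M. f (a *\<^sub>C x) = a *\<^sub>C f x)"


section \<open>Von Neumann algebras, preduals and faithful normal states\<close>

definition commutant :: "('h::complex_hilbert_space \<Rightarrow>\<^sub>L 'h) set \<Rightarrow> ('h \<Rightarrow>\<^sub>L 'h) set" where
  "commutant M = {T \<in> bounded_ops. \<forall>x\<in>M. T o\<^sub>L x = x o\<^sub>L T}"

definition von_neumann_algebra :: "('h::complex_hilbert_space \<Rightarrow>\<^sub>L 'h) set \<Rightarrow> bool" where
  "von_neumann_algebra M \<longleftrightarrow>
     M \<subseteq> bounded_ops \<and> id_blinfun \<in> M \<and>
     (\<forall>x\<in>M. \<forall>y\<in>M. x + y \<in> M \<and> x o\<^sub>L y \<in> M) \<and>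
     (\<forall>a. \<forall>x\<in>M. a *\<^sub>C x \<in> M) \<and> (\<forall>x\<in>M. adj x \<in> M) \<and>
     commutant (commutant M) = M"

definition unit_ball :: "('h::complex_hilbert_space \<Rightarrow>\<^sub>L 'h) set \<Rightarrow> ('h \<Rightarrow>\<^sub>L 'h) set" where
  "unit_ball M = {x \<in> M. norm x \<le> 1}"

text \<open>The coarsest topology on \<open>B(H)\<close> making all functionals
  \<open>T \<mapsto> \<Sum>n. \<langle>T \<xi>\<^sub>n, \<eta>\<^sub>n\<rangle>\<close> with square-summable \<open>\<xi>\<close>, \<open>\<eta>\<close> continuous.\<close>

definition sigma_weak_topology :: "('h::complex_hilbert_space \<Rightarrow>\<^sub>L 'h) topology" where
  "sigma_weak_topology = topology_generated_by
     {{T \<in> bounded_ops. (\<Sum>n. cinner (blinfun_apply T (\<xi> n)) (\<eta> n)) \<in> U} | \<xi> \<eta> U.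
        summable (\<lambda>n. (norm (\<xi> n))\<^sup>2) \<and> summable (\<lambda>n. (norm (\<eta> n))\<^sup>2) \<and> open U}"

definition normal_functional ::
  "('h::complex_hilbert_space \<Rightarrow>\<^sub>L 'h) set \<Rightarrow> (('h \<Rightarrow>\<^sub>L 'h) \<Rightarrow> complex) \<Rightarrow> bool" where
  "normal_functional M \<omega> \<longleftrightarrow>
     clinear_on M \<omega> \<and> continuous_map (subtopology sigma_weak_topology M) euclidean \<omega>"

text \<open>Functionals in the predual are extensional, so that equality of functions is equality on \<open>M\<close>.
  The metrics below are set to 0 outside their carriers because the locale \<^locale>\<open>Metric_space\<close>
  asks for non-negativity and symmetry there, too.\<close>

definition predual ::
  "('h::complex_hilbert_space \<Rightarrow>\<^sub>L 'h) set \<Rightarrow> (('h \<Rightarrow>\<^sub>L 'h) \<Rightarrow> complex) set" where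
  "predual M = {\<omega> \<in> extensional M. normal_functional M \<omega>}"

definition predual_dist :: "('h::complex_hilbert_space \<Rightarrow>\<^sub>L 'h) set \<Rightarrow>
    (('h \<Rightarrow>\<^sub>L 'h) \<Rightarrow> complex) \<Rightarrow> (('h \<Rightarrow>\<^sub>L 'h) \<Rightarrow> complex) \<Rightarrow> real" where
  "predual_dist M \<omega> \<psi> =
     (if \<omega> \<in> predual M \<and> \<psi> \<in> predual M then SUP x\<in>unit_ball M. cmod (\<omega> x - \<psi> x) else 0)"

definition separable_predual :: "('h::complex_hilbert_space \<Rightarrow>\<^sub>L 'h) set \<Rightarrow> bool" where
  "separable_predual M \<longleftrightarrow>
     separable_space (Metric_space.mtopology (predual M) (predual_dist M))"

definition state ::
  "('h::complex_hilbert_space \<Rightarrow>\<^sub>L 'h) set \<Rightarrow> (('h \<Rightarrow>\<^sub>L 'h) \<Rightarrow> complex) \<Rightarrow> bool" where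
  "state M \<phi> \<longleftrightarrow>
     clinear_on M \<phi> \<and> (\<forall>x\<in>M. \<phi> (adj x o\<^sub>L x) \<in> \<real>\<^sub>\<ge>\<^sub>0) \<and> \<phi> id_blinfun = 1"

definition faithful_normal_state ::
  "('h::complex_hilbert_space \<Rightarrow>\<^sub>L 'h) set \<Rightarrow> (('h \<Rightarrow>\<^sub>L 'h) \<Rightarrow> complex) \<Rightarrow> bool" where
  "faithful_normal_state M \<phi> \<longleftrightarrow>
     state M \<phi> \<and> normal_functional M \<phi> \<and> (\<forall>x\<in>M. \<phi> (adj x o\<^sub>L x) = 0 \<longrightarrow> x = 0)"


section \<open>State-preserving ucp maps and 1-Lipschitz maps of unit balls\<close>

text \<open>Positivity of a matrix \<open>[x\<^sub>i\<^sub>j]\<close> of operators, viewed as an operator on \<open>H\<^sup>n\<close>.\<close>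

definition positive_op_matrix ::
  "nat \<Rightarrow> (nat \<Rightarrow> nat \<Rightarrow> 'h::complex_hilbert_space \<Rightarrow>\<^sub>L 'h) \<Rightarrow> bool" where
  "positive_op_matrix n x \<longleftrightarrow>
     (\<forall>\<xi> :: nat \<Rightarrow> 'h. (\<Sum>i<n. \<Sum>j<n. cinner (blinfun_apply (x i j) (\<xi> j)) (\<xi> i)) \<in> \<real>\<^sub>\<ge>\<^sub>0)"

definition completely_positive_on :: "('h::complex_hilbert_space \<Rightarrow>\<^sub>L 'h) set \<Rightarrow>
    (('h \<Rightarrow>\<^sub>L 'h) \<Rightarrow> ('g::complex_hilbert_space \<Rightarrow>\<^sub>L 'g)) \<Rightarrow> bool" where
  "completely_positive_on M \<Phi> \<longleftrightarrow>
     (\<forall>n x. (\<forall>i<n. \<forall>j<n. x i j \<in> M) \<and> positive_op_matrix n x \<longrightarrow>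
        positive_op_matrix n (\<lambda>i j. \<Phi> (x i j)))"

definition ucp_map :: "('h::complex_hilbert_space \<Rightarrow>\<^sub>L 'h) set \<Rightarrow>
    ('g::complex_hilbert_space \<Rightarrow>\<^sub>L 'g) set \<Rightarrow> (('h \<Rightarrow>\<^sub>L 'h) \<Rightarrow> ('g \<Rightarrow>\<^sub>L 'g)) \<Rightarrow> bool" where
  "ucp_map M N \<Phi> \<longleftrightarrow>
     \<Phi> ` M \<subseteq> N \<and> clinear_on M \<Phi> \<and> \<Phi> id_blinfun = id_blinfun \<and> completely_positive_on M \<Phi>"

definition state_preserving_ucp :: "('h::complex_hilbert_space \<Rightarrow>\<^sub>L 'h) set \<Rightarrow>
    (('h \<Rightarrow>\<^sub>L 'h) \<Rightarrow> complex) \<Rightarrow> ('g::complex_hilbert_space \<Rightarrow>\<^sub>L 'g) set \<Rightarrow>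
    (('g \<Rightarrow>\<^sub>L 'g) \<Rightarrow> complex) \<Rightarrow> (('h \<Rightarrow>\<^sub>L 'h) \<Rightarrow> ('g \<Rightarrow>\<^sub>L 'g)) set" where
  "state_preserving_ucp M \<phi> N \<rho> = {\<Phi>. ucp_map M N \<Phi> \<and> (\<forall>x\<in>M. \<rho> (\<Phi> x) = \<phi> x)}"

definition norm2 ::
  "(('h::complex_hilbert_space \<Rightarrow>\<^sub>L 'h) \<Rightarrow> complex) \<Rightarrow> ('h \<Rightarrow>\<^sub>L 'h) \<Rightarrow> real" where
  "norm2 \<phi> x = sqrt (Re (\<phi> (adj x o\<^sub>L x)))"

definition dist2 :: "('h::complex_hilbert_space \<Rightarrow>\<^sub>L 'h) set \<Rightarrow>
    (('h \<Rightarrow>\<^sub>L 'h) \<Rightarrow> complex) \<Rightarrow> ('h \<Rightarrow>\<^sub>L 'h) \<Rightarrow> ('h \<Rightarrow>\<^sub>L 'h) \<Rightarrow> real" where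
  "dist2 M \<phi> x y = (if x \<in> M \<and> y \<in> M then norm2 \<phi> (x - y) else 0)"

text \<open>Maps \<open>M\<^sub>1 \<rightarrow> N\<^sub>1\<close> are extensional functions, i.e. elements of \<open>\<Pi>\<^sub>E x\<in>M\<^sub>1. N\<^sub>1\<close>, the carrier of the
  product topology.\<close>

definition lip1 :: "('h::complex_hilbert_space \<Rightarrow>\<^sub>L 'h) set \<Rightarrow>
    (('h \<Rightarrow>\<^sub>L 'h) \<Rightarrow> complex) \<Rightarrow> ('g::complex_hilbert_space \<Rightarrow>\<^sub>L 'g) set \<Rightarrow>
    (('g \<Rightarrow>\<^sub>L 'g) \<Rightarrow> complex) \<Rightarrow> (('h \<Rightarrow>\<^sub>L 'h) \<Rightarrow> ('g \<Rightarrow>\<^sub>L 'g)) set" where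
  "lip1 M \<phi> N \<rho> = {f \<in> unit_ball M \<rightarrow>\<^sub>E unit_ball N.
     \<forall>x\<in>unit_ball M. \<forall>y\<in>unit_ball M. dist2 N \<rho> (f x) (f y) \<le> dist2 M \<phi> x y}"

definition lip1_topology :: "('h::complex_hilbert_space \<Rightarrow>\<^sub>L 'h) set \<Rightarrow>
    (('h \<Rightarrow>\<^sub>L 'h) \<Rightarrow> complex) \<Rightarrow> ('g::complex_hilbert_space \<Rightarrow>\<^sub>L 'g) set \<Rightarrow>
    (('g \<Rightarrow>\<^sub>L 'g) \<Rightarrow> complex) \<Rightarrow> (('h \<Rightarrow>\<^sub>L 'h) \<Rightarrow> ('g \<Rightarrow>\<^sub>L 'g)) topology" where
  "lip1_topology M \<phi> N \<rho> = subtopology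
     (product_topology (\<lambda>_. Metric_space.mtopology (unit_ball N) (dist2 N \<rho>)) (unit_ball M))
     (lip1 M \<phi> N \<rho>)"

definition restrictions_to_ball :: "('h::complex_hilbert_space \<Rightarrow>\<^sub>L 'h) set \<Rightarrow>
    (('h \<Rightarrow>\<^sub>L 'h) \<Rightarrow> ('g::complex_hilbert_space \<Rightarrow>\<^sub>L 'g)) set \<Rightarrow>
    (('h \<Rightarrow>\<^sub>L 'h) \<Rightarrow> ('g \<Rightarrow>\<^sub>L 'g)) set" where
  "restrictions_to_ball M F = (\<lambda>\<Phi>. restrict \<Phi> (unit_ball M)) ` F"

lemma clinear_on_eq_of_restrict_eq:
  assumes "von_neumann_algebra M" "clinear_on M \<Phi>" "clinear_on M \<Psi>"
    and eq: "restrict \<Phi> (unit_ball M) = restrict \<Psi> (unit_ball M)" and x: "x \<in> M"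
  shows "\<Phi> x = (\<Psi> x :: 'g::complex_hilbert_space \<Rightarrow>\<^sub>L 'g)"
proof -
  define r where "r = norm x + 1"
  have r: "r > 0" "norm x \<le> r"
    by (simp_all add: r_def add_nonneg_pos)
  define y where "y = (1 / r) *\<^sub>R x"
  have y: "y \<in> M"
    using assms(1) x by (simp add: y_def scaleR_eq_scaleC von_neumann_algebra_def)
  have "norm y \<le> 1"
    using r by (simp add: y_def)
  then have "\<Phi> y = \<Psi> y"
    using fun_cong[OF eq, of y] y by (simp add: unit_ball_def)
  moreover have "x = complex_of_real r *\<^sub>C y"
    using r by (simp add: y_def scaleR_eq_scaleC[symmetric])
  ultimately show ?thesis
    using assms(2,3) y by (simp add: clinear_on_def)
qed

definition Polish_space :: "'a topology \<Rightarrow> bool" where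
  "Polish_space X \<longleftrightarrow> completely_metrizable_space X \<and> separable_space X"


section \<open>Modular automorphism groups and Markov maps\<close>

text \<open>Unbounded (linear or antilinear) operators are represented by their graphs.\<close>

definition gns_representation :: "('h::complex_hilbert_space \<Rightarrow>\<^sub>L 'h) set \<Rightarrow>
    (('h \<Rightarrow>\<^sub>L 'h) \<Rightarrow> complex) \<Rightarrow> (('h \<Rightarrow>\<^sub>L 'h) \<Rightarrow> ('k::complex_hilbert_space \<Rightarrow>\<^sub>L 'k)) \<Rightarrow>
    'k \<Rightarrow> bool" where
  "gns_representation M \<phi> \<pi> \<Omega> \<longleftrightarrow>
     \<pi> ` M \<subseteq> bounded_ops \<and> clinear_on M \<pi> \<and> \<pi> id_blinfun = id_blinfun \<and>
     (\<forall>x\<in>M. \<forall>y\<in>M. \<pi> (x o\<^sub>L y) = \<pi> x o\<^sub>L \<pi> y) \<and> (\<forall>x\<in>M. \<pi> (adj x) = adj (\<pi> x)) \<and>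
     (\<forall>x\<in>M. cinner (blinfun_apply (\<pi> x) \<Omega>) \<Omega> = \<phi> x) \<and>
     closure {blinfun_apply (\<pi> x) \<Omega> | x. x \<in> M} = UNIV"

text \<open>The closure \<open>S\<close> of the antilinear operator \<open>\<pi>(x)\<Omega> \<mapsto> \<pi>(x\<^sup>*)\<Omega>\<close>.\<close>

definition tomita_op :: "('h::complex_hilbert_space \<Rightarrow>\<^sub>L 'h) set \<Rightarrow>
    (('h \<Rightarrow>\<^sub>L 'h) \<Rightarrow> ('k::complex_hilbert_space \<Rightarrow>\<^sub>L 'k)) \<Rightarrow> 'k \<Rightarrow> ('k \<times> 'k) set" where
  "tomita_op M \<pi> \<Omega> = closure {(blinfun_apply (\<pi> x) \<Omega>, blinfun_apply (\<pi> (adj x)) \<Omega>) | x. x \<in> M}"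

text \<open>The adjoint of a densely defined antilinear operator \<open>S\<close> satisfies
  \<open>\<langle>S \<xi>, \<eta>\<rangle> = \<langle>S\<^sup>* \<eta>, \<xi>\<rangle>\<close>.\<close>

definition antilinear_adjoint :: "('k::complex_hilbert_space \<times> 'k) set \<Rightarrow> ('k \<times> 'k) set" where
  "antilinear_adjoint S = {(\<eta>, \<zeta>). \<forall>(\<xi>, \<xi>')\<in>S. cinner \<xi>' \<eta> = cinner \<zeta> \<xi>}"

text \<open>The graph of \<open>\<Delta> = S\<^sup>* S\<close>; relational composition applies its left argument first.\<close>

definition modular_op :: "('h::complex_hilbert_space \<Rightarrow>\<^sub>L 'h) set \<Rightarrow>
    (('h \<Rightarrow>\<^sub>L 'h) \<Rightarrow> ('k::complex_hilbert_space \<Rightarrow>\<^sub>L 'k)) \<Rightarrow> 'k \<Rightarrow> ('k \<times> 'k) set" where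
  "modular_op M \<pi> \<Omega> = tomita_op M \<pi> \<Omega> O antilinear_adjoint (tomita_op M \<pi> \<Omega>)"

definition spectral_measure :: "(real set \<Rightarrow> ('k::complex_hilbert_space \<Rightarrow>\<^sub>L 'k)) \<Rightarrow> bool" where
  "spectral_measure E \<longleftrightarrow>
     (\<forall>B\<in>sets borel. E B \<in> bounded_ops \<and> E B o\<^sub>L E B = E B \<and> adj (E B) = E B) \<and>
     E UNIV = id_blinfun \<and>
     (\<forall>B :: nat \<Rightarrow> real set. range B \<subseteq> sets borel \<and> disjoint_family B \<longrightarrow>
        (\<forall>\<xi>. (\<lambda>n. blinfun_apply (E (B n)) \<xi>) sums blinfun_apply (E (\<Union>n. B n)) \<xi>))"

text \<open>The finite measure \<open>B \<mapsto> \<langle>E(B) \<xi>, \<xi>\<rangle>\<close>.\<close>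

definition spectral_scalar_measure ::
  "(real set \<Rightarrow> ('k::complex_hilbert_space \<Rightarrow>\<^sub>L 'k)) \<Rightarrow> 'k \<Rightarrow> real measure" where
  "spectral_scalar_measure E \<xi> =
     measure_of UNIV (sets borel) (\<lambda>B. ennreal (Re (cinner (blinfun_apply (E B) \<xi>) \<xi>)))"

definition spectral_domain :: "(real set \<Rightarrow> ('k::complex_hilbert_space \<Rightarrow>\<^sub>L 'k)) \<Rightarrow>
    (real \<Rightarrow> complex) \<Rightarrow> 'k set" where
  "spectral_domain E f = {\<xi>. integrable (spectral_scalar_measure E \<xi>) (\<lambda>s. (cmod (f s))\<^sup>2)}"

text \<open>The graph of \<open>\<integral> f dE\<close>: on its domain \<open>D\<close>, this operator satisfies
  \<open>\<langle>(\<integral> f dE) \<xi>, \<eta>\<rangle> = \<integral> f dE\<^sub>\<xi>\<^sub>\<eta>\<close> for all \<open>\<eta>\<close> in \<open>D\<close>, where the complex measure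
  \<open>E\<^sub>\<xi>\<^sub>\<eta>(B) = \<langle>E(B) \<xi>, \<eta>\<rangle>\<close> is expressed through positive measures by polarization. As \<open>D\<close> is a
  dense subspace for Borel \<open>f\<close>, this determines the operator.\<close>

definition spectral_integral :: "(real set \<Rightarrow> ('k::complex_hilbert_space \<Rightarrow>\<^sub>L 'k)) \<Rightarrow>
    (real \<Rightarrow> complex) \<Rightarrow> ('k \<times> 'k) set" where
  "spectral_integral E f = {(\<xi>, \<zeta>). \<xi> \<in> spectral_domain E f \<and>
     (\<forall>\<eta>\<in>spectral_domain E f. cinner \<zeta> \<eta> =
        (\<Sum>k<4. \<i> ^ k * (LINT s|spectral_scalar_measure E (\<xi> + (\<i> ^ k) *\<^sub>C \<eta>). f s)) / 4)}"

text \<open>\<open>U t = A\<^sup>i\<^sup>t\<close> for a positive injective self-adjoint operator \<open>A\<close> with graph \<open>A\<close>, by functional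
  calculus: \<open>E\<close> is the spectral measure of \<open>A\<close>, it is concentrated on the positive reals, and there
  \<open>s\<^sup>i\<^sup>t = cis (t ln s)\<close>.\<close>

definition imaginary_powers :: "('k::complex_hilbert_space \<times> 'k) set \<Rightarrow>
    (real \<Rightarrow> ('k \<Rightarrow>\<^sub>L 'k)) \<Rightarrow> bool" where
  "imaginary_powers A U \<longleftrightarrow>
     (\<exists>E. spectral_measure E \<and> A = spectral_integral E complex_of_real \<and>
        (\<forall>t. {(\<xi>, blinfun_apply (U t) \<xi>) | \<xi>. True} = spectral_integral E (\<lambda>s. cis (t * ln s))))"

text \<open>\<open>\<sigma>\<close> is the modular automorphism group of \<open>\<phi>\<close>, computed in the GNS representation \<open>(\<pi>, \<Omega>)\<close>:
  \<open>\<pi>(\<sigma>\<^sub>t(x)) = \<Delta>\<^sup>i\<^sup>t \<pi>(x) \<Delta>\<^sup>-\<^sup>i\<^sup>t\<close>. For a faithful normal state \<open>\<pi>\<close> is injective, so \<open>\<sigma>\<close> is unique on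
  \<open>M\<close>, and it exists by Tomita's theorem. GNS representations are unique up to unitary equivalence,
  so \<open>\<sigma>\<close> does not depend on the choice of \<open>(\<pi>, \<Omega>)\<close>.\<close>

definition modular_automorphism_group :: "('h::complex_hilbert_space \<Rightarrow>\<^sub>L 'h) set \<Rightarrow>
    (('h \<Rightarrow>\<^sub>L 'h) \<Rightarrow> complex) \<Rightarrow> (('h \<Rightarrow>\<^sub>L 'h) \<Rightarrow> ('k::complex_hilbert_space \<Rightarrow>\<^sub>L 'k)) \<Rightarrow> 'k \<Rightarrow>
    (real \<Rightarrow> ('h \<Rightarrow>\<^sub>L 'h) \<Rightarrow> ('h \<Rightarrow>\<^sub>L 'h)) \<Rightarrow> bool" where
  "modular_automorphism_group M \<phi> \<pi> \<Omega> \<sigma> \<longleftrightarrow>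
     gns_representation M \<phi> \<pi> \<Omega> \<and>
     (\<exists>U. imaginary_powers (modular_op M \<pi> \<Omega>) U \<and>
        (\<forall>t. \<forall>x\<in>M. \<sigma> t x \<in> M \<and> \<pi> (\<sigma> t x) = U t o\<^sub>L \<pi> x o\<^sub>L U (- t)))"

definition markov_maps :: "('h::complex_hilbert_space \<Rightarrow>\<^sub>L 'h) set \<Rightarrow>
    (('h \<Rightarrow>\<^sub>L 'h) \<Rightarrow> complex) \<Rightarrow> (real \<Rightarrow> ('h \<Rightarrow>\<^sub>L 'h) \<Rightarrow> ('h \<Rightarrow>\<^sub>L 'h)) \<Rightarrow>
    ('g::complex_hilbert_space \<Rightarrow>\<^sub>L 'g) set \<Rightarrow> (('g \<Rightarrow>\<^sub>L 'g) \<Rightarrow> complex) \<Rightarrow>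
    (real \<Rightarrow> ('g \<Rightarrow>\<^sub>L 'g) \<Rightarrow> ('g \<Rightarrow>\<^sub>L 'g)) \<Rightarrow> (('h \<Rightarrow>\<^sub>L 'h) \<Rightarrow> ('g \<Rightarrow>\<^sub>L 'g)) set" where
  "markov_maps M \<phi> \<sigma> N \<rho> \<tau> =
     {\<Phi> \<in> state_preserving_ucp M \<phi> N \<rho>. \<forall>t. \<forall>x\<in>M. \<Phi> (\<sigma> t x) = \<tau> t (\<Phi> x)}"

end

theory Submission
  imports Defs
begin

text \<open>By Banach-Alaoglu, the unit ball of a von Neumann algebra is compact in the weak operator
  topology. Hence it is complete for the 2-norm of a faithful normal state, and bounded 2-norm null
  sequences are weakly null; it is 2-norm separable because \<open>a \<mapsto> \<phi>(a\<^sup>* \<cdot>)\<close> embeds it into the predual.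
  A 1-Lipschitz map is determined by its values on a countable dense set, which makes the space of
  1-Lipschitz maps between separable complete metric spaces Polish.

  A pointwise 2-norm limit of state-preserving ucp maps is, on finitely many points, a limit of a
  sequence of such maps, and therefore inherits linearity (which extends it from the ball to the
  algebra), unitality, preservation of the state and, by weak convergence of the matrix entries,
  complete positivity. Markov maps are closed because each modular automorphism is 2-norm continuous
  on bounded sets.\<close>

section \<open>Complex Hilbert spaces\<close>

text \<open>The Hilbert spaces may be nonseparable, so weak compactness yields cluster points along
  finer filters and not along subsequences. In the 2-norm a left factor costs only its operator
  norm, but in general a right factor admits no such estimate unless the state is a trace. What
  survives is continuity of right multiplication at 0 on bounded sequences. This is the point at
  which the modular groups enter: \<sigma>_t is conjugation by U_t, and the vector U_{-t} \<Omega>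
  is treated like any other vector, namely approximated by \<pi>(a) \<Omega> with a in the algebra,
  which turns the question into one about right multiplication by a. Contractivity of ucp maps, in
  both norms, comes from the 2x2 matrix form of complete positivity, that is, from the
  Kadison-Schwarz inequality. To integrate that inequality against \<rho>, the state has to be
  monotone for the order given by quadratic forms, whereas its definition speaks only of elements of
  the form adj x o x.\<close>

lemma cinner_add_right: "cinner x (y + z) = cinner x y + cinner x (z :: 'a :: complex_hilbert_space)"
  by (metis cinner_add_left cinner_commute complex_cnj_add)

lemma cinner_scaleC_right: "cinner x (a *\<^sub>C y) = cnj a * cinner x (y :: 'a :: complex_hilbert_space)"
  by (metis cinner_commute cinner_scaleC_left complex_cnj_mult)

lemma cinner_self: "cinner x x = complex_of_real ((norm (x :: 'a :: complex_hilbert_space))\<^sup>2)"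
proof -
  have "Im (cinner x x) = 0"
    using arg_cong[OF cinner_commute[of x x], of Im] by simp
  then show ?thesis
    by (simp add: complex_eq_iff power2_norm_eq_inner inner_eq_Re_cinner)
qed

lemma scaleR_scaleC_commute:
  "r *\<^sub>R (a *\<^sub>C x) = a *\<^sub>C (r *\<^sub>R (x :: 'a :: complex_vector))"
  by (simp add: scaleR_eq_scaleC scaleC_scaleC mult.commute)

lemma scaleC_minus_right: "a *\<^sub>C (- x) = - (a *\<^sub>C (x :: 'a :: complex_vector))"
  using scaleR_scaleC_commute[of "-1" a x] by simp

lemma scaleC_diff_right: "a *\<^sub>C (x - y) = a *\<^sub>C x - a *\<^sub>C (y :: 'a :: complex_vector)"
  using scaleC_add_right[of a x "- y"] by (simp add: scaleC_minus_right)

lemma scaleC_one: "1 *\<^sub>C x = (x :: 'a :: complex_vector)"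
  using scaleR_eq_scaleC[of 1 x] by simp

lemma scaleC_zero_left: "0 *\<^sub>C x = (0 :: 'a :: complex_vector)"
  using scaleR_eq_scaleC[of 0 x] by simp

lemma scaleC_uminus_one: "(-1) *\<^sub>C x = - (x :: 'a :: complex_vector)"
  using scaleR_eq_scaleC[of "-1" x] by simp

text \<open>Multiplying \<open>x\<close> by a unimodular scalar turns the inner product into its
  modulus, which is then a real inner product, and the real Cauchy-Schwarz inequality
  applies.\<close>

lemma cmod_cinner_le: "cmod (cinner x y) \<le> norm x * norm (y :: 'a :: complex_hilbert_space)"
proof (cases "cinner x y = 0")
  case False
  define a where "a = cnj (sgn (cinner x y))"
  have a: "cmod a = 1"
    using False by (simp add: a_def norm_sgn)
  have "a * cinner x y = complex_of_real (cmod (cinner x y))"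
    using False
    using complex_norm_square[of "cinner x y"]
    by (simp add: a_def sgn_div_norm scaleR_conv_of_real field_simps power2_eq_square)
  then have "cmod (cinner x y) = Re (cinner (a *\<^sub>C x) y)"
    by (simp add: cinner_scaleC_left)
  also have "\<dots> \<le> norm (a *\<^sub>C x) * norm y"
    by (simp add: norm_cauchy_schwarz flip: inner_eq_Re_cinner)
  finally show ?thesis
    by (simp add: norm_scaleC a)
qed auto

lemma bounded_bilinear_cinner:
  "bounded_bilinear (cinner :: 'a :: complex_hilbert_space \<Rightarrow> 'a \<Rightarrow> complex)"
proof
  show "\<exists>K. \<forall>a b. cmod (cinner a (b :: 'a)) \<le> norm a * norm b * K"
    by (rule exI[of _ 1]) (simp add: cmod_cinner_le)
qed (simp_all add: cinner_add_left cinner_add_right scaleR_eq_scaleC cinner_scaleC_left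
    cinner_scaleC_right scaleC_complex_def)

interpretation cinner: bounded_bilinear "cinner :: 'a :: complex_hilbert_space \<Rightarrow> 'a \<Rightarrow> complex"
  by (rule bounded_bilinear_cinner)

section \<open>Riesz representation and operators defined by bounded forms\<close>

lemma cinner_eqI:
  assumes "\<And>y. cinner x y = cinner z y"
  shows "x = (z :: 'a :: complex_hilbert_space)"
proof -
  have "cinner (x - z) (x - z) = 0"
    using assms by (simp add: cinner.diff_left)
  then show ?thesis
    by (simp add: cinner_self)
qed

text \<open>The minimizing sequences of \<open>\<parallel>x\<parallel>\<^sup>2 / 2 - f x\<close> are Cauchy by the parallelogram law, and the
  derivative of this functional vanishes at the limit.\<close>

lemma riesz_representation_real:
  fixes f :: "'a :: {real_inner, complete_space} \<Rightarrow> real"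
  assumes f: "bounded_linear f"
  shows "\<exists>v. \<forall>x. f x = x \<bullet> v"
proof -
  interpret f: bounded_linear f by fact
  define q where "q x = (norm x)\<^sup>2 / 2 - f x" for x
  obtain K where K: "\<And>x. norm (f x) \<le> norm x * K"
    using f.bounded by blast
  have bdd: "- (K\<^sup>2 / 2) \<le> q x" for x
  proof -
    have "f x \<le> norm x * K"
      using K[of x] by simp
    moreover have "0 \<le> (norm x - K)\<^sup>2"
      by simp
    ultimately show ?thesis
      unfolding q_def power2_diff by (simp add: field_simps)
  qed
  define m where "m = (INF x. q x)"
  have bb: "bdd_below (range q)"
    using bdd by (meson bdd_belowI2)
  have m_le: "m \<le> q x" for x
    unfolding m_def using bb by (simp add: cINF_lower)
  have "\<exists>x. q x < m + 1 / real (Suc n)" for n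
  proof (rule ccontr)
    assume "\<not> ?thesis"
    then have "m + 1 / real (Suc n) \<le> m"
      unfolding m_def[symmetric] by (subst (2) m_def) (rule cINF_greatest, auto simp: not_less)
    then show False
      by simp
  qed
  then obtain X where X: "\<And>n. q (X n) < m + 1 / real (Suc n)"
    by metis
  \<comment> \<open>The linear part \<open>f\<close> cancels between the three values of
    \<open>q\<close>; what remains is the parallelogram law.\<close>
  have par: "(norm (x - y))\<^sup>2 = 4 * q x + 4 * q y - 8 * q ((1/2) *\<^sub>R (x + y))" for x y
  proof -
    have "(norm ((1/2) *\<^sub>R (x + y)))\<^sup>2 = (norm (x + y))\<^sup>2 / 4"
      by (simp add: power_mult_distrib power2_eq_square)
    moreover have "(norm (x - y))\<^sup>2 + (norm (x + y))\<^sup>2 = 2 * (norm x)\<^sup>2 + 2 * (norm y)\<^sup>2"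
      by (simp add: power2_norm_eq_inner algebra_simps)
    moreover have "f ((1/2) *\<^sub>R (x + y)) = (f x + f y) / 2"
      by (simp add: f.scaleR f.add)
    ultimately show ?thesis
      unfolding q_def by (simp add: field_simps)
  qed
  \<comment> \<open>Each of the two values of \<open>q\<close> exceeds the infimum \<open>m\<close>
    by at most 1/(n+1), the value at the midpoint is at least \<open>m\<close>, and the coefficients
    4, 4, 8 of \<open>par\<close> leave 8/(n+1).\<close>
  have close: "(norm (X i - X j))\<^sup>2 \<le> 8 / real (Suc n)" if "n \<le> i" "n \<le> j" for i j n
  proof -
    have "1 / real (Suc i) \<le> 1 / real (Suc n)" "1 / real (Suc j) \<le> 1 / real (Suc n)"
      using that by (simp_all add: frac_le)
    then show ?thesis
      using par[of "X i" "X j"] X[of i] X[of j] m_le[of "(1/2) *\<^sub>R (X i + X j)"] by simp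
  qed
  have "Cauchy X"
  proof (rule CauchyI)
    fix e :: real assume "0 < e"
    obtain n where n: "8 / e\<^sup>2 < real n"
      using reals_Archimedean2 by blast
    then have "8 / real (Suc n) < e\<^sup>2"
      using \<open>0 < e\<close> by (simp add: field_simps) (smt (verit) zero_less_power)
    then have "norm (X i - X j) < e" if "n \<le> i" "n \<le> j" for i j
      using close[OF that] \<open>0 < e\<close> by (meson le_less_trans less_eq_real_def power2_less_imp_less)
    then show "\<exists>M. \<forall>m\<ge>M. \<forall>n\<ge>M. norm (X m - X n) < e"
      by blast
  qed
  then obtain v where v: "X \<longlonglongrightarrow> v"
    using Cauchy_convergent convergent_def by blast
  have "(\<lambda>n. q (X n)) \<longlonglongrightarrow> q v"
    unfolding q_def using f.tendsto[OF v] by (intro tendsto_intros v) auto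
  moreover have "(\<lambda>n. m + 1 / real (Suc n)) \<longlonglongrightarrow> m + 0"
    by (intro tendsto_intros LIMSEQ_Suc[OF lim_1_over_n])
  ultimately have qv: "q v \<le> m"
    using X by (intro LIMSEQ_le[of "\<lambda>n. q (X n)" "q v"]) (auto intro: less_imp_le)
  have "f x = x \<bullet> v" for x
  proof -
    have step: "0 \<le> t * (v \<bullet> x - f x) + t\<^sup>2 * ((norm x)\<^sup>2 / 2)" for t
    proof -
      have "q v \<le> q (v + t *\<^sub>R x)"
        using qv m_le order_trans by blast
      moreover have "(norm (v + t *\<^sub>R x))\<^sup>2 = (norm v)\<^sup>2 + 2 * t * (v \<bullet> x) + t\<^sup>2 * (norm x)\<^sup>2"
        unfolding power2_norm_eq_inner
        by (simp add: inner_add_left inner_add_right inner_commute[of x v] power2_eq_square distrib_left)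
      ultimately show ?thesis
        unfolding q_def by (simp add: f.add f.scaleR algebra_simps)
    qed
    \<comment> \<open>The quadratic inequality \<open>step\<close> is tested at t = - e. The summand
      1 in \<open>d\<close> keeps the divisor positive and leaves exactly - e^2 on the right, so e =
      0.\<close>
    define d e where "d = (norm x)\<^sup>2 / 2 + 1" and "e = (v \<bullet> x - f x) / d"
    have "d > 0"
      by (simp add: d_def add_nonneg_pos)
    then have c: "v \<bullet> x - f x = e * d"
      by (simp add: e_def)
    have "0 \<le> - e * (e * d) + (- e)\<^sup>2 * (d - 1)"
      using step[of "- e"] unfolding c by (simp add: d_def)
    also have "\<dots> = - e\<^sup>2"
      by (simp add: power2_eq_square algebra_simps)
    finally have "v \<bullet> x - f x = 0"
      using c by simp
    then show ?thesis
      by (simp add: inner_commute)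
  qed
  then show ?thesis
    by blast
qed

definition sesquilinear :: "('h::complex_hilbert_space \<Rightarrow> 'h \<Rightarrow> complex) \<Rightarrow> bool" where
  "sesquilinear B \<longleftrightarrow>
     (\<forall>x y z. B (x + y) z = B x z + B y z \<and> B z (x + y) = B z x + B z y) \<and>
     (\<forall>a x y. B (a *\<^sub>C x) y = a * B x y \<and> B x (a *\<^sub>C y) = cnj a * B x y)"

text \<open>Riesz representation of the real functional Re B x gives the vector T x. Uniqueness of
  representing vectors makes T linear, and testing the bound of \<open>B\<close> at y = T x gives
  norm T \<le> K.\<close>

lemma ex_operator_of_form:
  fixes B :: "'h::complex_hilbert_space \<Rightarrow> 'h \<Rightarrow> complex"
  assumes B: "sesquilinear B" and bound: "\<And>x y. cmod (B x y) \<le> K * norm x * norm y"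
    and K: "0 \<le> K"
  shows "\<exists>T\<in>bounded_ops. norm T \<le> K \<and> (\<forall>x y. cinner (blinfun_apply T x) y = B x y)"
proof -
  have "\<exists>v. \<forall>y. cinner v y = B x y" for x
  proof -
    have "bounded_linear (\<lambda>y. Re (B x y))"
    proof (rule bounded_linear_intro[where K = "K * norm x"])
      show "norm (Re (B x y)) \<le> norm y * (K * norm x)" for y
        using bound[of x y] abs_Re_le_cmod[of "B x y"] by (simp add: mult_ac)
    qed (use B in \<open>simp_all add: sesquilinear_def scaleR_eq_scaleC\<close>)
    then obtain v where v: "\<And>y. Re (B x y) = y \<bullet> v"
      using riesz_representation_real by blast
    have Re: "Re (cinner v y) = Re (B x y)" for y
      by (metis v inner_commute inner_eq_Re_cinner)
    \<comment> \<open>Both forms are conjugate-linear in the second variable, so the imaginary part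
      at \<open>y\<close> is the real part at \<open>\<i> *\<^sub>C y\<close>.\<close>
    have "Im (cinner v y) = Im (B x y)" for y
      using Re[of "\<i> *\<^sub>C y"] B by (simp add: sesquilinear_def cinner_scaleC_right)
    with Re show ?thesis
      by (auto simp: complex_eq_iff)
  qed
  then obtain t where t: "\<And>x y. cinner (t x) y = B x y"
    by metis
  have norm_t: "norm (t x) \<le> K * norm x" for x
  proof (cases "t x = 0")
    case False
    have "(norm (t x))\<^sup>2 \<le> K * norm x * norm (t x)"
      using bound[of x "t x"] by (simp add: cinner_self norm_power power2_eq_square norm_mult flip: t)
    then show ?thesis
      using False by (simp add: power2_eq_square)
  qed (use K in auto)
  have t_add: "t (x + y) = t x + t y" for x y
    using B by - (rule cinner_eqI, simp add: t cinner_add_left sesquilinear_def)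
  have t_scale: "t (a *\<^sub>C x) = a *\<^sub>C t x" for a x
    using B by - (rule cinner_eqI, simp add: t cinner_scaleC_left sesquilinear_def)
  have bl: "bounded_linear t"
    using norm_t by (intro bounded_linear_intro[where K = K])
      (simp_all add: t_add t_scale scaleR_eq_scaleC mult.commute)
  have Bt: "blinfun_apply (Blinfun t) = t"
    by (simp add: bounded_linear_Blinfun_apply bl)
  have "norm (Blinfun t) \<le> K"
    using K norm_t by (intro norm_blinfun_bound) (simp_all add: Bt)
  moreover have "Blinfun t \<in> bounded_ops"
    by (simp add: bounded_ops_def Bt t_scale)
  ultimately show ?thesis
    using t by (metis Bt)
qed

text \<open>\<open>adj\<close> is a definite description, so its algebraic rules are obtained by
  exhibiting an operator with the defining property. Uniqueness is nondegeneracy of the inner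
  product.\<close>

lemma adj_eqI:
  assumes "\<And>x y. cinner (blinfun_apply T x) y = cinner x (blinfun_apply S y)"
  shows "adj T = S"
  unfolding adj_def
proof (rule the_equality)
  fix S' assume S': "\<forall>x y. cinner (blinfun_apply T x) y = cinner x (blinfun_apply S' y)"
  show "S' = S"
  proof (rule blinfun_eqI, rule cinner_eqI)
    fix y z
    show "cinner (blinfun_apply S' y) z = cinner (blinfun_apply S y) z"
      using assms S' by (metis cinner_commute)
  qed
qed (use assms in blast)

lemma bounded_ops_scaleC: "T \<in> bounded_ops \<Longrightarrow> blinfun_apply T (a *\<^sub>C x) = a *\<^sub>C blinfun_apply T x"
  by (simp add: bounded_ops_def)

lemma norm_apply_le: "norm T \<le> K \<Longrightarrow> norm (blinfun_apply T x) \<le> K * norm x"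
  by (meson mult_right_mono norm_blinfun norm_ge_zero order_trans)

text \<open>The form (x, y) \<mapsto> \<langle>x, T y\<rangle> is sesquilinear because
  \<open>T\<close> is complex-linear, and bounded by norm T. Its operator satisfies the adjoint
  relation after conjugation.\<close>

lemma ex_adj:
  assumes T: "T \<in> bounded_ops"
  shows "\<exists>S\<in>bounded_ops. norm S \<le> norm T \<and>
    (\<forall>x y. cinner (blinfun_apply T x) y = cinner x (blinfun_apply S y))"
proof -
  have "cmod (cinner x (blinfun_apply T y)) \<le> norm T * norm x * norm y" for x y
    using order_trans[OF cmod_cinner_le mult_left_mono[OF norm_blinfun[of T y] norm_ge_zero[of x]]]
    by (simp add: mult_ac)
  then obtain S where S: "S \<in> bounded_ops" "norm S \<le> norm T"
    "\<And>x y. cinner (blinfun_apply S x) y = cinner x (blinfun_apply T y)"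
    using T ex_operator_of_form[of "\<lambda>x y. cinner x (blinfun_apply T y)" "norm T"]
    by (auto simp: sesquilinear_def cinner_add_left cinner_add_right cinner_scaleC_left
        cinner_scaleC_right blinfun.add_right bounded_ops_scaleC)
  then show ?thesis
    by (metis cinner_commute)
qed

lemma
  assumes "T \<in> bounded_ops"
  shows cinner_adj_right: "cinner x (blinfun_apply (adj T) y) = cinner (blinfun_apply T x) y"
    and cinner_adj_left: "cinner (blinfun_apply (adj T) y) x = cinner y (blinfun_apply T x)"
    and adj_in_bounded_ops: "adj T \<in> bounded_ops"
    and norm_adj_le: "norm (adj T) \<le> norm T"
proof -
  obtain S where S: "S \<in> bounded_ops" "norm S \<le> norm T"
    "\<And>x y. cinner (blinfun_apply T x) y = cinner x (blinfun_apply S y)"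
    using ex_adj[OF assms] by blast
  have "adj T = S"
    by (rule adj_eqI) (rule S)
  with S show "cinner x (blinfun_apply (adj T) y) = cinner (blinfun_apply T x) y"
    "cinner (blinfun_apply (adj T) y) x = cinner y (blinfun_apply T x)"
    "adj T \<in> bounded_ops" "norm (adj T) \<le> norm T"
    by (simp_all, metis cinner_commute)
qed

lemma adj_add: "S \<in> bounded_ops \<Longrightarrow> T \<in> bounded_ops \<Longrightarrow> adj (S + T) = adj S + adj T"
  by (rule adj_eqI)
    (simp add: blinfun.add_left cinner_add_left cinner_add_right cinner_adj_right)

lemma adj_diff: "S \<in> bounded_ops \<Longrightarrow> T \<in> bounded_ops \<Longrightarrow> adj (S - T) = adj S - adj T"
  by (rule adj_eqI)
    (simp add: blinfun.diff_left cinner.diff_left cinner.diff_right cinner_adj_right)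

lemma adj_scaleC: "T \<in> bounded_ops \<Longrightarrow> adj (a *\<^sub>C T) = cnj a *\<^sub>C adj T"
  by (rule adj_eqI)
    (simp add: scaleC_blinfun_apply cinner_scaleC_left cinner_scaleC_right cinner_adj_right)

lemma adj_compose:
  "S \<in> bounded_ops \<Longrightarrow> T \<in> bounded_ops \<Longrightarrow> adj (S o\<^sub>L T) = adj T o\<^sub>L adj S"
  by (rule adj_eqI) (simp add: cinner_adj_right)

lemma adj_id: "adj id_blinfun = (id_blinfun :: 'h::complex_hilbert_space \<Rightarrow>\<^sub>L 'h)"
  by (rule adj_eqI) simp

text \<open>The inequality \<le> is direct; the reverse one is the same inequality for the scalar
  \<open>inverse a\<close> and the operator \<open>a *\<^sub>C T\<close>.\<close>

lemma norm_scaleC_blinfun: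
  fixes T :: "'a::real_normed_vector \<Rightarrow>\<^sub>L 'b::complex_hilbert_space"
  shows "norm (a *\<^sub>C T) = cmod a * norm T"
proof -
  have le: "norm (a *\<^sub>C T) \<le> cmod a * norm T" for a and T :: "'a \<Rightarrow>\<^sub>L 'b"
  proof (rule norm_blinfun_bound)
    show "norm (blinfun_apply (a *\<^sub>C T) x) \<le> cmod a * norm T * norm x" for x
      unfolding scaleC_blinfun_apply norm_scaleC mult.assoc
      by (intro mult_left_mono norm_blinfun norm_ge_zero)
  qed simp
  show ?thesis
  proof (cases "a = 0")
    case False
    have "norm T \<le> cmod (inverse a) * norm (a *\<^sub>C T)"
      using le[of "inverse a" "a *\<^sub>C T"] False by (simp add: scaleC_scaleC scaleC_one)
    then show ?thesis
      using False le[of a T] by (simp add: norm_inverse norm_divide field_simps)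
  qed (use le[of a T] in simp)
qed

section \<open>Weak limits in von Neumann algebras\<close>

text \<open>Weak operator convergence is stated as a relation for arbitrary filters and not through
  a topology, because cluster points are reached along filters finer than
  \<open>sequentially\<close>.\<close>

definition wot_tendsto :: "('i \<Rightarrow> ('h::complex_hilbert_space \<Rightarrow>\<^sub>L 'h)) \<Rightarrow> ('h \<Rightarrow>\<^sub>L 'h) \<Rightarrow> 'i filter \<Rightarrow> bool"
  where "wot_tendsto y x F \<longleftrightarrow>
    (\<forall>\<xi> \<eta>. ((\<lambda>i. cinner (blinfun_apply (y i) \<xi>) \<eta>) \<longlongrightarrow> cinner (blinfun_apply x \<xi>) \<eta>) F)"

lemma wot_tendsto_compose:
  assumes "wot_tendsto y x F" "a \<in> bounded_ops"
  shows "wot_tendsto (\<lambda>i. a o\<^sub>L y i o\<^sub>L b) (a o\<^sub>L x o\<^sub>L b) F"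
  using assms by (simp add: wot_tendsto_def flip: cinner_adj_right)

lemma tendsto_imp_wot_tendsto: "(y \<longlongrightarrow> x) F \<Longrightarrow> wot_tendsto y x F"
  unfolding wot_tendsto_def by (intro allI cinner.tendsto blinfun.tendsto tendsto_const)

text \<open>Compactness provides a cluster point b of the image filter. Intersecting
  \<open>F\<close> with the preimages of the neighbourhoods of b forces convergence, and the
  intersection stays proper exactly because b is a cluster point.\<close>

lemma ex_cluster_filter:
  assumes C: "compact C" and F: "F \<noteq> bot" and ev: "eventually (\<lambda>i. g i \<in> C) F"
  shows "\<exists>G\<le>F. G \<noteq> bot \<and> (\<exists>b\<in>C. filterlim g (nhds b) G)"
proof -
  obtain b where b: "b \<in> C" and ne: "inf (nhds b) (filtermap g F) \<noteq> bot"
    using compact_filter[THEN iffD1, OF C, rule_format, of "filtermap g F"] F ev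
    by (auto simp: eventually_filtermap filtermap_bot_iff)
  define G where "G = inf F (filtercomap g (nhds b))"
  have "G \<noteq> bot"
  proof
    assume "G = bot"
    then have "eventually (\<lambda>_. False) G"
      by simp
    then obtain P Q where P: "eventually P F" and Q: "eventually Q (filtercomap g (nhds b))"
      and PQ: "\<And>i. P i \<Longrightarrow> Q i \<Longrightarrow> False"
      unfolding G_def eventually_inf by blast
    obtain Q' where Q': "eventually Q' (nhds b)" "\<And>i. Q' (g i) \<Longrightarrow> Q i"
      using Q unfolding eventually_filtercomap by blast
    have "eventually (\<lambda>z. \<not> Q' z) (filtermap g F)"
      unfolding eventually_filtermap using P by eventually_elim (use PQ Q' in blast)
    then have "eventually (\<lambda>_. False) (inf (nhds b) (filtermap g F))"
      unfolding eventually_inf using Q'(1) by blast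
    then show False
      using ne by (simp add: eventually_False)
  qed
  moreover have "filterlim g (nhds b) G"
    unfolding G_def by (meson filterlim_filtercomap filterlim_inf inf_le2 filterlim_mono order_refl)
  moreover have "G \<le> F"
    by (simp add: G_def)
  ultimately show ?thesis
    using b by blast
qed

text \<open>Tychonoff's theorem, carried over to the topology of the function type.\<close>

lemma compact_PiE_UNIV:
  assumes "\<And>i. compact (S i :: 'b::topological_space set)"
  shows "compact (PiE UNIV S)"
  using assms compactin_PiE[of "\<lambda>_. euclidean" UNIV S]
  by (simp add: euclidean_product_topology)

section \<open>Weak closedness of a von Neumann algebra and weak compactness of its balls\<close>

locale vn_algebra =
  fixes M :: "('h::complex_hilbert_space \<Rightarrow>\<^sub>L 'h) set"
  assumes vn: "von_neumann_algebra M"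
begin

lemma in_bounded_ops: "x \<in> M \<Longrightarrow> x \<in> bounded_ops"
  using vn by (auto simp: von_neumann_algebra_def)

lemma id_in: "id_blinfun \<in> M"
  and add_in: "x \<in> M \<Longrightarrow> y \<in> M \<Longrightarrow> x + y \<in> M"
  and compose_in: "x \<in> M \<Longrightarrow> y \<in> M \<Longrightarrow> x o\<^sub>L y \<in> M"
  and scaleC_in: "x \<in> M \<Longrightarrow> a *\<^sub>C x \<in> M"
  and adj_in: "x \<in> M \<Longrightarrow> adj x \<in> M"
  using vn by (simp_all add: von_neumann_algebra_def)

lemma scaleR_in: "x \<in> M \<Longrightarrow> r *\<^sub>R x \<in> M"
  by (simp add: scaleR_eq_scaleC scaleC_in)

lemma zero_in: "0 \<in> M"
  using scaleR_in[OF id_in, of 0] by simp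

lemma uminus_in: "x \<in> M \<Longrightarrow> - x \<in> M"
  using scaleR_in[of x "-1"] by simp

lemma diff_in: "x \<in> M \<Longrightarrow> y \<in> M \<Longrightarrow> x - y \<in> M"
  using add_in[of x "- y"] by (simp add: uminus_in)

lemmas mem_intros = id_in add_in compose_in scaleC_in adj_in scaleR_in zero_in diff_in

text \<open>Commuting with a fixed \<open>T\<close> passes to weak limits: in a matrix coefficient,
  \<open>T\<close> on the right changes the first vector, and \<open>T\<close> on the left changes
  the second one by \<open>adj T\<close>. The bicommutant condition does the rest.\<close>

lemma wot_closed:
  assumes lim: "wot_tendsto y x F" and F: "F \<noteq> bot" and ev: "eventually (\<lambda>i. y i \<in> M) F"
    and x: "x \<in> bounded_ops"
  shows "x \<in> M"
proof -
  have "x o\<^sub>L T = T o\<^sub>L x" if T: "T \<in> commutant M" for T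
  proof (rule blinfun_eqI, rule cinner_eqI)
    fix \<xi> \<eta>
    have T': "T \<in> bounded_ops"
      using T by (simp add: commutant_def)
    have "((\<lambda>i. cinner (blinfun_apply (y i) (blinfun_apply T \<xi>)) \<eta>) \<longlongrightarrow>
        cinner (blinfun_apply x (blinfun_apply T \<xi>)) \<eta>) F"
      using lim by (simp add: wot_tendsto_def)
    moreover have "eventually (\<lambda>i. cinner (blinfun_apply (y i) (blinfun_apply T \<xi>)) \<eta> =
        cinner (blinfun_apply (y i) \<xi>) (blinfun_apply (adj T) \<eta>)) F"
      using ev
    proof eventually_elim
      case (elim i)
      then have "blinfun_apply (T o\<^sub>L y i) \<xi> = blinfun_apply (y i o\<^sub>L T) \<xi>"
        using T by (simp add: commutant_def)
      then show ?case
        by (simp add: cinner_adj_right T')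
    qed
    ultimately have "((\<lambda>i. cinner (blinfun_apply (y i) \<xi>) (blinfun_apply (adj T) \<eta>)) \<longlongrightarrow>
        cinner (blinfun_apply x (blinfun_apply T \<xi>)) \<eta>) F"
      by (rule Lim_transform_eventually)
    moreover have "((\<lambda>i. cinner (blinfun_apply (y i) \<xi>) (blinfun_apply (adj T) \<eta>)) \<longlongrightarrow>
        cinner (blinfun_apply x \<xi>) (blinfun_apply (adj T) \<eta>)) F"
      using lim by (simp add: wot_tendsto_def)
    ultimately have "cinner (blinfun_apply x (blinfun_apply T \<xi>)) \<eta> =
        cinner (blinfun_apply x \<xi>) (blinfun_apply (adj T) \<eta>)"
      by (rule tendsto_unique[OF F])
    then show "cinner (blinfun_apply (x o\<^sub>L T) \<xi>) \<eta> = cinner (blinfun_apply (T o\<^sub>L x) \<xi>) \<eta>"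
      by (simp add: cinner_adj_right T')
  qed
  then have "x \<in> commutant (commutant M)"
    using x by (simp add: commutant_def)
  then show ?thesis
    using vn by (simp add: von_neumann_algebra_def)
qed

text \<open>An operator of norm at most \<open>K\<close> is a point in the product, over all pairs
  of vectors, of the discs of radius K times the two norms. A cluster point of this compact product
  is a bounded sesquilinear form, hence an operator, and it lies in \<open>M\<close> by
  \<open>wot_closed\<close>.\<close>

lemma wot_compact:
  assumes F: "F \<noteq> bot" and K: "0 \<le> K" and ev: "eventually (\<lambda>i. y i \<in> M \<and> norm (y i) \<le> K) F"
  shows "\<exists>G\<le>F. G \<noteq> bot \<and> (\<exists>x\<in>M. norm x \<le> K \<and> wot_tendsto y x G)"
proof -
  define g where "g i p = cinner (blinfun_apply (y i) (fst p)) (snd p)" for i p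
  define C where "C = PiE UNIV (\<lambda>p :: 'h \<times> 'h. cball (0 :: complex) (K * norm (fst p) * norm (snd p)))"
  have "compact C"
    unfolding C_def by (rule compact_PiE_UNIV) simp
  moreover have "eventually (\<lambda>i. g i \<in> C) F"
    using ev
  proof eventually_elim
    case (elim i)
    have "cmod (cinner (blinfun_apply (y i) \<xi>) \<eta>) \<le> K * norm \<xi> * norm \<eta>" for \<xi> \<eta>
      by (rule order_trans[OF cmod_cinner_le]) (use elim in \<open>simp add: norm_apply_le mult_right_mono\<close>)
    then show ?case
      by (simp add: C_def g_def PiE_UNIV_domain)
  qed
  ultimately obtain G b where G: "G \<le> F" "G \<noteq> bot" and b: "b \<in> C" and lim: "filterlim g (nhds b) G"
    using ex_cluster_filter[OF _ F] by metis
  have "((\<lambda>i. g i p) \<longlongrightarrow> b p) G" for p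
  proof (rule topological_tendstoI)
    fix S assume "open S" "b p \<in> S"
    then have "eventually (\<lambda>z. z p \<in> S) (nhds b)"
      using open_vimage[OF _ continuous_on_product_coordinates[of p], of S]
      by (auto simp: eventually_nhds intro!: exI[of _ "(\<lambda>z. z p) -` S"])
    then show "eventually (\<lambda>i. g i p \<in> S) G"
      using lim unfolding filterlim_iff by blast
  qed
  then have lim: "((\<lambda>i. cinner (blinfun_apply (y i) \<xi>) \<eta>) \<longlongrightarrow> b (\<xi>, \<eta>)) G" for \<xi> \<eta>
    by (auto simp: g_def dest: spec[of _ "(\<xi>, \<eta>)"])
  have evG: "eventually (\<lambda>i. y i \<in> M) G"
    using ev G(1) by (metis (mono_tags, lifting) eventually_mono filter_leD)
  have uniq: "b (\<xi>, \<eta>) = c" if "((\<lambda>i. cinner (blinfun_apply (y i) \<xi>) \<eta>) \<longlongrightarrow> c) G" for \<xi> \<eta> c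
    using tendsto_unique[OF G(2) lim that] .
  \<comment> \<open>Homogeneity in the first variable relies on complex linearity of
    \<open>y i\<close>, which is available only eventually along the filter; the other three laws
    hold for every index.\<close>
  have "b (a *\<^sub>C \<xi>, \<eta>) = a * b (\<xi>, \<eta>)" for a \<xi> \<eta>
  proof (rule uniq)
    have "eventually (\<lambda>i. a * cinner (blinfun_apply (y i) \<xi>) \<eta> = cinner (blinfun_apply (y i) (a *\<^sub>C \<xi>)) \<eta>) G"
      using evG by eventually_elim (simp add: in_bounded_ops bounded_ops_scaleC cinner_scaleC_left)
    then show "((\<lambda>i. cinner (blinfun_apply (y i) (a *\<^sub>C \<xi>)) \<eta>) \<longlongrightarrow> a * b (\<xi>, \<eta>)) G"
      by (rule Lim_transform_eventually[rotated]) (intro tendsto_intros lim)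
  qed
  moreover have "b (\<xi>, a *\<^sub>C \<eta>) = cnj a * b (\<xi>, \<eta>)" for a \<xi> \<eta>
    by (rule uniq) (simp only: cinner_scaleC_right, intro tendsto_intros lim)
  moreover have "b (\<xi> + \<xi>', \<eta>) = b (\<xi>, \<eta>) + b (\<xi>', \<eta>)" for \<xi> \<xi>' \<eta>
    by (rule uniq) (simp only: blinfun.add_right cinner_add_left, intro tendsto_intros lim)
  moreover have "b (\<xi>, \<eta> + \<eta>') = b (\<xi>, \<eta>) + b (\<xi>, \<eta>')" for \<xi> \<eta> \<eta>'
    by (rule uniq) (simp only: cinner_add_right, intro tendsto_intros lim)
  ultimately have "sesquilinear (\<lambda>\<xi> \<eta>. b (\<xi>, \<eta>))"
    by (simp add: sesquilinear_def)
  moreover have "cmod (b (\<xi>, \<eta>)) \<le> K * norm \<xi> * norm \<eta>" for \<xi> \<eta>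
    using PiE_mem[OF b[unfolded C_def], of "(\<xi>, \<eta>)"] by simp
  ultimately obtain x where x: "x \<in> bounded_ops" "norm x \<le> K"
    "\<And>\<xi> \<eta>. cinner (blinfun_apply x \<xi>) \<eta> = b (\<xi>, \<eta>)"
    using ex_operator_of_form[of "\<lambda>\<xi> \<eta>. b (\<xi>, \<eta>)" K] K by blast
  have "wot_tendsto y x G"
    using lim by (simp add: wot_tendsto_def x)
  moreover have "x \<in> M"
    by (rule wot_closed[OF calculation G(2) evG x(1)])
  ultimately show ?thesis
    using G x by blast
qed

end

section \<open>Normal functionals\<close>

text \<open>Convergence may be tested on a subbasis: the condition survives finite intersections and
  arbitrary unions, which is an induction over the generated open sets.\<close>

lemma limitin_topology_generated_by:
  assumes "l \<in> \<Union>S" and "\<And>U. U \<in> S \<Longrightarrow> l \<in> U \<Longrightarrow> eventually (\<lambda>i. f i \<in> U) F"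
  shows "limitin (topology_generated_by S) f l F"
  unfolding limitin_def
proof (intro conjI allI impI)
  fix U assume U: "openin (topology_generated_by S) U \<and> l \<in> U"
  then have "generate_topology_on S U"
    by (simp add: openin_topology_generated_by_iff)
  then show "eventually (\<lambda>i. f i \<in> U) F"
    using U[THEN conjunct2]
  proof induction
    case (Int a b)
    then show ?case
      by (simp add: eventually_conj)
  next
    case (UN K)
    then obtain k where "k \<in> K" "l \<in> k" "eventually (\<lambda>i. f i \<in> k) F"
      by blast
    then show ?case
      by (auto elim: eventually_mono)
  qed (use assms in auto)
qed (use assms in simp)

abbreviation square_summable :: "(nat \<Rightarrow> 'h::real_normed_vector) \<Rightarrow> bool" where
  "square_summable \<xi> \<equiv> summable (\<lambda>n. (norm (\<xi> n))\<^sup>2)"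

lemma square_summable_apply:
  assumes "square_summable \<xi>"
  shows "square_summable (\<lambda>n. blinfun_apply T (\<xi> n))"
proof (rule summable_comparison_test')
  show "summable (\<lambda>n. (norm T)\<^sup>2 * (norm (\<xi> n))\<^sup>2)"
    using assms by (rule summable_mult)
  show "norm ((norm (blinfun_apply T (\<xi> n)))\<^sup>2) \<le> (norm T)\<^sup>2 * (norm (\<xi> n))\<^sup>2" for n
    using power_mono[OF norm_blinfun[of T "\<xi> n"], of 2] by (simp add: power_mult_distrib)
qed

abbreviation sigma_weak_set ::
  "(nat \<Rightarrow> 'h::complex_hilbert_space) \<Rightarrow> (nat \<Rightarrow> 'h) \<Rightarrow> complex set \<Rightarrow> ('h \<Rightarrow>\<^sub>L 'h) set" where
  "sigma_weak_set \<xi> \<eta> U \<equiv>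
    {T \<in> bounded_ops. (\<Sum>n. cinner (blinfun_apply T (\<xi> n)) (\<eta> n)) \<in> U}"

definition sigma_weak_subbasis :: "('h::complex_hilbert_space \<Rightarrow>\<^sub>L 'h) set set" where
  "sigma_weak_subbasis =
    {sigma_weak_set \<xi> \<eta> U | \<xi> \<eta> U. square_summable \<xi> \<and> square_summable \<eta> \<and> open U}"

lemma sigma_weak_subbasisI:
  "square_summable \<xi> \<Longrightarrow> square_summable \<eta> \<Longrightarrow> open U \<Longrightarrow> sigma_weak_set \<xi> \<eta> U \<in> sigma_weak_subbasis"
  unfolding sigma_weak_subbasis_def by blast

lemma sigma_weak_topology_eq: "sigma_weak_topology = topology_generated_by sigma_weak_subbasis"
  by (simp only: sigma_weak_topology_def sigma_weak_subbasis_def)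

lemma Union_sigma_weak_subbasis: "\<Union> sigma_weak_subbasis = bounded_ops"
proof
  have "sigma_weak_set (\<lambda>_. 0) (\<lambda>_. 0) UNIV \<in> sigma_weak_subbasis"
    by (rule sigma_weak_subbasisI) auto
  then show "bounded_ops \<subseteq> \<Union> sigma_weak_subbasis"
    by auto
qed (auto simp: sigma_weak_subbasis_def)

lemma topspace_sigma_weak: "topspace sigma_weak_topology = bounded_ops"
  unfolding sigma_weak_topology_eq topology_generated_by_topspace by (rule Union_sigma_weak_subbasis)

text \<open>On bounded sets weak convergence is already sigma-weak. Each term of the defining series
  converges, and the norm bound dominates the series uniformly, so Tannery's theorem exchanges limit
  and sum.\<close>

lemma limitin_sigma_weak:
  assumes lim: "wot_tendsto y x F" and x: "x \<in> bounded_ops"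
    and ev: "eventually (\<lambda>i. y i \<in> bounded_ops \<and> norm (y i) \<le> K) F"
  shows "limitin sigma_weak_topology y x F"
proof (cases "F = bot")
  case False
  show ?thesis
    unfolding sigma_weak_topology_eq
  proof (rule limitin_topology_generated_by)
    show "x \<in> \<Union> sigma_weak_subbasis"
      using x by (simp add: Union_sigma_weak_subbasis)
  next
    fix V
    assume "V \<in> sigma_weak_subbasis" and xV: "x \<in> V"
    then obtain \<xi> \<eta> U where V: "V = sigma_weak_set \<xi> \<eta> U"
      and ss: "square_summable \<xi>" "square_summable \<eta>" and U: "open U"
      unfolding sigma_weak_subbasis_def by blast
    have "((\<lambda>i. \<Sum>n. cinner (blinfun_apply (y i) (\<xi> n)) (\<eta> n)) \<longlongrightarrow>
        (\<Sum>n. cinner (blinfun_apply x (\<xi> n)) (\<eta> n))) F"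
    proof (rule tannerys_theorem[THEN conjunct2, THEN conjunct2])
      show "((\<lambda>i. cinner (blinfun_apply (y i) (\<xi> n)) (\<eta> n)) \<longlongrightarrow>
          cinner (blinfun_apply x (\<xi> n)) (\<eta> n)) F" for n
        using lim by (simp add: wot_tendsto_def)
      \<comment> \<open>The majorant comes from a b \<le> a^2 + b^2. The absolute value spares
        deriving 0 \<le> K from a bound that holds only eventually.\<close>
      show "summable (\<lambda>n. \<bar>K\<bar> * ((norm (\<xi> n))\<^sup>2 + (norm (\<eta> n))\<^sup>2))"
        by (intro summable_mult summable_add ss)
      have "eventually (\<lambda>i. \<forall>n. cmod (cinner (blinfun_apply (y i) (\<xi> n)) (\<eta> n)) \<le>
          \<bar>K\<bar> * ((norm (\<xi> n))\<^sup>2 + (norm (\<eta> n))\<^sup>2)) F"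
        using ev
      proof eventually_elim
        case (elim i)
        show ?case
        proof
          fix n
          have "norm (y i) \<le> \<bar>K\<bar>"
            using elim by linarith
          then have "cmod (cinner (blinfun_apply (y i) (\<xi> n)) (\<eta> n)) \<le>
              \<bar>K\<bar> * norm (\<xi> n) * norm (\<eta> n)"
            by (intro order_trans[OF cmod_cinner_le] mult_right_mono norm_apply_le) auto
          also have "\<dots> = \<bar>K\<bar> * (norm (\<xi> n) * norm (\<eta> n))"
            by (simp add: mult_ac)
          also have "\<dots> \<le> \<bar>K\<bar> * ((norm (\<xi> n))\<^sup>2 + (norm (\<eta> n))\<^sup>2)"
          proof (rule mult_left_mono)
            have "0 \<le> (norm (\<xi> n) - norm (\<eta> n))\<^sup>2 + (norm (\<xi> n))\<^sup>2 + (norm (\<eta> n))\<^sup>2"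
              by simp
            then show "norm (\<xi> n) * norm (\<eta> n) \<le> (norm (\<xi> n))\<^sup>2 + (norm (\<eta> n))\<^sup>2"
              unfolding power2_diff by (simp add: algebra_simps)
          qed simp
          finally show "cmod (cinner (blinfun_apply (y i) (\<xi> n)) (\<eta> n)) \<le>
              \<bar>K\<bar> * ((norm (\<xi> n))\<^sup>2 + (norm (\<eta> n))\<^sup>2)" .
        qed
      qed
      then show "eventually (\<lambda>(n, i). cmod (cinner (blinfun_apply (y i) (\<xi> n)) (\<eta> n)) \<le>
          \<bar>K\<bar> * ((norm (\<xi> n))\<^sup>2 + (norm (\<eta> n))\<^sup>2)) (at_top \<times>\<^sub>F F)"
        unfolding eventually_prod_filter
        by (intro exI[of _ "\<lambda>_. True"] exI[of _ "\<lambda>i. \<forall>n. cmod (cinner (blinfun_apply (y i) (\<xi> n)) (\<eta> n)) \<le>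
          \<bar>K\<bar> * ((norm (\<xi> n))\<^sup>2 + (norm (\<eta> n))\<^sup>2)"]) auto
    qed fact
    then have "eventually (\<lambda>i. (\<Sum>n. cinner (blinfun_apply (y i) (\<xi> n)) (\<eta> n)) \<in> U) F"
      using U xV V by (auto intro: topological_tendstoD)
    with ev show "eventually (\<lambda>i. y i \<in> V) F"
      unfolding V by eventually_elim simp
  qed
qed (use x in \<open>simp add: limitin_def topspace_sigma_weak\<close>)

context vn_algebra
begin

text \<open>This is how normality is applied to limits: sigma-weak continuity becomes weak
  continuity along nets that are eventually bounded.\<close>

lemma normal_tendsto:
  assumes \<omega>: "normal_functional M \<omega>" and lim: "wot_tendsto y x F" and x: "x \<in> M"
    and ev: "eventually (\<lambda>i. y i \<in> M \<and> norm (y i) \<le> K) F"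
  shows "((\<lambda>i. \<omega> (y i)) \<longlongrightarrow> \<omega> x) F"
proof -
  have "limitin sigma_weak_topology y x F"
    using lim in_bounded_ops[OF x]
  proof (rule limitin_sigma_weak)
    show "eventually (\<lambda>i. y i \<in> bounded_ops \<and> norm (y i) \<le> K) F"
      using ev by eventually_elim (simp add: in_bounded_ops)
  qed
  then have "limitin (subtopology sigma_weak_topology M) y x F"
    using ev x by (auto simp: limitin_subtopology elim: eventually_mono)
  then have "limitin euclidean (\<omega> \<circ> y) (\<omega> x) F"
    using \<omega> unfolding normal_functional_def by (blast intro: continuous_map_limit)
  then show ?thesis
    by (simp add: o_def)
qed

text \<open>If no constant worked, elements of \<open>M\<close> could be rescaled so that \<omega>
  has modulus 1 on them while their norms tend to 0, against continuity at 0.\<close>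

lemma normal_bounded:
  assumes \<omega>: "normal_functional M \<omega>"
  shows "\<exists>C\<ge>0. \<forall>x\<in>M. cmod (\<omega> x) \<le> C * norm x"
proof (rule ccontr)
  assume no: "\<not> ?thesis"
  have "\<exists>x\<in>M. real (Suc n) * norm x < cmod (\<omega> x)" for n
    using no by (metis linorder_not_le of_nat_0_le_iff)
  then obtain X where X: "\<And>n. X n \<in> M" "\<And>n. real (Suc n) * norm (X n) < cmod (\<omega> (X n))"
    by metis
  define Y where "Y n = (1 / cmod (\<omega> (X n))) *\<^sub>R X n" for n
  have pos: "0 < cmod (\<omega> (X n))" for n
    using X(2)[of n] by (meson mult_nonneg_nonneg norm_ge_zero of_nat_0_le_iff le_less_trans)
  have Y: "Y n \<in> M" for n
    unfolding Y_def by (intro mem_intros X)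
  have norm_Y: "norm (Y n) \<le> 1 / real (Suc n)" for n
    using X(2)[of n] pos[of n] by (simp add: Y_def field_simps)
  have "Y \<longlonglongrightarrow> 0"
    by (rule Lim_null_comparison[OF _ LIMSEQ_Suc[OF lim_1_over_n]]) (use norm_Y in simp)
  then have "wot_tendsto Y 0 sequentially"
    by (rule tendsto_imp_wot_tendsto)
  moreover have "norm (Y n) \<le> 1" for n
    using norm_Y[of n] by (rule order_trans) simp
  ultimately have "(\<lambda>n. \<omega> (Y n)) \<longlonglongrightarrow> \<omega> 0"
    using Y by (intro normal_tendsto[OF \<omega>, where K = 1]) (auto simp: zero_in)
  moreover have "\<omega> 0 = 0"
    using \<omega> id_in zero_in unfolding normal_functional_def clinear_on_def
    by (metis add_cancel_right_right add_0)
  moreover have "cmod (\<omega> (Y n)) = 1" for n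
  proof -
    have "\<omega> (Y n) = complex_of_real (1 / cmod (\<omega> (X n))) * \<omega> (X n)"
      using \<omega> X(1)
      by (simp add: normal_functional_def clinear_on_def Y_def scaleR_eq_scaleC scaleC_complex_def)
    then show ?thesis
      using pos[of n] by (simp add: norm_mult norm_divide)
  qed
  ultimately show False
    using tendsto_norm[of "\<lambda>n. \<omega> (Y n)" 0 sequentially] by (simp add: LIMSEQ_const_iff)
qed

text \<open>Moving \<open>a\<close> across the inner product shows that the preimage of a subbasic
  set under left multiplication is again subbasic: the sequence \<eta> is replaced by its image
  under \<open>adj a\<close>, which is still square-summable.\<close>

lemma normal_functional_compose_left:
  assumes \<omega>: "normal_functional M \<omega>" and a: "a \<in> M"
  shows "normal_functional M (\<lambda>x. \<omega> (a o\<^sub>L x))"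
proof -
  have a': "a \<in> bounded_ops"
    using a by (rule in_bounded_ops)
  have a_ops: "a o\<^sub>L T \<in> bounded_ops" if "T \<in> bounded_ops" for T :: "'h \<Rightarrow>\<^sub>L 'h"
    using a' that by (simp add: bounded_ops_def)
  have "continuous_map sigma_weak_topology sigma_weak_topology (\<lambda>x :: 'h \<Rightarrow>\<^sub>L 'h. a o\<^sub>L x)"
    unfolding sigma_weak_topology_eq
  proof (rule continuous_on_generated_topo, unfold sigma_weak_topology_eq[symmetric] topspace_sigma_weak)
    show "(\<lambda>x :: 'h \<Rightarrow>\<^sub>L 'h. a o\<^sub>L x) ` bounded_ops \<subseteq> \<Union> sigma_weak_subbasis"
      using a_ops by (auto simp: Union_sigma_weak_subbasis)
  next
    fix V :: "('h \<Rightarrow>\<^sub>L 'h) set" assume "V \<in> sigma_weak_subbasis"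
    then obtain \<xi> \<eta> U where V: "V = sigma_weak_set \<xi> \<eta> U"
      and ss: "square_summable \<xi>" "square_summable \<eta>" and U: "open U"
      unfolding sigma_weak_subbasis_def by blast
    have "(\<lambda>x :: 'h \<Rightarrow>\<^sub>L 'h. a o\<^sub>L x) -` V \<inter> bounded_ops = sigma_weak_set \<xi> (\<lambda>n. blinfun_apply (adj a) (\<eta> n)) U"
      unfolding V using a' a_ops by (auto simp: cinner_adj_right)
    also have "openin sigma_weak_topology \<dots>"
      unfolding sigma_weak_topology_eq
      using ss U by (intro topology_generated_by_Basis sigma_weak_subbasisI square_summable_apply)
    finally show "openin sigma_weak_topology ((\<lambda>x :: 'h \<Rightarrow>\<^sub>L 'h. a o\<^sub>L x) -` V \<inter> bounded_ops)" .
  qed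
  then have "continuous_map (subtopology sigma_weak_topology M)
      (subtopology sigma_weak_topology M) (\<lambda>x :: 'h \<Rightarrow>\<^sub>L 'h. a o\<^sub>L x)"
    using a unfolding continuous_map_in_subtopology
    by (auto simp: compose_in intro: continuous_map_from_subtopology)
  moreover have "continuous_map (subtopology sigma_weak_topology M) euclidean \<omega>"
    using \<omega> by (simp add: normal_functional_def)
  ultimately have cont: "continuous_map (subtopology sigma_weak_topology M) euclidean (\<omega> \<circ> (\<lambda>x :: 'h \<Rightarrow>\<^sub>L 'h. a o\<^sub>L x))"
    by (rule continuous_map_compose)
  have "a o\<^sub>L (c *\<^sub>C x) = c *\<^sub>C (a o\<^sub>L x)" for c and x :: "'h \<Rightarrow>\<^sub>L 'h"
    by (rule blinfun_eqI) (simp add: scaleC_blinfun_apply bounded_ops_scaleC a')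
  moreover have "a o\<^sub>L (x + y) = (a o\<^sub>L x) + (a o\<^sub>L y)" for x y :: "'h \<Rightarrow>\<^sub>L 'h"
    by (rule blinfun_eqI) (simp add: blinfun.add_left blinfun.add_right)
  ultimately have "clinear_on M (\<lambda>x. \<omega> (a o\<^sub>L x))"
    using \<omega> a by (simp add: normal_functional_def clinear_on_def compose_in scaleC_in)
  with cont show ?thesis
    by (simp add: normal_functional_def o_def)
qed

end

section \<open>The 2-norm of a faithful normal state\<close>

lemma compose_add_right: "a o\<^sub>L (x + y) = (a o\<^sub>L x) + (a o\<^sub>L y)"
  for a :: "'b::real_normed_vector \<Rightarrow>\<^sub>L 'c::real_normed_vector"
  by (rule blinfun_eqI) (simp add: blinfun.add_left blinfun.add_right)

lemma compose_add_left: "(x + y) o\<^sub>L a = (x o\<^sub>L a) + (y o\<^sub>L a)"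
  by (rule blinfun_eqI) (simp add: blinfun.add_left)

lemma compose_diff_right: "a o\<^sub>L (x - y) = (a o\<^sub>L x) - (a o\<^sub>L y)"
  for a :: "'b::real_normed_vector \<Rightarrow>\<^sub>L 'c::real_normed_vector"
  by (rule blinfun_eqI) (simp add: blinfun.diff_left blinfun.diff_right)

lemma compose_diff_left: "(x - y) o\<^sub>L a = (x o\<^sub>L a) - (y o\<^sub>L a)"
  by (rule blinfun_eqI) (simp add: blinfun.diff_left)

lemma compose_scaleC_left: "(c *\<^sub>C x) o\<^sub>L a = c *\<^sub>C (x o\<^sub>L a)"
  by (rule blinfun_eqI) (simp add: scaleC_blinfun_apply)

lemma compose_scaleC_right: "a \<in> bounded_ops \<Longrightarrow> a o\<^sub>L (c *\<^sub>C x) = c *\<^sub>C (a o\<^sub>L x)"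
  by (rule blinfun_eqI) (simp add: scaleC_blinfun_apply bounded_ops_scaleC)

lemma compose_assoc: "(a o\<^sub>L b) o\<^sub>L c = a o\<^sub>L (b o\<^sub>L c)"
  by (rule blinfun_eqI) simp

lemma compose_id_left: "id_blinfun o\<^sub>L a = a"
  by (rule blinfun_eqI) simp

text \<open>Polarization: expanding the quadratic form at x + y compares imaginary parts of the two
  mixed coefficients, and replacing x by i x compares their real parts.\<close>

lemma self_adjointI:
  assumes T: "T \<in> bounded_ops" and real: "\<And>\<xi>. Im (cinner (blinfun_apply T \<xi>) \<xi>) = 0"
  shows "adj T = T"
proof (rule adj_eqI)
  have Im_eq: "Im (cinner (blinfun_apply T x) y) + Im (cinner (blinfun_apply T y) x) = 0" for x y
    using real[of "x + y"] real[of x] real[of y]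
    by (simp add: blinfun.add_right cinner_add_left cinner_add_right)
  have Re_eq: "Re (cinner (blinfun_apply T x) y) - Re (cinner (blinfun_apply T y) x) = 0" for x y
    using Im_eq[of "\<i> *\<^sub>C x" y]
    by (simp add: bounded_ops_scaleC T cinner_scaleC_left cinner_scaleC_right)
  fix x y
  have "cinner (blinfun_apply T x) y = cnj (cinner (blinfun_apply T y) x)"
    using Im_eq[of x y] Re_eq[of x y] by (simp add: complex_eq_iff)
  then show "cinner (blinfun_apply T x) y = cinner x (blinfun_apply T y)"
    by (metis cinner_commute)
qed

text \<open>For self-adjoint \<open>T\<close>, four times Re \<langle>T x, y\<rangle> is the
  difference of the quadratic form at x + y and x - y. The bound and the parallelogram law estimate
  it by 2 K (|x|^2 + |y|^2), and a suitable y turns the left side into the norm of T x.\<close>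

lemma norm_le_numerical_radius:
  assumes T: "T \<in> bounded_ops" and sa: "adj T = T" and K: "0 \<le> K"
    and bound: "\<And>\<xi>. \<bar>Re (cinner (blinfun_apply T \<xi>) \<xi>)\<bar> \<le> K * (norm \<xi>)\<^sup>2"
  shows "norm T \<le> K"
proof (rule norm_blinfun_bound)
  fix x
  show "norm (blinfun_apply T x) \<le> K * norm x"
  proof (cases "blinfun_apply T x = 0")
    case False
    \<comment> \<open>The factor stretches T x to the length of x, so that y is parallel to T x and
      |x|^2 + |y|^2 = 2 |x|^2.\<close>
    define r where "r = norm x / norm (blinfun_apply T x)"
    define y where "y = r *\<^sub>R blinfun_apply T x"
    have norm_y: "norm y = norm x"
      using False by (simp add: y_def r_def)
    have "Re (cinner (blinfun_apply T y) x) = Re (cinner (blinfun_apply T x) y)"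
      using cinner_adj_left[OF T, of y x] unfolding sa by (metis cinner_commute cnj.simps(1))
    then have "4 * Re (cinner (blinfun_apply T x) y) =
        Re (cinner (blinfun_apply T (x + y)) (x + y)) - Re (cinner (blinfun_apply T (x - y)) (x - y))"
      by (simp add: blinfun.add_right blinfun.diff_right cinner_add_left cinner_add_right
          cinner.diff_left cinner.diff_right)
    also have "\<dots> \<le> K * (norm (x + y))\<^sup>2 + K * (norm (x - y))\<^sup>2"
      using bound[of "x + y"] bound[of "x - y"] by linarith
    also have "\<dots> = K * ((norm (x + y))\<^sup>2 + (norm (x - y))\<^sup>2)"
      by (simp add: distrib_left)
    also have "(norm (x + y))\<^sup>2 + (norm (x - y))\<^sup>2 = 2 * (norm x)\<^sup>2 + 2 * (norm y)\<^sup>2"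
      by (simp add: power2_norm_eq_inner algebra_simps)
    also have "K * (2 * (norm x)\<^sup>2 + 2 * (norm y)\<^sup>2) = 4 * (K * norm x * norm x)"
      by (simp add: norm_y power2_eq_square)
    finally have "Re (cinner (blinfun_apply T x) y) \<le> K * norm x * norm x"
      by simp
    moreover have "Re (cinner (blinfun_apply T x) y) = norm (blinfun_apply T x) * norm x"
      using False
      by (simp add: y_def r_def scaleR_eq_scaleC cinner_scaleC_right cinner_self power2_eq_square
          flip: inner_eq_Re_cinner)
    ultimately have *: "norm (blinfun_apply T x) * norm x \<le> K * norm x * norm x"
      by simp
    have "x \<noteq> 0"
      using False by auto
    with * show ?thesis
      by simp
  qed (use K in simp)
qed (rule K)

section \<open>The sesquilinear form and the 2-norm of a state\<close>

locale vn_state = vn_algebra M for M :: "('h::complex_hilbert_space \<Rightarrow>\<^sub>L 'h) set" +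
  fixes \<phi> :: "('h \<Rightarrow>\<^sub>L 'h) \<Rightarrow> complex"
  assumes faithful_normal: "faithful_normal_state M \<phi>"
begin

lemma normal: "normal_functional M \<phi>"
  using faithful_normal by (simp add: faithful_normal_state_def)

lemma phi_add: "x \<in> M \<Longrightarrow> y \<in> M \<Longrightarrow> \<phi> (x + y) = \<phi> x + \<phi> y"
  and phi_scaleC: "x \<in> M \<Longrightarrow> \<phi> (a *\<^sub>C x) = a * \<phi> x"
  and phi_id: "\<phi> id_blinfun = 1"
  and phi_square: "x \<in> M \<Longrightarrow> \<phi> (adj x o\<^sub>L x) \<in> \<real>\<^sub>\<ge>\<^sub>0"
  and faithful: "x \<in> M \<Longrightarrow> \<phi> (adj x o\<^sub>L x) = 0 \<Longrightarrow> x = 0"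
  using faithful_normal
  by (simp_all add: faithful_normal_state_def state_def clinear_on_def scaleC_complex_def)

lemma phi_zero: "\<phi> 0 = 0"
  using phi_add[OF zero_in zero_in] by simp

lemma phi_diff: "x \<in> M \<Longrightarrow> y \<in> M \<Longrightarrow> \<phi> (x - y) = \<phi> x - \<phi> y"
  using phi_add[of "x - y" y] by (simp add: diff_in)

lemma norm2_nonneg: "x \<in> M \<Longrightarrow> 0 \<le> norm2 \<phi> x"
  using phi_square[of x] by (simp add: norm2_def complex_nonneg_Reals_iff)

lemma phi_self: "x \<in> M \<Longrightarrow> \<phi> (adj x o\<^sub>L x) = complex_of_real ((norm2 \<phi> x)\<^sup>2)"
  using phi_square[of x] by (simp add: norm2_def complex_nonneg_Reals_iff complex_eq_iff)

lemma form_expand: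
  assumes x: "x \<in> M" and y: "y \<in> M"
  shows "\<phi> (adj (x + a *\<^sub>C y) o\<^sub>L (x + a *\<^sub>C y)) =
    \<phi> (adj x o\<^sub>L x) + a * \<phi> (adj x o\<^sub>L y) + cnj a * \<phi> (adj y o\<^sub>L x) + a * cnj a * \<phi> (adj y o\<^sub>L y)"
  using assms
  by (simp add: adj_add adj_scaleC in_bounded_ops mem_intros compose_add_left compose_add_right
      compose_scaleC_left compose_scaleC_right phi_add phi_scaleC algebra_simps)

text \<open>The state is known to be real only on squares. Expanding the square of x + a y for a = 1
  and a = i extracts the imaginary and the real parts of the mixed terms.\<close>

lemma form_commute:
  assumes x: "x \<in> M" and y: "y \<in> M"
  shows "\<phi> (adj x o\<^sub>L y) = cnj (\<phi> (adj y o\<^sub>L x))"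
proof -
  have im: "Im (\<phi> (adj z o\<^sub>L z)) = 0" if "z \<in> M" for z
    using phi_self[OF that] by simp
  have "Im (\<phi> (adj x o\<^sub>L y)) + Im (\<phi> (adj y o\<^sub>L x)) = 0"
    using form_expand[OF x y, of 1] im[of "x + 1 *\<^sub>C y"] im[OF x] im[OF y] x y by (simp add: mem_intros)
  moreover have "Re (\<phi> (adj x o\<^sub>L y)) = Re (\<phi> (adj y o\<^sub>L x))"
    using form_expand[OF x y, of \<i>] im[of "x + \<i> *\<^sub>C y"] im[OF x] im[OF y] x y by (simp add: mem_intros)
  ultimately show ?thesis
    by (simp add: complex_eq_iff)
qed

lemma norm2_expand:
  assumes x: "x \<in> M" and y: "y \<in> M"
  shows "(norm2 \<phi> (x + a *\<^sub>C y))\<^sup>2 =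
    (norm2 \<phi> x)\<^sup>2 + 2 * Re (cnj a * \<phi> (adj y o\<^sub>L x)) + (cmod a)\<^sup>2 * (norm2 \<phi> y)\<^sup>2"
proof -
  have "complex_of_real ((norm2 \<phi> (x + a *\<^sub>C y))\<^sup>2) = complex_of_real ((norm2 \<phi> x)\<^sup>2) +
      (cnj a * \<phi> (adj y o\<^sub>L x) + cnj (cnj a * \<phi> (adj y o\<^sub>L x))) +
      complex_of_real ((cmod a)\<^sup>2 * (norm2 \<phi> y)\<^sup>2)"
    using form_expand[OF x y, of a] form_commute[OF x y] complex_norm_square[of a]
    by (simp add: x y mem_intros phi_self)
  also have "\<dots> = complex_of_real ((norm2 \<phi> x)\<^sup>2 + 2 * Re (cnj a * \<phi> (adj y o\<^sub>L x)) +
      (cmod a)\<^sup>2 * (norm2 \<phi> y)\<^sup>2)"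
    unfolding complex_add_cnj by simp
  finally show ?thesis
    using of_real_eq_iff by blast
qed

text \<open>The square of the 2-norm of x - s c y is nonnegative for every real s, where c is the
  mixed term. The resulting polynomial in s is evaluated at one point, depending on whether
  \<open>y\<close> has 2-norm 0.\<close>

lemma cauchy_schwarz:
  assumes x: "x \<in> M" and y: "y \<in> M"
  shows "cmod (\<phi> (adj y o\<^sub>L x)) \<le> norm2 \<phi> x * norm2 \<phi> y"
proof -
  define c where "c = \<phi> (adj y o\<^sub>L x)"
  define A B where "A = (norm2 \<phi> x)\<^sup>2" and "B = (norm2 \<phi> y)\<^sup>2"
  have AB: "0 \<le> A" "0 \<le> B"
    by (simp_all add: A_def B_def)
  have ineq: "0 \<le> A - 2 * s * (cmod c)\<^sup>2 + s\<^sup>2 * (cmod c)\<^sup>2 * B" for s :: real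
  proof -
    have "0 \<le> (norm2 \<phi> (x + (- of_real s * c) *\<^sub>C y))\<^sup>2"
      by simp
    also have "\<dots> = A + 2 * Re (cnj (- of_real s * c) * c) + (cmod (- of_real s * c))\<^sup>2 * B"
      unfolding norm2_expand[OF x y] by (simp add: A_def B_def c_def)
    also have "Re (cnj (- of_real s * c) * c) = - s * (cmod c)\<^sup>2"
      unfolding cmod_power2 by (simp add: power2_eq_square algebra_simps)
    finally show ?thesis
      by (simp add: norm_mult power_mult_distrib)
  qed
  have "(cmod c)\<^sup>2 \<le> A * B"
  proof (cases "B = 0")
    case True
    show ?thesis
    proof (rule ccontr)
      assume "\<not> ?thesis"
      then have "0 < (cmod c)\<^sup>2"
        using AB by (simp add: True)
      then show False
        \<comment> \<open>With B = 0 the polynomial is affine in s, and this value of s makes it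
          equal to - A - 2.\<close>
        using ineq[of "(A + 1) / (cmod c)\<^sup>2"] AB(1) by (simp add: True)
    qed
  next
    case False
    then have "0 < B"
      using AB by simp
    then show ?thesis
      \<comment> \<open>The minimum over s is attained at 1 / B and equals A - |c|^2 / B.\<close>
      using ineq[of "1 / B"] by (simp add: field_simps power2_eq_square)
  qed
  then have "(cmod c)\<^sup>2 \<le> (norm2 \<phi> x * norm2 \<phi> y)\<^sup>2"
    by (simp add: A_def B_def power_mult_distrib)
  then show ?thesis
    unfolding c_def
    by (rule power2_le_imp_le) (simp add: norm2_nonneg x y)
qed

lemma norm2_zero: "norm2 \<phi> 0 = 0"
proof -
  have "a o\<^sub>L (0 :: 'h \<Rightarrow>\<^sub>L 'h) = 0" for a :: "'h \<Rightarrow>\<^sub>L 'h"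
    by (rule blinfun_eqI) simp
  then show ?thesis
    by (simp add: norm2_def phi_zero)
qed

lemma norm2_scaleC:
  assumes x: "x \<in> M"
  shows "norm2 \<phi> (a *\<^sub>C x) = cmod a * norm2 \<phi> x"
proof (rule power2_eq_imp_eq)
  have "adj x o\<^sub>L (0 :: 'h \<Rightarrow>\<^sub>L 'h) = 0"
    by (rule blinfun_eqI) simp
  then show "(norm2 \<phi> (a *\<^sub>C x))\<^sup>2 = (cmod a * norm2 \<phi> x)\<^sup>2"
    using norm2_expand[OF zero_in x, of a] by (simp add: norm2_zero phi_zero power_mult_distrib)
qed (use x in \<open>simp_all add: norm2_nonneg scaleC_in\<close>)

lemma norm2_triangle:
  assumes x: "x \<in> M" and y: "y \<in> M"
  shows "norm2 \<phi> (x + y) \<le> norm2 \<phi> x + norm2 \<phi> y"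
proof (rule power2_le_imp_le)
  have "Re (\<phi> (adj y o\<^sub>L x)) \<le> norm2 \<phi> x * norm2 \<phi> y"
    using cauchy_schwarz[OF x y] complex_Re_le_cmod order_trans by blast
  then show "(norm2 \<phi> (x + y))\<^sup>2 \<le> (norm2 \<phi> x + norm2 \<phi> y)\<^sup>2"
    using norm2_expand[OF x y, of 1] by (simp add: scaleC_one power2_sum)
qed (use norm2_nonneg assms in simp)

lemma norm2_uminus: "x \<in> M \<Longrightarrow> norm2 \<phi> (- x) = norm2 \<phi> x"
  using norm2_scaleC[of x "-1"] by (simp add: scaleC_uminus_one)

lemma norm2_diff_commute: "x \<in> M \<Longrightarrow> y \<in> M \<Longrightarrow> norm2 \<phi> (x - y) = norm2 \<phi> (y - x)"
  using norm2_uminus[of "x - y"] by (simp add: diff_in)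

lemma norm2_eq_zero_iff: "x \<in> M \<Longrightarrow> norm2 \<phi> x = 0 \<longleftrightarrow> x = 0"
  using faithful[of x] phi_self[of x] norm2_zero by auto

lemma norm2_id: "norm2 \<phi> id_blinfun = 1"
  by (simp add: norm2_def adj_id compose_id_left phi_id)

section \<open>Positivity and monotonicity of the state\<close>

lemma cmod_phi_le: "x \<in> M \<Longrightarrow> cmod (\<phi> x) \<le> norm2 \<phi> x"
  using cauchy_schwarz[OF _ id_in, of x] by (simp add: norm2_id adj_id compose_id_left)

text \<open>Normality gives only a bound with some constant C. Repeated squaring removes it: by
  Cauchy-Schwarz against the identity, |\<phi>(p)|^2 \<le> \<phi>(p^2) for self-adjoint p, so the
  2^n-th power of |\<phi>(h)| / |h| stays below C for all n, and the ratio is at most 1.\<close>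

lemma cmod_phi_le_norm:
  assumes h: "h \<in> M" and sa: "adj h = h"
  shows "cmod (\<phi> h) \<le> norm h"
proof (rule ccontr)
  assume "\<not> ?thesis"
  then have less: "norm h < cmod (\<phi> h)"
    by simp
  \<comment> \<open>Here \<open>p n\<close> is the 2^n-th power of \<open>h\<close>.\<close>
  define p where "p n = ((\<lambda>T. T o\<^sub>L T) ^^ n) h" for n
  have p_Suc: "p (Suc n) = p n o\<^sub>L p n" for n
    by (simp add: p_def)
  have p: "p n \<in> M \<and> adj (p n) = p n \<and> norm (p n) \<le> norm h ^ (2 ^ n) \<and> cmod (\<phi> h) ^ (2 ^ n) \<le> cmod (\<phi> (p n))" for n
  proof (induction n)
    case 0
    then show ?case
      using h sa by (simp add: p_def)
  next
    case (Suc n)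
    have "cmod (\<phi> h) ^ (2 ^ Suc n) = (cmod (\<phi> h) ^ (2 ^ n))\<^sup>2"
      by (simp add: power_mult[symmetric] mult.commute)
    also have "\<dots> \<le> (cmod (\<phi> (p n)))\<^sup>2"
      using Suc by (intro power_mono) auto
    also have "\<dots> \<le> (norm2 \<phi> (p n))\<^sup>2"
      using Suc cmod_phi_le by (intro power_mono) auto
    also have "\<dots> = cmod (\<phi> (p (Suc n)))"
      using phi_self[of "p n"] Suc by (simp add: p_Suc norm_power)
    finally have "cmod (\<phi> h) ^ (2 ^ Suc n) \<le> cmod (\<phi> (p (Suc n)))" .
    moreover have "norm (p (Suc n)) \<le> norm h ^ (2 ^ Suc n)"
    proof -
      have "norm (p (Suc n)) \<le> norm (p n) * norm (p n)"
        unfolding p_Suc by (rule norm_blinfun_compose)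
      also have "\<dots> \<le> norm h ^ (2 ^ n) * norm h ^ (2 ^ n)"
        using Suc by (intro mult_mono) auto
      finally show ?thesis
        by (simp add: power_add[symmetric] mult_2)
    qed
    ultimately show ?case
      using Suc by (simp add: p_Suc compose_in adj_compose in_bounded_ops)
  qed
  obtain C where C: "0 \<le> C" "\<And>x. x \<in> M \<Longrightarrow> cmod (\<phi> x) \<le> C * norm x"
    using normal_bounded[OF normal] by blast
  have "0 < norm h"
    using less C(2)[OF h] by (cases "norm h = 0") auto
  define q where "q = cmod (\<phi> h) / norm h"
  have q: "1 < q"
    using less \<open>0 < norm h\<close> by (simp add: q_def)
  have "q ^ n \<le> C" for n
  proof -
    have "cmod (\<phi> h) ^ (2 ^ n) \<le> C * norm h ^ (2 ^ n)"
      using p[of n] C(2)[of "p n"] C(1) by (meson mult_left_mono order_trans)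
    then have "q ^ (2 ^ n) \<le> C"
      using \<open>0 < norm h\<close> by (simp add: q_def power_divide field_simps)
    moreover have "q ^ n \<le> q ^ (2 ^ n)"
      using q by (intro power_increasing) (auto simp: less_imp_le)
    ultimately show ?thesis
      by simp
  qed
  then show False
    using real_arch_pow[OF q, of C] by (auto simp: not_less[symmetric])
qed

text \<open>As \<open>\<phi>(1) = 1\<close>, contractivity on self-adjoint operators gives positivity, because
  \<open>\<parallel>\<parallel>p\<parallel> - p\<parallel> \<le> \<parallel>p\<parallel>\<close>; this avoids square roots of operators.\<close>

lemma phi_positive:
  assumes p: "p \<in> M" and pos: "\<And>\<xi>. cinner (blinfun_apply p \<xi>) \<xi> \<in> \<real>\<^sub>\<ge>\<^sub>0"
  shows "0 \<le> Re (\<phi> p)"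
proof -
  define c where "c = norm p"
  define q where "q = complex_of_real c *\<^sub>C id_blinfun - p"
  have q: "q \<in> M"
    unfolding q_def by (intro mem_intros p)
  have qq: "cinner (blinfun_apply q \<xi>) \<xi> = c * (norm \<xi>)\<^sup>2 - cinner (blinfun_apply p \<xi>) \<xi>" for \<xi>
    by (simp add: q_def blinfun.diff_left scaleC_blinfun_apply cinner.diff_left cinner_scaleC_left cinner_self)
  have sa: "adj q = q"
    using pos by (intro self_adjointI in_bounded_ops q) (simp add: qq complex_nonneg_Reals_iff)
  have "Re (cinner (blinfun_apply p \<xi>) \<xi>) \<le> c * (norm \<xi>)\<^sup>2" for \<xi>
  proof -
    have "Re (cinner (blinfun_apply p \<xi>) \<xi>) \<le> norm (blinfun_apply p \<xi>) * norm \<xi>"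
      using complex_Re_le_cmod cmod_cinner_le order_trans by blast
    also have "\<dots> \<le> (c * norm \<xi>) * norm \<xi>"
      by (intro mult_right_mono norm_apply_le) (auto simp: c_def)
    finally show ?thesis
      by (simp add: power2_eq_square mult.assoc)
  qed
  then have "\<bar>Re (cinner (blinfun_apply q \<xi>) \<xi>)\<bar> \<le> c * (norm \<xi>)\<^sup>2" for \<xi>
    using pos[of \<xi>] by (simp add: qq complex_nonneg_Reals_iff)
  then have "norm q \<le> c"
    by (intro norm_le_numerical_radius in_bounded_ops q sa) (simp_all add: c_def)
  then have "Re (\<phi> q) \<le> c"
    using cmod_phi_le_norm[OF q sa] complex_Re_le_cmod[of "\<phi> q"] by linarith
  moreover have "\<phi> q = c - \<phi> p"
    using p by (simp add: q_def phi_diff phi_scaleC phi_id mem_intros)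
  ultimately show ?thesis
    by simp
qed

lemma phi_mono:
  assumes "p \<in> M" "q \<in> M"
    and "\<And>\<xi>. cinner (blinfun_apply q \<xi>) \<xi> - cinner (blinfun_apply p \<xi>) \<xi> \<in> \<real>\<^sub>\<ge>\<^sub>0"
  shows "Re (\<phi> p) \<le> Re (\<phi> q)"
  using phi_positive[of "q - p"] assms
  by (simp add: diff_in blinfun.diff_left cinner.diff_left phi_diff)

text \<open>As quadratic forms, the square of x y is at most |x|^2 times the square of y, and the
  state is monotone. The estimate is special to left factors.\<close>

lemma norm2_compose_le:
  assumes x: "x \<in> M" and y: "y \<in> M"
  shows "norm2 \<phi> (x o\<^sub>L y) \<le> norm x * norm2 \<phi> y"
proof (rule power2_le_imp_le)
  have self: "cinner (blinfun_apply (adj z o\<^sub>L z) \<xi>) \<xi> = complex_of_real ((norm (blinfun_apply z \<xi>))\<^sup>2)"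
    if "z \<in> M" for z \<xi>
    using that by (simp add: cinner_adj_left in_bounded_ops cinner_self)
  have "Re (\<phi> (adj (x o\<^sub>L y) o\<^sub>L (x o\<^sub>L y))) \<le>
      Re (\<phi> (complex_of_real ((norm x)\<^sup>2) *\<^sub>C (adj y o\<^sub>L y)))"
  proof (rule phi_mono)
    fix \<xi>
    have "(norm (blinfun_apply (x o\<^sub>L y) \<xi>))\<^sup>2 \<le> (norm x * norm (blinfun_apply y \<xi>))\<^sup>2"
      by (intro power_mono) (simp_all add: norm_blinfun)
    then show "cinner (blinfun_apply (complex_of_real ((norm x)\<^sup>2) *\<^sub>C (adj y o\<^sub>L y)) \<xi>) \<xi> -
        cinner (blinfun_apply (adj (x o\<^sub>L y) o\<^sub>L (x o\<^sub>L y)) \<xi>) \<xi> \<in> \<real>\<^sub>\<ge>\<^sub>0"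
      unfolding scaleC_blinfun_apply cinner_scaleC_left self[OF y] self[OF compose_in[OF x y]]
      by (simp add: complex_nonneg_Reals_iff power_mult_distrib del: blinfun_apply_blinfun_compose)
  qed (use x y in \<open>simp_all add: mem_intros\<close>)
  then show "(norm2 \<phi> (x o\<^sub>L y))\<^sup>2 \<le> (norm x * norm2 \<phi> y)\<^sup>2"
    using x y by (simp add: phi_self phi_scaleC mem_intros power_mult_distrib)
qed (use y norm2_nonneg in simp)

end

section \<open>Completeness and separability of the unit ball\<close>

text \<open>Balls of radius 1/(n+1) around a countable dense set form a base. The gain is that
  second countability, unlike separability, is inherited by subspaces of any topological
  space.\<close>

lemma (in Metric_space) separable_imp_second_countable:
  assumes "separable_space mtopology"
  shows "second_countable mtopology"
proof -
  obtain C where C: "countable C" "C \<subseteq> M" "mtopology closure_of C = M"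
    using assms by (auto simp: separable_space_def)
  define B where "B = (\<lambda>(c, n). mball c (1 / real (Suc n))) ` (C \<times> UNIV)"
  have "\<exists>V\<in>B. x \<in> V \<and> V \<subseteq> U" if U: "openin mtopology U" and x: "x \<in> U" for U x
  proof -
    obtain r where r: "0 < r" "mball x r \<subseteq> U"
      using U x by (auto simp: openin_mtopology)
    \<comment> \<open>Half of \<open>r\<close>: the centre lies within 1/(n+1) of \<open>x\<close>,
      and the small ball adds another 1/(n+1).\<close>
    obtain n where n: "1 / real (Suc n) < r / 2"
      using r nat_approx_posE[of "r / 2"] by auto
    have xM: "x \<in> M"
      using U x openin_subset by fastforce
    then have "x \<in> mtopology closure_of C"
      using C by simp
    then obtain c where c: "c \<in> C" "d x c < 1 / real (Suc n)"
      unfolding metric_closure_of by (auto simp: dest: spec[of _ "1 / real (Suc n)"])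
    have cM: "c \<in> M"
      using c C by blast
    have "mball c (1 / real (Suc n)) \<subseteq> mball x r"
    proof
      fix z assume z: "z \<in> mball c (1 / real (Suc n))"
      then have "d x z \<le> d x c + d c z"
        using triangle xM cM by auto
      then show "z \<in> mball x r"
        using z c(2) n xM by auto
    qed
    moreover have "x \<in> mball c (1 / real (Suc n))"
      using c cM xM by (simp add: commute)
    moreover have "mball c (1 / real (Suc n)) \<in> B"
      using c(1) by (auto simp: B_def)
    ultimately show ?thesis
      using r(2) by blast
  qed
  moreover have "countable B"
    unfolding B_def using C by auto
  moreover have "\<forall>V\<in>B. openin mtopology V"
    by (auto simp: B_def)
  ultimately show ?thesis
    unfolding second_countable_def by blast
qed

text \<open>The dense points can be chosen inside \<open>A\<close> itself, since the subspace is
  second countable and hence separable.\<close>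

lemma (in Metric_space) separable_subset_dense:
  assumes sep: "separable_space mtopology" and A: "A \<subseteq> M"
  obtains D where "countable D" "D \<subseteq> A" "\<And>x e. x \<in> A \<Longrightarrow> 0 < e \<Longrightarrow> \<exists>c\<in>D. d x c < e"
proof -
  have "separable_space (subtopology mtopology A)"
    by (rule second_countable_imp_separable_space[OF second_countable_subtopology[OF
          separable_imp_second_countable[OF sep]]])
  then obtain D where D: "countable D" "D \<subseteq> A" "subtopology mtopology A closure_of D = A"
    using A by (auto simp: separable_space_def inf.absorb2)
  have "\<exists>c\<in>D. d x c < e" if "x \<in> A" "0 < e" for x e
  proof -
    have "x \<in> mtopology closure_of D"
      using that(1) D(3) closure_of_subtopology_subset[of mtopology A D] by blast
    then show ?thesis
      using that unfolding metric_closure_of by fastforce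
  qed
  with D that show ?thesis
    by blast
qed

lemma (in Metric_space) separableI:
  assumes "countable D" "D \<subseteq> M" "\<And>x e. x \<in> M \<Longrightarrow> 0 < e \<Longrightarrow> \<exists>c\<in>D. d x c < e"
  shows "separable_space mtopology"
  unfolding separable_space_def
proof (intro exI conjI)
  show "mtopology closure_of D = topspace mtopology"
    using assms(2,3) unfolding metric_closure_of by fastforce
qed (use assms in auto)

section \<open>The predual as a metric space\<close>

context vn_algebra
begin

lemma unit_ball_subset: "unit_ball M \<subseteq> M"
  by (auto simp: unit_ball_def)

lemma zero_in_ball: "0 \<in> unit_ball M"
  by (simp add: unit_ball_def zero_in)

text \<open>The supremum in \<open>predual_dist\<close> obeys these two rules because normal
  functionals are bounded on the ball and the ball is nonempty.\<close>

lemma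
  assumes "\<omega> \<in> predual M" "\<psi> \<in> predual M"
  shows predual_dist_upper: "x \<in> unit_ball M \<Longrightarrow> cmod (\<omega> x - \<psi> x) \<le> predual_dist M \<omega> \<psi>"
    and predual_dist_least: "(\<And>x. x \<in> unit_ball M \<Longrightarrow> cmod (\<omega> x - \<psi> x) \<le> B) \<Longrightarrow> predual_dist M \<omega> \<psi> \<le> B"
proof -
  obtain C where C: "0 \<le> C" "\<And>x. x \<in> M \<Longrightarrow> cmod (\<omega> x) \<le> C * norm x"
    using assms normal_bounded[of \<omega>] by (auto simp: predual_def)
  obtain D where D: "0 \<le> D" "\<And>x. x \<in> M \<Longrightarrow> cmod (\<psi> x) \<le> D * norm x"
    using assms normal_bounded[of \<psi>] by (auto simp: predual_def)
  have "cmod (\<omega> x - \<psi> x) \<le> C + D" if "x \<in> unit_ball M" for x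
  proof -
    have "C * norm x \<le> C * 1" "D * norm x \<le> D * 1"
      using that C(1) D(1) by (intro mult_left_mono; simp add: unit_ball_def)+
    then show ?thesis
      using C(2)[of x] D(2)[of x] norm_triangle_ineq4[of "\<omega> x" "\<psi> x"] that
      by (simp add: unit_ball_def)
  qed
  then have bdd: "bdd_above ((\<lambda>x. cmod (\<omega> x - \<psi> x)) ` unit_ball M)"
    by (rule bdd_aboveI2)
  have eq: "predual_dist M \<omega> \<psi> = (SUP x\<in>unit_ball M. cmod (\<omega> x - \<psi> x))"
    using assms by (simp add: predual_dist_def)
  show "x \<in> unit_ball M \<Longrightarrow> cmod (\<omega> x - \<psi> x) \<le> predual_dist M \<omega> \<psi>"
    unfolding eq by (rule cSUP_upper[OF _ bdd])
  show "(\<And>x. x \<in> unit_ball M \<Longrightarrow> cmod (\<omega> x - \<psi> x) \<le> B) \<Longrightarrow> predual_dist M \<omega> \<psi> \<le> B"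
    unfolding eq using zero_in_ball by (intro cSUP_least) auto
qed

lemma Metric_space_predual: "Metric_space (predual M) (predual_dist M)"
proof
  show "0 \<le> predual_dist M \<omega> \<psi>" for \<omega> \<psi>
  proof (cases "\<omega> \<in> predual M \<and> \<psi> \<in> predual M")
    case True
    then show ?thesis
      using order_trans[OF norm_ge_zero predual_dist_upper[OF _ _ zero_in_ball]] by blast
  qed (auto simp: predual_dist_def)
  show "predual_dist M \<omega> \<psi> = predual_dist M \<psi> \<omega>" for \<omega> \<psi>
    by (auto simp: predual_dist_def norm_minus_commute)
  show "predual_dist M \<omega> \<psi> = 0 \<longleftrightarrow> \<omega> = \<psi>" if \<omega>: "\<omega> \<in> predual M" and \<psi>: "\<psi> \<in> predual M" for \<omega> \<psi>
  proof
    assume eq: "predual_dist M \<omega> \<psi> = 0"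
    show "\<omega> = \<psi>"
    proof (rule extensionalityI)
      fix x assume x: "x \<in> M"
      \<comment> \<open>The distance sees only the unit ball, so \<open>x\<close> is scaled into it;
        the summand 1 covers x = 0.\<close>
      define r where "r = norm x + 1"
      have r: "0 < r" "norm x \<le> r"
        by (simp_all add: r_def add_nonneg_pos)
      have "(1 / r) *\<^sub>R x \<in> unit_ball M"
        using r x by (simp add: unit_ball_def scaleR_in)
      then have "\<omega> ((1 / r) *\<^sub>R x) = \<psi> ((1 / r) *\<^sub>R x)"
        using predual_dist_upper[OF \<omega> \<psi>] eq by fastforce
      moreover have "\<theta> ((1 / r) *\<^sub>R x) = complex_of_real (1 / r) * \<theta> x" if "\<theta> \<in> predual M" for \<theta>
        using that x by (simp only: scaleR_eq_scaleC)
          (simp add: predual_def normal_functional_def clinear_on_def scaleC_complex_def)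
      ultimately have "complex_of_real (1 / r) * \<omega> x = complex_of_real (1 / r) * \<psi> x"
        using \<omega> \<psi> by metis
      then show "\<omega> x = \<psi> x"
        using r by simp
    qed (use \<omega> \<psi> in \<open>auto simp: predual_def\<close>)
  next
    assume "\<omega> = \<psi>"
    then show "predual_dist M \<omega> \<psi> = 0"
      using predual_dist_least[OF \<omega> \<psi>, of 0] predual_dist_upper[OF \<omega> \<psi> zero_in_ball] by simp
  qed
  show "predual_dist M \<omega> \<theta> \<le> predual_dist M \<omega> \<psi> + predual_dist M \<psi> \<theta>"
    if "\<omega> \<in> predual M" "\<psi> \<in> predual M" "\<theta> \<in> predual M" for \<omega> \<psi> \<theta>
  proof (rule predual_dist_least)
    fix x assume "x \<in> unit_ball M"
    then have "cmod (\<omega> x - \<psi> x) \<le> predual_dist M \<omega> \<psi>" "cmod (\<psi> x - \<theta> x) \<le> predual_dist M \<psi> \<theta>"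
      using that by (simp_all add: predual_dist_upper)
    then show "cmod (\<omega> x - \<theta> x) \<le> predual_dist M \<omega> \<psi> + predual_dist M \<psi> \<theta>"
      using norm_triangle_ineq[of "\<omega> x - \<psi> x" "\<psi> x - \<theta> x"] by simp
  qed (use that in auto)
qed

end

section \<open>The unit ball as a complete separable metric space\<close>

context vn_state
begin

lemma dist2_ball: "x \<in> unit_ball M \<Longrightarrow> y \<in> unit_ball M \<Longrightarrow> dist2 M \<phi> x y = norm2 \<phi> (x - y)"
  using unit_ball_subset by (auto simp: dist2_def)

lemma Metric_space_ball: "Metric_space (unit_ball M) (dist2 M \<phi>)"
proof
  show "0 \<le> dist2 M \<phi> x y" for x y
    by (simp add: dist2_def norm2_nonneg diff_in)
  show "dist2 M \<phi> x y = dist2 M \<phi> y x" for x y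
    by (simp add: dist2_def norm2_diff_commute)
  show "dist2 M \<phi> x y = 0 \<longleftrightarrow> x = y" if "x \<in> unit_ball M" "y \<in> unit_ball M" for x y
    using that unit_ball_subset norm2_eq_zero_iff[of "x - y"] diff_in[of x y]
    by (auto simp: dist2_ball norm2_zero)
  show "dist2 M \<phi> x z \<le> dist2 M \<phi> x y + dist2 M \<phi> y z"
    if "x \<in> unit_ball M" "y \<in> unit_ball M" "z \<in> unit_ball M" for x y z
  proof -
    have "x - y \<in> M" "y - z \<in> M"
      using that unit_ball_subset by (auto intro: diff_in)
    then show ?thesis
      using that norm2_triangle[of "x - y" "y - z"] by (simp add: dist2_ball)
  qed
qed

sublocale ball: Metric_space "unit_ball M" "dist2 M \<phi>"
  by (rule Metric_space_ball)

lemma phi_adj_tendsto: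
  assumes "a \<in> M" "x \<in> M" "wot_tendsto y x F" "eventually (\<lambda>i. y i \<in> M \<and> norm (y i) \<le> K) F"
  shows "((\<lambda>i. \<phi> (adj a o\<^sub>L y i)) \<longlongrightarrow> \<phi> (adj a o\<^sub>L x)) F"
  using normal_functional_compose_left[OF normal adj_in[OF assms(1)]] assms(3,2,4)
  by (rule normal_tendsto)

text \<open>A cluster point \<open>x\<close> of a 2-norm Cauchy sequence is its 2-norm limit, because
  \<open>\<parallel>X\<^sub>n - x\<parallel>\<^sup>2 = lim\<^sub>m \<phi>((X\<^sub>n - x)\<^sup>* (X\<^sub>n - X\<^sub>m))\<close> along the subfilter.\<close>

lemma mcomplete_ball: "ball.mcomplete"
  unfolding ball.mcomplete_def
proof (intro allI impI)
  fix X assume X: "ball.MCauchy X"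
  then have XB: "X n \<in> unit_ball M" for n
    by (auto simp: ball.MCauchy_def)
  then have XM: "X n \<in> M" and X1: "norm (X n) \<le> 1" for n
    by (auto simp: unit_ball_def)
  obtain G x where G: "G \<le> sequentially" "G \<noteq> bot" and x: "x \<in> M" "norm x \<le> 1"
    and lim: "wot_tendsto X x G"
    using wot_compact[of sequentially 1 X] XM X1 by auto
  have xB: "x \<in> unit_ball M"
    using x by (simp add: unit_ball_def)
  have "\<exists>N. \<forall>n\<ge>N. dist2 M \<phi> (X n) x < e" if e: "0 < e" for e
  proof -
    obtain N where N: "\<And>n m. N \<le> n \<Longrightarrow> N \<le> m \<Longrightarrow> norm2 \<phi> (X n - X m) < e / 2"
      using X half_gt_zero[OF e] unfolding ball.MCauchy_def by (metis dist2_ball XB)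
    have "norm2 \<phi> (X n - x) \<le> e / 2" if n: "N \<le> n" for n
    proof -
      let ?a = "X n - x"
      have a: "?a \<in> M"
        by (intro diff_in XM x)
      have "((\<lambda>m. \<phi> (adj ?a o\<^sub>L X m)) \<longlongrightarrow> \<phi> (adj ?a o\<^sub>L x)) G"
        by (rule phi_adj_tendsto[OF a x(1) lim, where K = 1]) (simp add: XM X1)
      then have "((\<lambda>m. \<phi> (adj ?a o\<^sub>L X n) - \<phi> (adj ?a o\<^sub>L X m)) \<longlongrightarrow>
          \<phi> (adj ?a o\<^sub>L X n) - \<phi> (adj ?a o\<^sub>L x)) G"
        by (intro tendsto_intros)
      moreover have "\<phi> (adj ?a o\<^sub>L X n) - \<phi> (adj ?a o\<^sub>L y) = \<phi> (adj ?a o\<^sub>L (X n - y))" if "y \<in> M" for y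
        using that a XM by (simp only: compose_diff_right) (simp add: phi_diff mem_intros)
      ultimately have "((\<lambda>m. \<phi> (adj ?a o\<^sub>L (X n - X m))) \<longlongrightarrow> \<phi> (adj ?a o\<^sub>L ?a)) G"
        using XM x(1) by simp
      then have "((\<lambda>m. cmod (\<phi> (adj ?a o\<^sub>L (X n - X m)))) \<longlongrightarrow> (norm2 \<phi> ?a)\<^sup>2) G"
        using tendsto_norm phi_self[OF a] by (metis abs_of_nonneg norm_of_real zero_le_power2)
      moreover have "eventually (\<lambda>m. cmod (\<phi> (adj ?a o\<^sub>L (X n - X m))) \<le> e / 2 * norm2 \<phi> ?a) G"
      proof (rule filter_leD[OF G(1)], rule eventually_sequentiallyI)
        fix m assume "N \<le> m"
        then have "norm2 \<phi> (X n - X m) \<le> e / 2"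
          using N n by (simp add: less_imp_le)
        then show "cmod (\<phi> (adj ?a o\<^sub>L (X n - X m))) \<le> e / 2 * norm2 \<phi> ?a"
          using cauchy_schwarz[OF diff_in[OF XM XM] a, of n m] norm2_nonneg[OF a]
          by (meson mult_right_mono order_trans)
      qed
      \<comment> \<open>Cauchy-Schwarz bounds the quantities along the subfilter by e / 2 times the
        2-norm of \<open>?a\<close>; dividing the limit inequality by that norm leaves e /
        2.\<close>
      ultimately have "(norm2 \<phi> ?a)\<^sup>2 \<le> e / 2 * norm2 \<phi> ?a"
        using tendsto_upperbound G(2) by blast
      then show ?thesis
        using norm2_nonneg[OF a] \<open>0 < e\<close> by (cases "norm2 \<phi> ?a = 0") (simp_all add: power2_eq_square)
    qed
    then show ?thesis
      using e XB xB by (intro exI[of _ N]) (fastforce simp: dist2_ball)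
  qed
  then have "limitin ball.mtopology X x sequentially"
    using XB xB by (simp add: ball.limit_metric_sequentially)
  then show "\<exists>x. limitin ball.mtopology X x sequentially"
    by blast
qed

text \<open>Along the indices where a matrix coefficient stays away from 0, a weak cluster point x
  exists. The inner products of \<open>z n\<close> with x in the 2-norm form tend to 0 by
  Cauchy-Schwarz and to the square of the 2-norm of x by normality, so faithfulness forces x = 0, a
  contradiction.\<close>

lemma norm2_tendsto_imp_wot_tendsto:
  assumes z: "\<And>n. z n \<in> M" "\<And>n. norm (z n) \<le> K" and lim: "(\<lambda>n. norm2 \<phi> (z n)) \<longlonglongrightarrow> 0"
  shows "wot_tendsto z 0 sequentially"
proof (rule ccontr)
  have K: "0 \<le> K"
    using z(2)[of 0] norm_ge_zero order_trans by blast
  assume "\<not> ?thesis"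
  then obtain \<xi> \<eta> where "\<not> (\<lambda>n. cinner (blinfun_apply (z n) \<xi>) \<eta>) \<longlonglongrightarrow> 0"
    by (auto simp: wot_tendsto_def cinner.zero_left)
  then obtain e where e: "0 < e"
    and "\<not> eventually (\<lambda>n. cmod (cinner (blinfun_apply (z n) \<xi>) \<eta>) < e) sequentially"
    unfolding tendsto_iff by auto
  \<comment> \<open>The sequential filter cut down to the bad indices; it is proper because these
    occur arbitrarily late.\<close>
  define F where "F = inf sequentially (principal {n. e \<le> cmod (cinner (blinfun_apply (z n) \<xi>) \<eta>)})"
  have "F \<noteq> bot"
  proof
    assume "F = bot"
    then have "eventually (\<lambda>n. \<not> e \<le> cmod (cinner (blinfun_apply (z n) \<xi>) \<eta>)) sequentially"
      unfolding F_def trivial_limit_def eventually_inf_principal by simp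
    then show False
      using \<open>\<not> eventually _ sequentially\<close> by (simp add: not_le)
  qed
  then obtain G x where G: "G \<le> F" "G \<noteq> bot" and x: "x \<in> M" and wot: "wot_tendsto z x G"
    using wot_compact[of F K z] z K by auto
  have "((\<lambda>n. norm2 \<phi> (z n) * norm2 \<phi> x) \<longlongrightarrow> 0 * norm2 \<phi> x) G"
    using lim G(1) by (intro tendsto_intros) (auto simp: F_def intro: tendsto_mono)
  then have "((\<lambda>n. norm2 \<phi> (z n) * norm2 \<phi> x) \<longlongrightarrow> 0) G"
    by simp
  moreover have "eventually (\<lambda>n. cmod (\<phi> (adj x o\<^sub>L z n)) \<le> norm2 \<phi> (z n) * norm2 \<phi> x) G"
    by (rule always_eventually) (blast intro: cauchy_schwarz z(1) x)
  ultimately have "((\<lambda>n. \<phi> (adj x o\<^sub>L z n)) \<longlongrightarrow> 0) G"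
    by (rule Lim_null_comparison[rotated])
  moreover have "((\<lambda>n. \<phi> (adj x o\<^sub>L z n)) \<longlongrightarrow> \<phi> (adj x o\<^sub>L x)) G"
    by (rule phi_adj_tendsto[OF x x wot, where K = K]) (simp add: z)
  ultimately have "x = 0"
    using tendsto_unique[OF G(2), of _ 0 "\<phi> (adj x o\<^sub>L x)"] faithful[OF x] by metis
  then have "((\<lambda>n. cinner (blinfun_apply (z n) \<xi>) \<eta>) \<longlongrightarrow> 0) G"
    using wot by (auto simp: wot_tendsto_def cinner.zero_left)
  then have "eventually (\<lambda>n. cmod (cinner (blinfun_apply (z n) \<xi>) \<eta>) < e) G"
    using e by (simp add: tendsto_iff)
  moreover have "eventually (\<lambda>n. e \<le> cmod (cinner (blinfun_apply (z n) \<xi>) \<eta>)) G"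
    using G(1) by (rule filter_leD) (simp add: F_def eventually_inf_principal)
  ultimately have "eventually (\<lambda>n. False) G"
    by eventually_elim simp
  then show False
    using G(2) by simp
qed

text \<open>The map \<open>a \<mapsto> \<phi>(a\<^sup>* \<cdot>)\<close> from the ball to the predual satisfies
  \<open>\<parallel>a - b\<parallel>\<^sub>2\<^sup>2 \<le> 2 \<parallel>\<phi>(a\<^sup>* \<cdot>) - \<phi>(b\<^sup>* \<cdot>)\<parallel>\<close>.\<close>

lemma separable_ball:
  assumes "separable_predual M"
  shows "separable_space ball.mtopology"
proof -
  interpret predual: Metric_space "predual M" "predual_dist M"
    by (rule Metric_space_predual)
  define w where "w a = restrict (\<lambda>x. \<phi> (adj a o\<^sub>L x)) M" for a
  have w: "w a \<in> predual M" if "a \<in> M" for a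
  proof -
    have *: "normal_functional M (\<lambda>x. \<phi> (adj a o\<^sub>L x))"
      by (rule normal_functional_compose_left[OF normal adj_in[OF that]])
    then have "clinear_on M (w a)"
      by (simp add: w_def normal_functional_def clinear_on_def add_in scaleC_in)
    moreover have "continuous_map (subtopology sigma_weak_topology M) euclidean (w a)"
      using * unfolding normal_functional_def
      by (auto simp: w_def elim!: continuous_map_eq)
    ultimately show ?thesis
      by (simp add: predual_def w_def normal_functional_def)
  qed
  have "separable_space predual.mtopology"
    using assms by (simp add: separable_predual_def)
  then obtain C where C: "countable C" "C \<subseteq> w ` unit_ball M"
    "\<And>x e. x \<in> w ` unit_ball M \<Longrightarrow> 0 < e \<Longrightarrow> \<exists>c\<in>C. predual_dist M x c < e"
    using w unit_ball_subset by (auto elim!: predual.separable_subset_dense[of "w ` unit_ball M"])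
  then obtain D where D: "D \<subseteq> unit_ball M" "countable D" "C = w ` D"
    by (meson countable_subset_image)
  show ?thesis
  proof (rule ball.separableI[OF D(2,1)])
    fix x and e :: real assume x: "x \<in> unit_ball M" and e: "0 < e"
    then obtain a where a: "a \<in> D" "predual_dist M (w x) (w a) < e\<^sup>2 / 2"
      using C(3)[of "w x" "e\<^sup>2 / 2"] D(3) by auto
    have xM: "x \<in> M" and aM: "a \<in> M" and aB: "a \<in> unit_ball M"
      using x a D unit_ball_subset by auto
    define u where "u = x - a"
    have u: "u \<in> M"
      unfolding u_def by (intro diff_in xM aM)
    \<comment> \<open>A difference of two ball elements has norm at most 2, so only its half may be
      inserted into the predual distance. This is the source of the factor 2 and of the tolerance
      e^2 / 2.\<close>
    have "norm u \<le> 2"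
      unfolding u_def using norm_triangle_ineq4[of x a] x aB by (simp add: unit_ball_def)
    then have hB: "(1/2) *\<^sub>R u \<in> unit_ball M"
      using u by (simp add: unit_ball_def scaleR_in)
    have "(norm2 \<phi> u)\<^sup>2 = cmod (\<phi> (adj u o\<^sub>L u))"
      by (simp add: phi_self u norm_power)
    also have "adj u o\<^sub>L u = (adj x o\<^sub>L u) - (adj a o\<^sub>L u)"
      by (simp add: u_def adj_diff in_bounded_ops xM aM compose_diff_left)
    also have "\<phi> \<dots> = 2 * (w x ((1/2) *\<^sub>R u) - w a ((1/2) *\<^sub>R u))"
      using u xM aM
      by (simp add: w_def scaleR_eq_scaleC phi_diff phi_scaleC mem_intros compose_scaleC_right
          in_bounded_ops algebra_simps)
    also have "cmod \<dots> \<le> 2 * predual_dist M (w x) (w a)"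
      using predual_dist_upper[OF w[OF xM] w[OF aM] hB] unfolding norm_mult by simp
    also have "\<dots> < e\<^sup>2"
      using a(2) by simp
    finally have "norm2 \<phi> u < e"
      using e by (meson less_imp_le power2_less_imp_less)
    then show "\<exists>c\<in>D. dist2 M \<phi> x c < e"
      using a(1) x aB by (intro bexI[of _ a]) (simp_all add: u_def dist2_ball)
  qed
qed

end

section \<open>Spaces of 1-Lipschitz maps\<close>

locale lip_maps = A: Metric_space A dA + B: Metric_space B dB
  for A :: "'a set" and dA and B :: "'b set" and dB
begin

definition lip :: "('a \<Rightarrow> 'b) set" where
  "lip = {f \<in> A \<rightarrow>\<^sub>E B. \<forall>x\<in>A. \<forall>y\<in>A. dB (f x) (f y) \<le> dA x y}"

definition lip_top :: "('a \<Rightarrow> 'b) topology" where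
  "lip_top = subtopology (product_topology (\<lambda>_. B.mtopology) A) lip"

lemma topspace_lip: "topspace lip_top = lip"
  by (auto simp: lip_top_def lip_def)

lemma lip_in: "f \<in> lip \<Longrightarrow> x \<in> A \<Longrightarrow> f x \<in> B"
  by (auto simp: lip_def)

lemma lip_le: "f \<in> lip \<Longrightarrow> x \<in> A \<Longrightarrow> y \<in> A \<Longrightarrow> dB (f x) (f y) \<le> dA x y"
  by (auto simp: lip_def)

lemma openin_lip_ball:
  assumes "x \<in> A" and c: "c \<in> B"
  shows "openin lip_top {g \<in> lip. dB (g x) c < e}"
proof -
  have "continuous_map lip_top B.mtopology (\<lambda>g. g x)"
    unfolding lip_top_def
    by (intro continuous_map_from_subtopology continuous_map_product_projection assms)
  then have "openin lip_top {g \<in> topspace lip_top. g x \<in> B.mball c e}"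
    by (rule openin_continuous_map_preimage) simp
  moreover have "{g \<in> topspace lip_top. g x \<in> B.mball c e} = {g \<in> lip. dB (g x) c < e}"
    using assms by (auto simp: topspace_lip lip_in B.commute)
  ultimately show ?thesis
    by simp
qed

text \<open>The constraints are pairs of a point and a centre, where the centre need not be a value
  of a given map. This lets both range over countable sets in the proof of second
  countability.\<close>

lemma openin_lip_nbhd:
  assumes P: "finite P" "P \<subseteq> A \<times> B"
  shows "openin lip_top {g \<in> lip. \<forall>(x, c)\<in>P. dB (g x) c < e}"
  using P
proof (induction P)
  case empty
  then show ?case
    using openin_topspace[of lip_top] by (simp add: topspace_lip)
next
  case (insert p P)
  obtain x c where p: "p = (x, c)"
    by (cases p)
  have "openin lip_top ({g \<in> lip. dB (g x) c < e} \<inter> {g \<in> lip. \<forall>(x, c)\<in>P. dB (g x) c < e})"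
    using insert p by (intro openin_Int openin_lip_ball) auto
  then show ?case
    by (rule back_subst[where P = "openin lip_top"]) (auto simp: p)
qed

lemma lip_nbhd_base:
  assumes U: "openin lip_top U" and f: "f \<in> U"
  shows "\<exists>F e. finite F \<and> F \<subseteq> A \<and> 0 < e \<and> {g \<in> lip. \<forall>x\<in>F. dB (g x) (f x) < e} \<subseteq> U"
proof -
  obtain W where W: "openin (product_topology (\<lambda>_. B.mtopology) A) W" "U = W \<inter> lip"
    using U by (auto simp: lip_top_def openin_subtopology)
  obtain V where V: "finite {x \<in> A. V x \<noteq> B}" "\<And>x. x \<in> A \<Longrightarrow> openin B.mtopology (V x)"
    "f \<in> PiE A V" "PiE A V \<subseteq> W"
    using W f unfolding openin_product_topology_alt by auto
  have fl: "f \<in> lip"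
    using W f by simp
  define F where "F = {x \<in> A. V x \<noteq> B}"
  have "\<exists>r>0. B.mball (f x) r \<subseteq> V x" if "x \<in> A" for x
    using V(2)[OF that] V(3) that unfolding B.openin_mtopology by (auto simp: PiE_iff)
  then obtain r where r: "\<And>x. x \<in> A \<Longrightarrow> 0 < r x" "\<And>x. x \<in> A \<Longrightarrow> B.mball (f x) (r x) \<subseteq> V x"
    by metis
  \<comment> \<open>Only the finitely many restricted coordinates matter; the element 1 makes the
    minimum meaningful when there are none.\<close>
  define e where "e = Min (insert 1 (r ` F))"
  have F: "finite F" "F \<subseteq> A"
    using V(1) by (auto simp: F_def)
  then have e: "0 < e" "\<And>x. x \<in> F \<Longrightarrow> e \<le> r x"
    using r(1) by (auto simp: e_def)
  have "g \<in> U" if g: "g \<in> lip" "\<And>x. x \<in> F \<Longrightarrow> dB (g x) (f x) < e" for g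
  proof -
    have "g x \<in> V x" if x: "x \<in> A" for x
    proof (cases "x \<in> F")
      case True
      then have "g x \<in> B.mball (f x) (r x)"
        using g(1) g(2)[OF True] e(2)[OF True] x fl by (auto simp: lip_in B.commute)
      then show ?thesis
        using r(2)[OF x] by blast
    next
      case False
      then show ?thesis
        using x g(1) by (auto simp: F_def lip_in)
    qed
    then have "g \<in> PiE A V"
      using g(1) by (auto simp: lip_def PiE_iff)
    then show ?thesis
      using V(4) W(2) g(1) by blast
  qed
  then have "{g \<in> lip. \<forall>x\<in>F. dB (g x) (f x) < e} \<subseteq> U"
    by blast
  with F e(1) show ?thesis
    by (intro exI[of _ F] exI[of _ e] conjI)
qed

text \<open>For a fixed finite \<open>F\<close>, closeness up to 1/(n+1) on \<open>F\<close> defines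
  an open neighbourhood of \<open>f\<close>, so the closure meets each of them. The sequence depends
  on \<open>F\<close>.\<close>

lemma lip_closure_sequence:
  assumes f: "f \<in> lip_top closure_of S" and F: "finite F" "F \<subseteq> A"
  obtains g where "\<And>n. g n \<in> S" "\<And>n. g n \<in> lip" "\<And>x. x \<in> F \<Longrightarrow> (\<lambda>n. dB (g n x) (f x)) \<longlonglongrightarrow> 0"
proof -
  have fl: "f \<in> lip"
    using f by (simp add: in_closure_of topspace_lip)
  have "\<exists>g\<in>S. g \<in> lip \<and> (\<forall>x\<in>F. dB (g x) (f x) < 1 / real (Suc n))" for n
  proof -
    define P where "P = (\<lambda>x. (x, f x)) ` F"
    define W where "W = {g \<in> lip. \<forall>(x, c)\<in>P. dB (g x) c < 1 / real (Suc n)}"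
    have "openin lip_top W"
      unfolding W_def using F fl by (intro openin_lip_nbhd) (auto simp: P_def lip_in)
    moreover have "f \<in> W"
      using fl F by (auto simp: W_def P_def lip_in subset_iff)
    ultimately obtain g where "g \<in> S" "g \<in> W"
      using f unfolding in_closure_of by blast
    then show ?thesis
      by (auto simp: P_def W_def)
  qed
  then obtain g where g: "\<And>n. g n \<in> S" "\<And>n. g n \<in> lip"
    "\<And>n x. x \<in> F \<Longrightarrow> dB (g n x) (f x) < 1 / real (Suc n)"
    by metis
  have "(\<lambda>n. dB (g n x) (f x)) \<longlonglongrightarrow> 0" if "x \<in> F" for x
  proof (rule Lim_null_comparison[OF always_eventually LIMSEQ_Suc[OF lim_1_over_n]], rule allI)
    show "norm (dB (g n x) (f x)) \<le> 1 / real (Suc n)" for n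
      using g(3)[OF that, of n] by simp
  qed
  with g that show ?thesis
    by blast
qed

text \<open>A constraint at x can be moved to a nearby point of a countable dense set, because both
  maps are 1-Lipschitz, and its centre can be moved to a countable dense subset of the target. Only
  countably many finite constraint sets remain.\<close>

lemma second_countable_lip:
  assumes sepA: "separable_space A.mtopology" and sepB: "separable_space B.mtopology"
  shows "second_countable lip_top"
proof -
  obtain D where D: "countable D" "D \<subseteq> A" "\<And>x e. x \<in> A \<Longrightarrow> 0 < e \<Longrightarrow> \<exists>c\<in>D. dA x c < e"
    using A.separable_subset_dense[OF sepA order_refl] by blast
  obtain C where C: "countable C" "C \<subseteq> B" "\<And>x e. x \<in> B \<Longrightarrow> 0 < e \<Longrightarrow> \<exists>c\<in>C. dB x c < e"
    using B.separable_subset_dense[OF sepB order_refl] by blast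
  define V where "V P n = {g \<in> lip. \<forall>(x, c)\<in>P. dB (g x) c < 1 / real (Suc n)}" for P n
  define \<B> where "\<B> = (\<lambda>(P, n). V P n) ` ({P. finite P \<and> P \<subseteq> D \<times> C} \<times> UNIV)"
  have "countable \<B>"
    unfolding \<B>_def using C(1) D(1)
    by (intro countable_image countable_SIGMA countable_Collect_finite_subset) auto
  moreover have "\<forall>V\<in>\<B>. openin lip_top V"
    using C(2) D(2) by (auto simp: \<B>_def V_def intro!: openin_lip_nbhd)
  moreover have "\<exists>V\<in>\<B>. f \<in> V \<and> V \<subseteq> U" if U: "openin lip_top U" and f: "f \<in> U" for U f
  proof -
    obtain F e where F: "finite F" "F \<subseteq> A" and e: "0 < e"
      and sub: "{g \<in> lip. \<forall>x\<in>F. dB (g x) (f x) < e} \<subseteq> U"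
      using lip_nbhd_base[OF U f] by blast
    have fl: "f \<in> lip"
      using f openin_subset[OF U] by (auto simp: topspace_lip)
    \<comment> \<open>A quarter, since the path from g x to f x passes through g (p x), the centre q
      x and f (p x).\<close>
    obtain n where n: "1 / real (Suc n) < e / 4"
      using e nat_approx_posE[of "e / 4"] by auto
    have "\<forall>x\<in>F. \<exists>y\<in>D. dA x y < e / 4"
      using D(3)[of _ "e / 4"] F(2) e by auto
    then obtain p where p: "\<And>x. x \<in> F \<Longrightarrow> p x \<in> D" "\<And>x. x \<in> F \<Longrightarrow> dA x (p x) < e / 4"
      by metis
    have "\<forall>x\<in>F. \<exists>c\<in>C. dB (f (p x)) c < 1 / real (Suc n)"
      using p(1) D(2) fl by (auto intro!: C(3) lip_in)
    then obtain q where q: "\<And>x. x \<in> F \<Longrightarrow> q x \<in> C" "\<And>x. x \<in> F \<Longrightarrow> dB (f (p x)) (q x) < 1 / real (Suc n)"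
      by metis
    let ?P = "(\<lambda>x. (p x, q x)) ` F"
    have mem: "V ?P n \<in> \<B>"
      using F(1) p(1) q(1) by (auto simp: \<B>_def intro!: rev_image_eqI[of "(?P, n)"])
    have fV: "f \<in> V ?P n"
      using fl q(2) by (auto simp: V_def)
    have VU: "V ?P n \<subseteq> {g \<in> lip. \<forall>x\<in>F. dB (g x) (f x) < e}"
    proof clarify
      fix g assume "g \<in> V ?P n"
      then have g: "g \<in> lip" "\<And>x. x \<in> F \<Longrightarrow> dB (g (p x)) (q x) < 1 / real (Suc n)"
        by (auto simp: V_def)
      have "dB (g x) (f x) < e" if x: "x \<in> F" for x
      proof -
        have xA: "x \<in> A" and pA: "p x \<in> A" and qB: "q x \<in> B"
          using x F p(1) D(2) q(1) C(2) by auto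
        have "dB (g x) (f x) \<le> dB (g x) (g (p x)) + dB (g (p x)) (f x)"
          using g(1) fl xA pA by (intro B.triangle) (auto intro: lip_in)
        moreover have "dB (g (p x)) (f x) \<le> dB (g (p x)) (q x) + dB (q x) (f x)"
          using g(1) fl xA pA qB by (intro B.triangle) (auto intro: lip_in)
        moreover have "dB (q x) (f x) \<le> dB (q x) (f (p x)) + dB (f (p x)) (f x)"
          using fl xA pA qB by (intro B.triangle) (auto intro: lip_in)
        moreover have "dB (g x) (g (p x)) < e / 4" "dB (f (p x)) (f x) < e / 4"
          using lip_le[OF g(1) xA pA] lip_le[OF fl pA xA] p(2)[OF x] by (auto simp: A.commute)
        moreover have "dB (q x) (f (p x)) < e / 4" "dB (g (p x)) (q x) < e / 4"
          using q(2)[OF x] g(2)[OF x] n by (auto simp: B.commute)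
        ultimately show ?thesis
          by linarith
      qed
      with g(1) show "g \<in> lip \<and> (\<forall>x\<in>F. dB (g x) (f x) < e)"
        by blast
    qed
    show ?thesis
      using fV subset_trans[OF VU sub] mem by (intro bexI[of _ "V ?P n"] conjI)
  qed
  ultimately show ?thesis
    unfolding second_countable_def by blast
qed

text \<open>Equicontinuity spreads convergence from the dense set: the values at any point are
  Cauchy by comparison with a nearby point of \<open>D\<close>, and the Lipschitz inequality passes
  to the limit. The limit prescribed on \<open>D\<close> is thereby extended.\<close>

lemma lip_limit:
  assumes complete: "B.mcomplete" and D: "D \<subseteq> A" "\<And>x e. x \<in> A \<Longrightarrow> 0 < e \<Longrightarrow> \<exists>c\<in>D. dA x c < e"
    and f: "\<And>n. f n \<in> lip" and lim: "\<And>c. c \<in> D \<Longrightarrow> limitin B.mtopology (\<lambda>n. f n c) (g c) sequentially"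
  obtains h where "h \<in> lip" "\<And>c. c \<in> D \<Longrightarrow> h c = g c"
proof -
  have "\<exists>y. limitin B.mtopology (\<lambda>n. f n x) y sequentially" if x: "x \<in> A" for x
  proof -
    have "B.MCauchy (\<lambda>n. f n x)"
      unfolding B.MCauchy_def
    proof (intro conjI allI impI)
      show "range (\<lambda>n. f n x) \<subseteq> B"
        using f x lip_in by blast
      fix e :: real assume e: "0 < e"
      obtain c where c: "c \<in> D" "dA x c < e / 3"
        using D(2)[OF x, of "e / 3"] e by auto
      have cA: "c \<in> A"
        using c D by blast
      have "B.MCauchy (\<lambda>n. f n c)"
        using f cA lip_in by (intro B.convergent_imp_MCauchy[OF _ lim[OF c(1)]]) blast
      then obtain N where N: "\<And>n n'. N \<le> n \<Longrightarrow> N \<le> n' \<Longrightarrow> dB (f n c) (f n' c) < e / 3"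
        using e unfolding B.MCauchy_def by (meson divide_pos_pos zero_less_numeral)
      have "dB (f n x) (f n' x) < e" if n: "N \<le> n" "N \<le> n'" for n n'
      proof -
        have "dB (f n x) (f n' x) \<le> dB (f n x) (f n c) + dB (f n c) (f n' x)"
          using x cA f by (intro B.triangle) (auto intro: lip_in)
        moreover have "dB (f n c) (f n' x) \<le> dB (f n c) (f n' c) + dB (f n' c) (f n' x)"
          using x cA f by (intro B.triangle) (auto intro: lip_in)
        moreover have "dB (f n x) (f n c) < e / 3" "dB (f n' c) (f n' x) < e / 3"
          using lip_le[OF f x cA, of n] lip_le[OF f cA x, of n'] c(2) by (auto simp: A.commute)
        ultimately show ?thesis
          using N[OF n] by linarith
      qed
      then show "\<exists>N. \<forall>n n'. N \<le> n \<longrightarrow> N \<le> n' \<longrightarrow> dB (f n x) (f n' x) < e"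
        by blast
    qed
    then show ?thesis
      using complete by (auto simp: B.mcomplete_def)
  qed
  then obtain k where k: "\<And>x. x \<in> A \<Longrightarrow> limitin B.mtopology (\<lambda>n. f n x) (k x) sequentially"
    by metis
  have kB: "k x \<in> B" if "x \<in> A" for x
    using k[OF that] B.limitin_mspace by blast
  have dist_k: "(\<lambda>n. dB (f n x) (k x)) \<longlonglongrightarrow> 0" if "x \<in> A" for x
    using k[OF that] by (simp add: B.limitin_metric_dist_null)
  have "dB (k x) (k y) \<le> dA x y" if x: "x \<in> A" and y: "y \<in> A" for x y
  proof -
    have "(\<lambda>n. dB (f n x) (k x) + dA x y + dB (f n y) (k y)) \<longlonglongrightarrow> 0 + dA x y + 0"
      by (intro tendsto_intros dist_k x y)
    moreover have "dB (k x) (k y) \<le> dB (f n x) (k x) + dA x y + dB (f n y) (k y)" for n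
    proof -
      have "dB (k x) (k y) \<le> dB (k x) (f n x) + dB (f n x) (k y)"
        using x y f kB by (intro B.triangle) (auto intro: lip_in)
      moreover have "dB (f n x) (k y) \<le> dB (f n x) (f n y) + dB (f n y) (k y)"
        using x y f kB by (intro B.triangle) (auto intro: lip_in)
      ultimately show ?thesis
        using lip_le[OF f x y, of n] by (simp add: B.commute)
    qed
    ultimately show ?thesis
      using LIMSEQ_le_const by fastforce
  qed
  then have "restrict k A \<in> lip"
    using kB by (simp add: lip_def)
  moreover have "restrict k A c = g c" if "c \<in> D" for c
    using B.limitin_metric_unique[OF k lim[OF that]] that D(1) by auto
  ultimately show ?thesis
    using that by blast
qed

text \<open>Restriction to a countable dense set \<open>D\<close> embeds the space as a closed
  subset of the countable power of the target, and such a power is completely metrizable. Closedness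
  is tested with sequences, since the power is metrizable, and then reduces to
  \<open>lip_limit\<close>.\<close>

lemma completely_metrizable_lip:
  assumes complete: "B.mcomplete" and sepA: "separable_space A.mtopology"
  shows "completely_metrizable_space lip_top"
proof -
  obtain D where D: "countable D" "D \<subseteq> A" "\<And>x e. x \<in> A \<Longrightarrow> 0 < e \<Longrightarrow> \<exists>c\<in>D. dA x c < e"
    using A.separable_subset_dense[OF sepA order_refl] by blast
  define Y where "Y = product_topology (\<lambda>_. B.mtopology) D"
  define h where "h f = restrict f D" for f :: "'a \<Rightarrow> 'b"
  have "completely_metrizable_space B.mtopology"
    using complete by (simp add: B.completely_metrizable_space_mtopology)
  then have Y: "completely_metrizable_space Y"
    unfolding Y_def completely_metrizable_space_product_topology using D(1)
    by (auto intro: countable_subset[OF _ D(1)])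
  have topY: "topspace Y = D \<rightarrow>\<^sub>E B"
    by (simp add: Y_def)
  have hY: "h ` lip \<subseteq> topspace Y"
    using D(2) by (auto simp: topY h_def lip_in)
  have "closedin Y (h ` lip)"
  proof -
    obtain Z d where Z: "Metric_space Z d" "Y = Metric_space.mtopology Z d"
      using Y unfolding completely_metrizable_space_def by blast
    interpret Z: Metric_space Z d
      by (rule Z(1))
    have "l \<in> h ` lip" if s: "range s \<subseteq> h ` lip" and l: "limitin Z.mtopology s l sequentially" for s l
    proof -
      have "\<exists>f. f \<in> lip \<and> s n = h f" for n
        using s by blast
      then obtain f where f: "\<And>n. f n \<in> lip" "\<And>n. s n = h (f n)"
        by metis
      have l': "limitin Y s l sequentially"
        using l Z by simp
      have "limitin B.mtopology (\<lambda>n. f n c) (l c) sequentially" if "c \<in> D" for c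
        using l' that unfolding Y_def limitin_componentwise by (auto simp: f(2) h_def)
      then obtain k where k: "k \<in> lip" "\<And>c. c \<in> D \<Longrightarrow> k c = l c"
        using lip_limit[OF complete D(2,3), of f l] f(1) by blast
      have "l \<in> topspace Y"
        using l' limitin_topspace by metis
      then have "l = h k"
        using k(2) by (auto simp: topY h_def PiE_def extensional_def fun_eq_iff)
      then show ?thesis
        using k(1) by blast
    qed
    moreover have "h ` lip \<subseteq> Z"
      using hY Z by simp
    ultimately show ?thesis
      unfolding Z(2) Z.metric_closedin_iff_sequentially_closed by blast
  qed
  then have "completely_metrizable_space (subtopology Y (h ` lip))"
    by (rule completely_metrizable_space_closedin[OF Y])
  moreover have "homeomorphic_map lip_top (subtopology Y (h ` lip)) h"
  proof (rule bijective_open_imp_homeomorphic_map)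
    show "continuous_map lip_top (subtopology Y (h ` lip)) h"
      unfolding continuous_map_in_subtopology topspace_lip
    proof
      show "continuous_map lip_top Y h"
        unfolding Y_def continuous_map_componentwise
      proof (intro conjI ballI)
        show "h ` topspace lip_top \<subseteq> extensional D"
          by (auto simp: h_def)
        fix c assume c: "c \<in> D"
        have "continuous_map lip_top B.mtopology (\<lambda>f. f c)"
          unfolding lip_top_def using c D(2)
          by (intro continuous_map_from_subtopology continuous_map_product_projection) auto
        then show "continuous_map lip_top B.mtopology (\<lambda>f. h f c)"
          using c by (simp add: h_def)
      qed
    qed simp
    show "h ` topspace lip_top = topspace (subtopology Y (h ` lip))"
      using hY by (auto simp: topspace_lip)
    have inj: "f = g" if f: "f \<in> lip" and g: "g \<in> lip" and eq: "h f = h g" for f g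
    proof (rule extensionalityI)
      fix x assume x: "x \<in> A"
      have "dB (f x) (g x) \<le> 0"
      proof (rule field_le_epsilon)
        fix e :: real assume "0 < e"
        then obtain c where c: "c \<in> D" "dA x c < e / 2"
          using D(3)[OF x, of "e / 2"] by auto
        have cA: "c \<in> A"
          using c D by blast
        have "f c = g c"
          using fun_cong[OF eq, of c] c by (simp add: h_def)
        moreover have "dB (f x) (g x) \<le> dB (f x) (f c) + dB (f c) (g x)"
          using x cA f g by (intro B.triangle) (auto intro: lip_in)
        ultimately show "dB (f x) (g x) \<le> 0 + e"
          using lip_le[OF f x cA] lip_le[OF g cA x] c(2) by (simp add: A.commute)
      qed
      then show "f x = g x"
        using x f g B.nonneg[of "f x" "g x"] by (metis B.zero lip_in order_antisym)
    qed (use f g in \<open>auto simp: lip_def PiE_iff\<close>)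
    then show "inj_on h (topspace lip_top)"
      by (auto simp: inj_on_def topspace_lip)
    \<comment> \<open>The Lipschitz bound lets the values on \<open>D\<close> control the values at
      all points, so a neighbourhood of f contains one that is described on \<open>D\<close>
      alone.\<close>
    show "open_map lip_top (subtopology Y (h ` lip)) h"
      unfolding open_map_def
    proof (intro allI impI)
      fix U assume U: "openin lip_top U"
      have "\<exists>V. openin (subtopology Y (h ` lip)) V \<and> h f \<in> V \<and> V \<subseteq> h ` U" if f: "f \<in> U" for f
      proof -
        obtain F e where F: "finite F" "F \<subseteq> A" and e: "0 < e"
          and sub: "{g \<in> lip. \<forall>x\<in>F. dB (g x) (f x) < e} \<subseteq> U"
          using lip_nbhd_base[OF U f] by blast
        have fl: "f \<in> lip"
          using f openin_subset[OF U] by (auto simp: topspace_lip)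
        have "\<forall>x\<in>F. \<exists>y\<in>D. dA x y < e / 3"
      using D(3)[of _ "e / 3"] F(2) e by auto
        then obtain p where p: "\<And>x. x \<in> F \<Longrightarrow> p x \<in> D" "\<And>x. x \<in> F \<Longrightarrow> dA x (p x) < e / 3"
          by metis
        \<comment> \<open>The constraints sit at the points p x of \<open>D\<close>; the tolerance e
          / 3 pays for x to p x under g, for the constraint, and for p x back to x under f. The
          factor \<open>topspace Y\<close> takes care of an empty \<open>F\<close>.\<close>
        define V where "V = topspace Y \<inter> (\<Inter>x\<in>F. {g \<in> topspace Y. g (p x) \<in> B.mball (f (p x)) (e / 3)})"
        have "openin Y {g \<in> topspace Y. g (p x) \<in> B.mball (f (p x)) (e / 3)}" if "x \<in> F" for x
          using p(1)[OF that]
          by (intro openin_continuous_map_preimage[of _ B.mtopology])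
            (auto simp: Y_def intro: continuous_map_product_projection)
        then have "openin Y V"
          unfolding V_def using F(1) by (cases "F = {}") (auto intro!: openin_Int openin_INT2)
        then have "openin (subtopology Y (h ` lip)) (V \<inter> h ` lip)"
          by (auto simp: openin_subtopology)
        moreover have "h f \<in> V \<inter> h ` lip"
          using fl hY e p(1) D(2) by (auto simp: V_def h_def subset_iff lip_in)
        moreover have "V \<inter> h ` lip \<subseteq> h ` U"
        proof clarify
          fix g assume gV: "h g \<in> V" and g: "g \<in> lip"
          have "dB (g x) (f x) < e" if x: "x \<in> F" for x
          proof -
            have xA: "x \<in> A" and pA: "p x \<in> A"
              using x F p(1) D(2) by auto
            have "dB (g x) (f x) \<le> dB (g x) (g (p x)) + dB (g (p x)) (f x)"
              using g fl xA pA by (intro B.triangle) (auto intro: lip_in)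
            moreover have "dB (g (p x)) (f x) \<le> dB (g (p x)) (f (p x)) + dB (f (p x)) (f x)"
              using g fl xA pA by (intro B.triangle) (auto intro: lip_in)
            moreover have "dB (g (p x)) (f (p x)) < e / 3"
              using gV x p(1)[OF x] by (auto simp: V_def h_def B.commute)
            moreover have "dB (g x) (g (p x)) < e / 3" "dB (f (p x)) (f x) < e / 3"
              using lip_le[OF g xA pA] lip_le[OF fl pA xA] p(2)[OF x] by (auto simp: A.commute)
            ultimately show ?thesis
              by linarith
          qed
          then have "g \<in> U"
            using g sub by blast
          then show "h g \<in> h ` U"
            by (rule imageI)
        qed
        ultimately show ?thesis
          by blast
      qed
      then show "openin (subtopology Y (h ` lip)) (h ` U)"
        by (subst openin_subopen) blast
    qed
  qed
  ultimately show ?thesis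
    using homeomorphic_completely_metrizable_space homeomorphic_map_imp_homeomorphic_space by blast
qed

text \<open>Complete metrizability passes to closed subsets, and separability to subspaces by way of
  second countability.\<close>

lemma Polish_closedin_lip:
  assumes "B.mcomplete" "separable_space A.mtopology" "separable_space B.mtopology"
    and "closedin lip_top S"
  shows "Polish_space (subtopology lip_top S)"
  unfolding Polish_space_def
proof
  show "completely_metrizable_space (subtopology lip_top S)"
    by (rule completely_metrizable_space_closedin[OF completely_metrizable_lip[OF assms(1,2)] assms(4)])
  show "separable_space (subtopology lip_top S)"
    by (rule second_countable_imp_separable_space[OF second_countable_subtopology[OF
          second_countable_lip[OF assms(2,3)]]])
qed

end

section \<open>Limits in the 2-norm\<close>

context vn_state
begin

text \<open>Convergence is taken in the whole algebra and not in the metric space of the ball,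
  because sums and multiples of ball elements may leave the ball.\<close>

definition norm2_lim :: "(nat \<Rightarrow> 'h \<Rightarrow>\<^sub>L 'h) \<Rightarrow> ('h \<Rightarrow>\<^sub>L 'h) \<Rightarrow> bool" where
  "norm2_lim y l \<longleftrightarrow> (\<forall>n. y n \<in> M) \<and> l \<in> M \<and> (\<lambda>n. norm2 \<phi> (y n - l)) \<longlonglongrightarrow> 0"

lemma norm2_lim_const: "l \<in> M \<Longrightarrow> norm2_lim (\<lambda>_. l) l"
  by (simp add: norm2_lim_def norm2_zero)

lemma norm2_lim_unique:
  assumes y: "norm2_lim y l" "norm2_lim y l'"
  shows "l = l'"
proof -
  have M: "y n \<in> M" "l \<in> M" "l' \<in> M" for n
    using y by (simp_all add: norm2_lim_def)
  have "(\<lambda>n. norm2 \<phi> (y n - l) + norm2 \<phi> (y n - l')) \<longlonglongrightarrow> 0 + 0"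
    using y by (intro tendsto_intros) (simp_all add: norm2_lim_def)
  moreover have "norm2 \<phi> (l - l') \<le> norm2 \<phi> (y n - l) + norm2 \<phi> (y n - l')" for n
    using norm2_triangle[of "l - y n" "y n - l'"] norm2_diff_commute[of l "y n"] M
    by (simp add: diff_in)
  ultimately have "norm2 \<phi> (l - l') \<le> 0"
    using LIMSEQ_le_const by fastforce
  then show ?thesis
    using norm2_nonneg[of "l - l'"] norm2_eq_zero_iff[of "l - l'"] M diff_in[of l l'] by simp
qed

lemma norm2_lim_add:
  assumes y: "norm2_lim y l" "norm2_lim y' l'"
  shows "norm2_lim (\<lambda>n. y n + y' n) (l + l')"
proof -
  have M: "y n \<in> M" "l \<in> M" "y' n \<in> M" "l' \<in> M" for n
    using y by (simp_all add: norm2_lim_def)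
  have "(\<lambda>n. norm2 \<phi> (y n - l) + norm2 \<phi> (y' n - l')) \<longlonglongrightarrow> 0 + 0"
    using y by (intro tendsto_intros) (simp_all add: norm2_lim_def)
  moreover have "norm2 \<phi> (y n + y' n - (l + l')) \<le> norm2 \<phi> (y n - l) + norm2 \<phi> (y' n - l')" for n
    using norm2_triangle[of "y n - l" "y' n - l'"] M by (simp add: diff_in algebra_simps)
  ultimately have "(\<lambda>n. norm2 \<phi> (y n + y' n - (l + l'))) \<longlonglongrightarrow> 0"
    using M
    by - (rule Lim_null_comparison[of _ "\<lambda>n. norm2 \<phi> (y n - l) + norm2 \<phi> (y' n - l')"],
      simp_all add: norm2_nonneg mem_intros)
  then show ?thesis
    using M by (simp add: norm2_lim_def add_in)
qed

lemma norm2_lim_scaleC: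
  assumes "norm2_lim y l"
  shows "norm2_lim (\<lambda>n. a *\<^sub>C y n) (a *\<^sub>C l)"
proof -
  have M: "y n \<in> M" "l \<in> M" for n
    using assms by (simp_all add: norm2_lim_def)
  have "(\<lambda>n. cmod a * norm2 \<phi> (y n - l)) \<longlonglongrightarrow> cmod a * 0"
    using assms by (intro tendsto_intros) (simp add: norm2_lim_def)
  moreover have "cmod a * norm2 \<phi> (y n - l) = norm2 \<phi> (a *\<^sub>C y n - a *\<^sub>C l)" for n
    using M by (simp add: norm2_scaleC diff_in flip: scaleC_diff_right)
  ultimately show ?thesis
    using M by (simp add: norm2_lim_def scaleC_in)
qed

lemma norm2_lim_phi:
  assumes "norm2_lim y l"
  shows "(\<lambda>n. \<phi> (y n)) \<longlonglongrightarrow> \<phi> l"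
proof -
  have M: "y n \<in> M" "l \<in> M" for n
    using assms by (simp_all add: norm2_lim_def)
  have "(\<lambda>n. \<phi> (y n) - \<phi> l) \<longlonglongrightarrow> 0"
  proof (rule Lim_null_comparison[OF always_eventually], rule allI)
    show "cmod (\<phi> (y n) - \<phi> l) \<le> norm2 \<phi> (y n - l)" for n
      using cmod_phi_le[of "y n - l"] M by (simp add: diff_in phi_diff)
    show "(\<lambda>n. norm2 \<phi> (y n - l)) \<longlonglongrightarrow> 0"
      using assms by (simp add: norm2_lim_def)
  qed
  then show ?thesis
    by (rule LIM_zero_cancel)
qed

lemma norm2_lim_cinner:
  assumes y: "norm2_lim y l" and bound: "\<And>n. norm (y n) \<le> K"
  shows "(\<lambda>n. cinner (blinfun_apply (y n) \<xi>) \<eta>) \<longlonglongrightarrow> cinner (blinfun_apply l \<xi>) \<eta>"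
proof -
  have M: "y n \<in> M" "l \<in> M" for n
    using y by (simp_all add: norm2_lim_def)
  have "wot_tendsto (\<lambda>n. y n - l) 0 sequentially"
  proof (rule norm2_tendsto_imp_wot_tendsto)
    show "norm (y n - l) \<le> K + norm l" for n
      using norm_triangle_ineq4[of "y n" l] bound[of n] by simp
  qed (use M y in \<open>simp_all add: diff_in norm2_lim_def\<close>)
  then have "(\<lambda>n. cinner (blinfun_apply (y n) \<xi>) \<eta> - cinner (blinfun_apply l \<xi>) \<eta>) \<longlonglongrightarrow> 0"
    by (simp add: wot_tendsto_def blinfun.diff_left cinner.diff_left cinner.zero_left)
  then show ?thesis
    by (rule LIM_zero_cancel)
qed

end

section \<open>State-preserving ucp maps\<close>

lemma sum_lessThan_2: "(\<Sum>i<2. f i) = f 0 + f (Suc 0)"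
  for f :: "nat \<Rightarrow> 'a::comm_monoid_add"
  by (simp add: numeral_2_eq_2)

locale vn_state_pair = A: vn_state M \<phi> + B: vn_state N \<rho>
  for M :: "('h::complex_hilbert_space \<Rightarrow>\<^sub>L 'h) set" and \<phi>
    and N :: "('g::complex_hilbert_space \<Rightarrow>\<^sub>L 'g) set" and \<rho>
begin

sublocale L: lip_maps "unit_ball M" "dist2 M \<phi>" "unit_ball N" "dist2 N \<rho>"
  by (simp add: lip_maps_def A.Metric_space_ball B.Metric_space_ball)

lemma lip1_eq: "lip1 M \<phi> N \<rho> = L.lip"
  by (simp add: lip1_def L.lip_def)

lemma lip1_topology_eq: "lip1_topology M \<phi> N \<rho> = L.lip_top"
  by (simp add: lip1_topology_def L.lip_top_def lip1_eq)

section \<open>The Kadison-Schwarz inequality and contractivity of ucp maps\<close>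

context
  fixes \<Phi> :: "('h \<Rightarrow>\<^sub>L 'h) \<Rightarrow> ('g \<Rightarrow>\<^sub>L 'g)"
  assumes ucp: "ucp_map M N \<Phi>"
begin

lemma ucp_in: "x \<in> M \<Longrightarrow> \<Phi> x \<in> N"
  and ucp_add: "x \<in> M \<Longrightarrow> y \<in> M \<Longrightarrow> \<Phi> (x + y) = \<Phi> x + \<Phi> y"
  and ucp_scaleC: "x \<in> M \<Longrightarrow> \<Phi> (a *\<^sub>C x) = a *\<^sub>C \<Phi> x"
  and ucp_id: "\<Phi> id_blinfun = id_blinfun"
  using ucp by (auto simp: ucp_map_def clinear_on_def)

lemma ucp_diff: "x \<in> M \<Longrightarrow> y \<in> M \<Longrightarrow> \<Phi> (x - y) = \<Phi> x - \<Phi> y"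
  using ucp_add[of "x - y" y] by (simp add: A.diff_in)

lemma ucp_positive_matrix:
  assumes "\<And>i j. i < n \<Longrightarrow> j < n \<Longrightarrow> x i j \<in> M" "positive_op_matrix n x"
  shows "(\<Sum>i<n. \<Sum>j<n. cinner (blinfun_apply (\<Phi> (x i j)) (\<xi> j)) (\<xi> i)) \<in> \<real>\<^sub>\<ge>\<^sub>0"
  using ucp assms by (auto simp: ucp_map_def completely_positive_on_def positive_op_matrix_def)

lemma ucp_positive:
  assumes "x \<in> M" "\<And>\<xi>. cinner (blinfun_apply x \<xi>) \<xi> \<in> \<real>\<^sub>\<ge>\<^sub>0"
  shows "cinner (blinfun_apply (\<Phi> x) \<xi>) \<xi> \<in> \<real>\<^sub>\<ge>\<^sub>0"
  using ucp_positive_matrix[of 1 "\<lambda>_ _. x" "\<lambda>_. \<xi>"] assms by (simp add: positive_op_matrix_def)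

text \<open>Complete positivity for the matrix with rows \<open>(1, x)\<close> and \<open>(x\<^sup>*, x\<^sup>* x)\<close>, whose quadratic form is
  \<open>\<parallel>\<xi>\<^sub>0 + x \<xi>\<^sub>1\<parallel>\<^sup>2\<close>.\<close>

lemma ucp_square_matrix:
  assumes x: "x \<in> M"
  shows "cinner a a + cinner (blinfun_apply (\<Phi> x) b) a +
    (cinner (blinfun_apply (\<Phi> (adj x)) a) b + cinner (blinfun_apply (\<Phi> (adj x o\<^sub>L x)) b) b) \<in> \<real>\<^sub>\<ge>\<^sub>0"
proof -
  define X where "X i j = (if i = 0 then if j = 0 then id_blinfun else x
    else if j = 0 then adj x else adj x o\<^sub>L x)" for i j :: nat
  have "positive_op_matrix 2 X"
    unfolding positive_op_matrix_def
  proof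
    fix \<xi> :: "nat \<Rightarrow> 'h"
    have "(\<Sum>i<2. \<Sum>j<2. cinner (blinfun_apply (X i j) (\<xi> j)) (\<xi> i)) =
        cinner (\<xi> 0 + blinfun_apply x (\<xi> 1)) (\<xi> 0 + blinfun_apply x (\<xi> 1))"
      using x by (simp add: sum_lessThan_2 X_def cinner_add_left cinner_add_right cinner_adj_left
          A.in_bounded_ops)
    also have "\<dots> \<in> \<real>\<^sub>\<ge>\<^sub>0"
      by (simp only: cinner_self) simp
    finally show "(\<Sum>i<2. \<Sum>j<2. cinner (blinfun_apply (X i j) (\<xi> j)) (\<xi> i)) \<in> \<real>\<^sub>\<ge>\<^sub>0" .
  qed
  moreover have "X i j \<in> M" for i j
    using x by (simp add: X_def A.mem_intros)
  ultimately have "(\<Sum>i<2. \<Sum>j<2. cinner (blinfun_apply (\<Phi> (X i j)) ((if j = 0 then a else b))) (if i = 0 then a else b)) \<in> \<real>\<^sub>\<ge>\<^sub>0"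
    by (intro ucp_positive_matrix)
  then show ?thesis
    by (simp add: sum_lessThan_2 X_def ucp_id)
qed

lemma square_positive: "x \<in> M \<Longrightarrow> cinner (blinfun_apply (adj x o\<^sub>L x) \<xi>) \<xi> \<in> \<real>\<^sub>\<ge>\<^sub>0"
  by (simp add: cinner_adj_left A.in_bounded_ops) (simp only: cinner_self, simp)

text \<open>The positive expression of \<open>ucp_square_matrix\<close> at a = - \<Phi>(x) b
  collapses to the claim once the two mixed terms have equal real parts. That symmetry follows from
  the expression being real: its imaginary part vanishes at \<open>\<i> *\<^sub>C a\<close> as
  well.\<close>

lemma kadison_schwarz:
  assumes x: "x \<in> M"
  shows "(norm (blinfun_apply (\<Phi> x) b))\<^sup>2 \<le> Re (cinner (blinfun_apply (\<Phi> (adj x o\<^sub>L x)) b) b)"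
proof -
  have real: "Im (cinner (blinfun_apply (\<Phi> (adj x o\<^sub>L x)) b) b) = 0"
    using ucp_positive[OF A.compose_in[OF A.adj_in[OF x] x] square_positive[OF x], of b]
    by (simp add: complex_nonneg_Reals_iff)
  have Im: "Im (cinner (blinfun_apply (\<Phi> x) b) a) + Im (cinner (blinfun_apply (\<Phi> (adj x)) a) b) = 0" for a
    using ucp_square_matrix[OF x, of a b] real cinner_self[of a]
    by (simp add: complex_nonneg_Reals_iff)
  have adj: "Re (cinner (blinfun_apply (\<Phi> (adj x)) a) b) = Re (cinner (blinfun_apply (\<Phi> x) b) a)" for a
    using Im[of "\<i> *\<^sub>C a"] ucp_in[OF A.adj_in[OF x]]
    by (simp add: cinner_scaleC_left cinner_scaleC_right B.in_bounded_ops bounded_ops_scaleC)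
  define a where "a = - blinfun_apply (\<Phi> x) b"
  have "Re (cinner (blinfun_apply (\<Phi> x) b) a) = - (norm (blinfun_apply (\<Phi> x) b))\<^sup>2"
    by (simp add: a_def cinner.minus_right cinner_self del: of_real_power)
  moreover have "Re (cinner a a) = (norm (blinfun_apply (\<Phi> x) b))\<^sup>2"
    by (simp add: a_def cinner.minus_right cinner.minus_left cinner_self del: of_real_power)
  ultimately show ?thesis
    using ucp_square_matrix[OF x, of a b] adj[of a] by (simp add: complex_nonneg_Reals_iff)
qed

text \<open>The operator 1 - \<open>adj x o\<^sub>L x\<close> is positive, so \<Phi> maps
  \<open>adj x o\<^sub>L x\<close> below the identity; Kadison-Schwarz then bounds
  \<Phi>(x).\<close>

lemma ucp_unit_ball:
  assumes "x \<in> unit_ball M"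
  shows "\<Phi> x \<in> unit_ball N"
proof -
  have x: "x \<in> M" "norm x \<le> 1"
    using assms by (simp_all add: unit_ball_def)
  have "norm (\<Phi> x) \<le> 1"
  proof (rule norm_blinfun_bound)
    fix b
    have pos: "cinner (blinfun_apply (id_blinfun - (adj x o\<^sub>L x)) \<xi>) \<xi> \<in> \<real>\<^sub>\<ge>\<^sub>0" for \<xi>
    proof -
      have "(norm (blinfun_apply x \<xi>))\<^sup>2 \<le> (norm \<xi>)\<^sup>2"
        using norm_apply_le[OF x(2), of \<xi>] by (intro power_mono) simp_all
      then show ?thesis
        using x(1) by (simp add: blinfun.diff_left cinner.diff_left cinner_adj_left A.in_bounded_ops
            cinner_self complex_nonneg_Reals_iff del: of_real_power)
    qed
    have sq: "adj x o\<^sub>L x \<in> M"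
      using x(1) by (simp add: A.mem_intros)
    have "cinner (blinfun_apply (\<Phi> (id_blinfun - (adj x o\<^sub>L x))) b) b \<in> \<real>\<^sub>\<ge>\<^sub>0"
      by (rule ucp_positive[OF A.diff_in[OF A.id_in sq] pos])
    then have "Re (cinner (blinfun_apply (\<Phi> (adj x o\<^sub>L x)) b) b) \<le> (norm b)\<^sup>2"
      by (simp add: ucp_diff[OF A.id_in sq] ucp_id blinfun.diff_left cinner.diff_left cinner_self
          complex_nonneg_Reals_iff del: of_real_power)
    then have "(norm (blinfun_apply (\<Phi> x) b))\<^sup>2 \<le> (norm b)\<^sup>2"
      using kadison_schwarz[OF x(1), of b] by linarith
    then have "norm (blinfun_apply (\<Phi> x) b) \<le> norm b"
      by (rule power2_le_imp_le) simp
    then show "norm (blinfun_apply (\<Phi> x) b) \<le> 1 * norm b"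
      by simp
  qed simp
  then show ?thesis
    using x by (simp add: unit_ball_def ucp_in)
qed

text \<open>The state \<rho> is applied to the operator form of Kadison-Schwarz, and \<rho> after
  \<Phi> is \<phi>.\<close>

lemma ucp_norm2_le:
  assumes state: "\<And>x. x \<in> M \<Longrightarrow> \<rho> (\<Phi> x) = \<phi> x" and x: "x \<in> M"
  shows "norm2 \<rho> (\<Phi> x) \<le> norm2 \<phi> x"
proof -
  have sq: "adj x o\<^sub>L x \<in> M" and y: "\<Phi> x \<in> N"
    using x by (simp_all add: A.mem_intros ucp_in)
  have "Re (\<rho> (adj (\<Phi> x) o\<^sub>L \<Phi> x)) \<le> Re (\<rho> (\<Phi> (adj x o\<^sub>L x)))"
  proof (rule B.phi_mono)
    fix b
    have "Im (cinner (blinfun_apply (\<Phi> (adj x o\<^sub>L x)) b) b) = 0"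
      using ucp_positive[OF sq square_positive[OF x], of b] by (simp add: complex_nonneg_Reals_iff)
    then show "cinner (blinfun_apply (\<Phi> (adj x o\<^sub>L x)) b) b -
        cinner (blinfun_apply (adj (\<Phi> x) o\<^sub>L \<Phi> x) b) b \<in> \<real>\<^sub>\<ge>\<^sub>0"
      using kadison_schwarz[OF x, of b] y
      by (simp add: cinner_adj_left B.in_bounded_ops cinner_self complex_nonneg_Reals_iff
          del: of_real_power)
  qed (use sq y in \<open>simp_all add: B.mem_intros ucp_in\<close>)
  then show ?thesis
    by (simp add: norm2_def state sq)
qed

end

section \<open>Restrictions to the ball and sequences approximating points of the closure\<close>

lemma state_preserving_restrict_in_lip:
  assumes "\<Phi> \<in> state_preserving_ucp M \<phi> N \<rho>"
  shows "restrict \<Phi> (unit_ball M) \<in> L.lip"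
proof -
  have ucp: "ucp_map M N \<Phi>" and st: "\<And>x. x \<in> M \<Longrightarrow> \<rho> (\<Phi> x) = \<phi> x"
    using assms by (simp_all add: state_preserving_ucp_def)
  have "dist2 N \<rho> (\<Phi> x) (\<Phi> y) \<le> dist2 M \<phi> x y" if "x \<in> unit_ball M" "y \<in> unit_ball M" for x y
  proof -
    have M: "x \<in> M" "y \<in> M"
      using that by (simp_all add: unit_ball_def)
    show ?thesis
      using ucp_norm2_le[OF ucp st A.diff_in[OF M]]
      by (simp add: dist2_def M ucp_in[OF ucp] ucp_diff[OF ucp])
  qed
  then show ?thesis
    by (auto simp: L.lip_def ucp_unit_ball[OF ucp])
qed

lemma restrictions_subset_lip:
  "F \<subseteq> state_preserving_ucp M \<phi> N \<rho> \<Longrightarrow> restrictions_to_ball M F \<subseteq> L.lip"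
  using state_preserving_restrict_in_lip by (auto simp: restrictions_to_ball_def)

text \<open>Stated for an arbitrary family \<open>F\<close> of state-preserving ucp maps, so that
  for Markov maps the approximating maps are Markov too.\<close>

lemma closure_approximation:
  assumes F: "F \<subseteq> state_preserving_ucp M \<phi> N \<rho>"
    and f: "f \<in> L.lip_top closure_of (restrictions_to_ball M F)"
    and P: "finite P" "P \<subseteq> unit_ball M"
  obtains \<Psi> where "\<And>n. \<Psi> n \<in> F" "\<And>x. x \<in> P \<Longrightarrow> B.norm2_lim (\<lambda>n. \<Psi> n x) (f x)"
proof -
  have fl: "f \<in> L.lip"
    using f by (simp add: in_closure_of L.topspace_lip)
  obtain g where g: "\<And>n. g n \<in> restrictions_to_ball M F" "\<And>n. g n \<in> L.lip"
    "\<And>x. x \<in> P \<Longrightarrow> (\<lambda>n. dist2 N \<rho> (g n x) (f x)) \<longlonglongrightarrow> 0"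
    using L.lip_closure_sequence[OF f P] by metis
  have "\<exists>\<Psi>\<in>F. g n = restrict \<Psi> (unit_ball M)" for n
    using g(1)[of n] by (auto simp: restrictions_to_ball_def)
  then obtain \<Psi> where \<Psi>: "\<And>n. \<Psi> n \<in> F" "\<And>n. g n = restrict (\<Psi> n) (unit_ball M)"
    by metis
  have "B.norm2_lim (\<lambda>n. \<Psi> n x) (f x)" if x: "x \<in> P" for x
  proof -
    have xB: "x \<in> unit_ball M"
      using x P by blast
    have "\<Psi> n x \<in> unit_ball N" "f x \<in> unit_ball N" for n
      using L.lip_in[OF g(2) xB, of n] L.lip_in[OF fl xB] xB by (simp_all add: \<Psi>)
    then show ?thesis
      using g(3)[OF x] xB B.unit_ball_subset
      by (auto simp: B.norm2_lim_def \<Psi> B.dist2_ball)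
  qed
  with \<Psi> that show ?thesis
    by blast
qed

lemma
  assumes "\<Phi> \<in> state_preserving_ucp M \<phi> N \<rho>"
  shows state_preserving_ucp: "ucp_map M N \<Phi>"
    and state_preserving_rho: "x \<in> M \<Longrightarrow> \<rho> (\<Phi> x) = \<phi> x"
  using assms by (simp_all add: state_preserving_ucp_def)

section \<open>Extending a limit map from the ball to the algebra\<close>

context
  fixes f
  assumes f: "f \<in> L.lip_top closure_of (restrictions_to_ball M (state_preserving_ucp M \<phi> N \<rho>))"
begin

lemma limit_in: "x \<in> unit_ball M \<Longrightarrow> f x \<in> N"
  using f L.lip_in[of f] B.unit_ball_subset by (auto simp: in_closure_of L.topspace_lip)

text \<open>Linearity involves only the three points x, y and their combination, so one
  approximating sequence of linear maps serves all three, and 2-norm limits are unique. The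
  combination must lie in the ball because \<open>f\<close> is meaningful only there.\<close>

lemma limit_combination:
  assumes x: "x \<in> unit_ball M" and y: "y \<in> unit_ball M"
    and z: "a *\<^sub>C x + b *\<^sub>C y \<in> unit_ball M"
  shows "f (a *\<^sub>C x + b *\<^sub>C y) = a *\<^sub>C f x + b *\<^sub>C f y"
proof -
  have M: "x \<in> M" "y \<in> M"
    using x y by (simp_all add: unit_ball_def)
  obtain \<Psi> where \<Psi>: "\<And>n. \<Psi> n \<in> state_preserving_ucp M \<phi> N \<rho>"
    "\<And>u. u \<in> {x, y, a *\<^sub>C x + b *\<^sub>C y} \<Longrightarrow> B.norm2_lim (\<lambda>n. \<Psi> n u) (f u)"
    using closure_approximation[OF order_refl f, of "{x, y, a *\<^sub>C x + b *\<^sub>C y}"] x y z by auto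
  have "B.norm2_lim (\<lambda>n. a *\<^sub>C \<Psi> n x + b *\<^sub>C \<Psi> n y) (a *\<^sub>C f x + b *\<^sub>C f y)"
    by (intro B.norm2_lim_add B.norm2_lim_scaleC \<Psi>) auto
  moreover have "a *\<^sub>C \<Psi> n x + b *\<^sub>C \<Psi> n y = \<Psi> n (a *\<^sub>C x + b *\<^sub>C y)" for n
    using ucp_add[OF state_preserving_ucp[OF \<Psi>(1)]] ucp_scaleC[OF state_preserving_ucp[OF \<Psi>(1)]] M
    by (simp add: A.scaleC_in)
  ultimately have "B.norm2_lim (\<lambda>n. \<Psi> n (a *\<^sub>C x + b *\<^sub>C y)) (a *\<^sub>C f x + b *\<^sub>C f y)"
    by simp
  then show ?thesis
    using \<Psi>(2)[of "a *\<^sub>C x + b *\<^sub>C y"] B.norm2_lim_unique by blast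
qed

lemma limit_scaleC:
  assumes "x \<in> unit_ball M" "a *\<^sub>C x \<in> unit_ball M"
  shows "f (a *\<^sub>C x) = a *\<^sub>C f x"
  using limit_combination[of x x a 0] assms by (simp add: scaleC_zero_left)

lemma id_in_unit_ball: "id_blinfun \<in> unit_ball M"
  using A.id_in norm_blinfun_id_le by (simp add: unit_ball_def)

lemma limit_id: "f id_blinfun = id_blinfun"
proof -
  obtain \<Psi> where \<Psi>: "\<And>n. \<Psi> n \<in> state_preserving_ucp M \<phi> N \<rho>"
    "\<And>u. u \<in> {id_blinfun} \<Longrightarrow> B.norm2_lim (\<lambda>n. \<Psi> n u) (f u)"
    using closure_approximation[OF order_refl f, of "{id_blinfun}"] id_in_unit_ball by auto
  then have "B.norm2_lim (\<lambda>n. id_blinfun) (f id_blinfun)"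
    using ucp_id[OF state_preserving_ucp[OF \<Psi>(1)]] by (metis (no_types, lifting) singletonI ext)
  then show ?thesis
    using B.norm2_lim_const[OF B.id_in] B.norm2_lim_unique by blast
qed

lemma limit_rho:
  assumes x: "x \<in> unit_ball M"
  shows "\<rho> (f x) = \<phi> x"
proof -
  have M: "x \<in> M"
    using x by (simp add: unit_ball_def)
  obtain \<Psi> where \<Psi>: "\<And>n. \<Psi> n \<in> state_preserving_ucp M \<phi> N \<rho>"
    "\<And>u. u \<in> {x} \<Longrightarrow> B.norm2_lim (\<lambda>n. \<Psi> n u) (f u)"
    using closure_approximation[OF order_refl f, of "{x}"] x by auto
  then have "(\<lambda>n. \<rho> (\<Psi> n x)) \<longlonglongrightarrow> \<rho> (f x)"
    by (intro B.norm2_lim_phi) simp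
  then show ?thesis
    using state_preserving_rho[OF \<Psi>(1) M] by (simp add: LIMSEQ_const_iff)
qed

text \<open>The entries form a finite set. Ucp maps keep them in the unit ball, and on bounded
  sequences 2-norm convergence implies convergence of matrix coefficients; the nonnegative reals are
  closed.\<close>

lemma limit_positive_matrix:
  assumes x: "\<And>i j. i < n \<Longrightarrow> j < n \<Longrightarrow> x i j \<in> unit_ball M" and pos: "positive_op_matrix n x"
  shows "positive_op_matrix n (\<lambda>i j. f (x i j))"
  unfolding positive_op_matrix_def
proof
  fix \<xi> :: "nat \<Rightarrow> 'g"
  define P where "P = (\<lambda>(i, j). x i j) ` ({..<n} \<times> {..<n})"
  have P: "finite P" "P \<subseteq> unit_ball M" "\<And>i j. i < n \<Longrightarrow> j < n \<Longrightarrow> x i j \<in> P"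
    using x by (auto simp: P_def)
  obtain \<Psi> where \<Psi>: "\<And>n. \<Psi> n \<in> state_preserving_ucp M \<phi> N \<rho>"
    "\<And>u. u \<in> P \<Longrightarrow> B.norm2_lim (\<lambda>n. \<Psi> n u) (f u)"
    using closure_approximation[OF order_refl f P(1,2)] by metis
  have lim: "(\<lambda>k. \<Sum>i<n. \<Sum>j<n. cinner (blinfun_apply (\<Psi> k (x i j)) (\<xi> j)) (\<xi> i)) \<longlonglongrightarrow>
      (\<Sum>i<n. \<Sum>j<n. cinner (blinfun_apply (f (x i j)) (\<xi> j)) (\<xi> i))"
  proof (intro tendsto_sum)
    fix i j assume "i \<in> {..<n}" "j \<in> {..<n}"
    then have ij: "x i j \<in> P" "x i j \<in> unit_ball M"
      using P(3) x by auto
    show "(\<lambda>k. cinner (blinfun_apply (\<Psi> k (x i j)) (\<xi> j)) (\<xi> i)) \<longlonglongrightarrow>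
        cinner (blinfun_apply (f (x i j)) (\<xi> j)) (\<xi> i)"
    proof (rule B.norm2_lim_cinner[OF \<Psi>(2)[OF ij(1)]])
      show "norm (\<Psi> k (x i j)) \<le> 1" for k
        using ucp_unit_ball[OF state_preserving_ucp[OF \<Psi>(1)] ij(2), of k] by (simp add: unit_ball_def)
    qed
  qed
  have "(\<Sum>i<n. \<Sum>j<n. cinner (blinfun_apply (\<Psi> k (x i j)) (\<xi> j)) (\<xi> i)) \<in> \<real>\<^sub>\<ge>\<^sub>0" for k
    using x pos A.unit_ball_subset
    by (intro ucp_positive_matrix[OF state_preserving_ucp[OF \<Psi>(1)]]) auto
  then show "(\<Sum>i<n. \<Sum>j<n. cinner (blinfun_apply (f (x i j)) (\<xi> j)) (\<xi> i)) \<in> \<real>\<^sub>\<ge>\<^sub>0"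
    by (intro Lim_in_closed_set[OF closed_nonneg_Reals_complex _ _ lim]) auto
qed

text \<open>Homogeneity dictates the formula. The radius \<open>norm x + 1\<close> is positive also
  for x = 0; \<open>extension_eq\<close> allows any other admissible radius.\<close>

definition extension :: "('h \<Rightarrow>\<^sub>L 'h) \<Rightarrow> ('g \<Rightarrow>\<^sub>L 'g)" where
  "extension x = complex_of_real (norm x + 1) *\<^sub>C f (complex_of_real (1 / (norm x + 1)) *\<^sub>C x)"

lemma scaled_in_unit_ball:
  assumes "x \<in> M" "0 < R" "norm x \<le> R"
  shows "complex_of_real (1 / R) *\<^sub>C x \<in> unit_ball M"
  using assms by (simp add: unit_ball_def A.scaleC_in norm_scaleC_blinfun norm_divide)

text \<open>Passing from a radius to a larger one multiplies the scaled point by a factor at most 1,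
  which stays in the ball, where \<open>f\<close> is homogeneous. Two arbitrary radii are compared
  through their maximum.\<close>

lemma extension_eq:
  assumes x: "x \<in> M" and R: "0 < R" "norm x \<le> R"
  shows "extension x = complex_of_real R *\<^sub>C f (complex_of_real (1 / R) *\<^sub>C x)"
proof -
  have step: "complex_of_real r *\<^sub>C f (complex_of_real (1 / r) *\<^sub>C x) =
      complex_of_real s *\<^sub>C f (complex_of_real (1 / s) *\<^sub>C x)"
    if r: "0 < r" "norm x \<le> r" and s: "r \<le> s" for r s
  proof -
    have eq: "complex_of_real (1 / s) *\<^sub>C x = complex_of_real (r / s) *\<^sub>C complex_of_real (1 / r) *\<^sub>C x"
      using r by (simp add: scaleC_scaleC flip: of_real_mult of_real_divide)
    have "f (complex_of_real (1 / s) *\<^sub>C x) = complex_of_real (r / s) *\<^sub>C f (complex_of_real (1 / r) *\<^sub>C x)"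
      unfolding eq using r s x
      by (intro limit_scaleC) (simp_all only: eq[symmetric], simp_all only: scaled_in_unit_ball)
    then show ?thesis
      using r s by (simp add: scaleC_scaleC flip: of_real_mult of_real_divide)
  qed
  have "0 < norm x + 1"
    by (simp add: add_nonneg_pos)
  then show ?thesis
    unfolding extension_def
    using step[of R "max R (norm x + 1)"] step[of "norm x + 1" "max R (norm x + 1)"] R by simp
qed

lemma extension_ball: "x \<in> unit_ball M \<Longrightarrow> extension x = f x"
  using extension_eq[of x 1] by (simp add: unit_ball_def scaleC_one)

lemma extension_add:
  assumes x: "x \<in> M" and y: "y \<in> M"
  shows "extension (x + y) = extension x + extension y"
proof -
  \<comment> \<open>A common radius for both summands. The sum is taken at radius 2 R, which makes
    its scaled version the midpoint of two ball elements.\<close>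
  define R where "R = norm x + norm y + 1"
  have R: "0 < R" "norm x \<le> R" "norm y \<le> R"
    by (simp_all add: R_def add_nonneg_pos)
  have "norm (x + y) \<le> 2 * R"
    using norm_triangle_ineq[of x y] R by linarith
  note xy = extension_eq[OF A.add_in[OF x y], of "2 * R"] scaled_in_unit_ball[OF A.add_in[OF x y], of "2 * R"]
  have eq: "complex_of_real (1 / (2 * R)) *\<^sub>C (x + y) =
      (1/2) *\<^sub>C complex_of_real (1 / R) *\<^sub>C x + (1/2) *\<^sub>C complex_of_real (1 / R) *\<^sub>C y"
    by (simp add: scaleC_add_right scaleC_scaleC)
  have "f (complex_of_real (1 / (2 * R)) *\<^sub>C (x + y)) =
      (1/2) *\<^sub>C f (complex_of_real (1 / R) *\<^sub>C x) + (1/2) *\<^sub>C f (complex_of_real (1 / R) *\<^sub>C y)"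
    unfolding eq
    by (rule limit_combination) (use x y R xy(2) \<open>norm (x + y) \<le> 2 * R\<close> eq scaled_in_unit_ball in simp_all)
  then show ?thesis
    using xy(1) R \<open>norm (x + y) \<le> 2 * R\<close> extension_eq[OF x R(1,2)] extension_eq[OF y R(1,3)]
    by (simp add: scaleC_add_right scaleC_scaleC)
qed

lemma extension_scaleC:
  assumes x: "x \<in> M"
  shows "extension (a *\<^sub>C x) = a *\<^sub>C extension x"
proof -
  define r where "r = norm x + 1"
  \<comment> \<open>Scaling \<open>a\<close> by s gives modulus at most 1, so the scaled multiple
    stays in the ball; the summand 1 keeps s positive when a = 0.\<close>
  define s where "s = cmod a + 1"
  have r: "0 < r" "norm x \<le> r" and s: "0 < s" "cmod a \<le> s"
    by (simp_all add: r_def s_def add_nonneg_pos)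
  have le: "norm (a *\<^sub>C x) \<le> s * r"
    unfolding norm_scaleC_blinfun using r s by (intro mult_mono) auto
  have eq: "complex_of_real (1 / (s * r)) *\<^sub>C a *\<^sub>C x = (a / s) *\<^sub>C complex_of_real (1 / r) *\<^sub>C x"
    by (simp add: scaleC_scaleC)
  have ax: "extension (a *\<^sub>C x) = complex_of_real (s * r) *\<^sub>C f (complex_of_real (1 / (s * r)) *\<^sub>C a *\<^sub>C x)"
    using le r s by (intro extension_eq A.scaleC_in x) auto
  have "complex_of_real (1 / (s * r)) *\<^sub>C a *\<^sub>C x \<in> unit_ball M"
    using le r s by (intro scaled_in_unit_ball A.scaleC_in x) auto
  then have "f (complex_of_real (1 / (s * r)) *\<^sub>C a *\<^sub>C x) = (a / s) *\<^sub>C f (complex_of_real (1 / r) *\<^sub>C x)"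
    unfolding eq by (intro limit_scaleC scaled_in_unit_ball x r)
  then show ?thesis
    unfolding ax extension_eq[OF x r] using r s by (simp add: scaleC_scaleC mult.commute)
qed

text \<open>All entries are scaled by one common radius. Positivity of a matrix is unaffected by a
  positive scalar, so the claim reduces to matrices over the ball.\<close>

lemma extension_positive_matrix:
  assumes x: "\<And>i j. i < n \<Longrightarrow> j < n \<Longrightarrow> x i j \<in> M" and pos: "positive_op_matrix n x"
  shows "positive_op_matrix n (\<lambda>i j. extension (x i j))"
proof -
  define R where "R = 1 + (\<Sum>i<n. \<Sum>j<n. norm (x i j))"
  have R: "0 < R"
    unfolding R_def by (intro add_pos_nonneg sum_nonneg) auto
  have le: "norm (x i j) \<le> R" if "i < n" "j < n" for i j
  proof -
    have "norm (x i j) \<le> (\<Sum>j<n. norm (x i j))"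
      using that by (intro member_le_sum) auto
    also have "\<dots> \<le> (\<Sum>i<n. \<Sum>j<n. norm (x i j))"
      using that by (intro member_le_sum[of i "{..<n}" "\<lambda>i. \<Sum>j<n. norm (x i j)"] sum_nonneg) auto
    finally show ?thesis
      by (simp add: R_def)
  qed
  have scale: "(\<Sum>i<n. \<Sum>j<n. cinner (blinfun_apply (complex_of_real c *\<^sub>C z i j) (\<xi> j)) (\<xi> i)) =
      complex_of_real c * (\<Sum>i<n. \<Sum>j<n. cinner (blinfun_apply (z i j) (\<xi> j)) (\<xi> i))"
    for c and z :: "nat \<Rightarrow> nat \<Rightarrow> 'i \<Rightarrow>\<^sub>L 'i::complex_hilbert_space" and \<xi> :: "nat \<Rightarrow> 'i"
    by (simp add: scaleC_blinfun_apply cinner_scaleC_left sum_distrib_left)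
  have "positive_op_matrix n (\<lambda>i j. complex_of_real (1 / R) *\<^sub>C x i j)"
    unfolding positive_op_matrix_def scale
    using pos R by (auto simp: positive_op_matrix_def complex_nonneg_Reals_iff)
  then have "positive_op_matrix n (\<lambda>i j. f (complex_of_real (1 / R) *\<^sub>C x i j))"
    by (intro limit_positive_matrix scaled_in_unit_ball x R le)
  then have "positive_op_matrix n (\<lambda>i j. complex_of_real R *\<^sub>C f (complex_of_real (1 / R) *\<^sub>C x i j))"
    unfolding positive_op_matrix_def scale
    using R by (auto simp: complex_nonneg_Reals_iff)
  then show ?thesis
    using x R le by (simp add: positive_op_matrix_def extension_eq)
qed

lemma extension_state_preserving: "extension \<in> state_preserving_ucp M \<phi> N \<rho>"
proof -
  have in_N: "extension x \<in> N" if "x \<in> M" for x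
    unfolding extension_def using that
    by (intro B.scaleC_in limit_in scaled_in_unit_ball) (simp_all add: add_nonneg_pos)
  have "\<rho> (extension x) = \<phi> x" if x: "x \<in> M" for x
  proof -
    define r where "r = norm x + 1"
    have r: "0 < r" "norm x \<le> r"
      by (simp_all add: r_def add_nonneg_pos)
    show ?thesis
      unfolding extension_eq[OF x r]
      using r x scaled_in_unit_ball[OF x r] limit_in limit_rho
      by (simp add: B.phi_scaleC A.phi_scaleC)
  qed
  moreover have "clinear_on M extension"
    by (simp add: clinear_on_def extension_add extension_scaleC)
  moreover have "completely_positive_on M extension"
    unfolding completely_positive_on_def using extension_positive_matrix by blast
  moreover have "extension id_blinfun = id_blinfun"
    by (simp add: extension_ball id_in_unit_ball limit_id)
  ultimately show ?thesis
    using in_N by (auto simp: state_preserving_ucp_def ucp_map_def)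
qed

lemma limit_is_restriction: "f \<in> restrictions_to_ball M (state_preserving_ucp M \<phi> N \<rho>)"
proof -
  have "f \<in> extensional (unit_ball M)"
    using f by (auto simp: in_closure_of L.topspace_lip L.lip_def PiE_iff)
  then have "f = restrict extension (unit_ball M)"
    by (intro extensionalityI[of _ "unit_ball M"]) (auto simp: extension_ball)
  then show ?thesis
    unfolding restrictions_to_ball_def using extension_state_preserving by blast
qed

end

lemma closedin_state_preserving_ucp:
  "closedin L.lip_top (restrictions_to_ball M (state_preserving_ucp M \<phi> N \<rho>))"
  using limit_is_restriction restrictions_subset_lip[OF order_refl]
  by (simp add: closure_of_subset_eq[symmetric] L.topspace_lip subset_iff)

end

section \<open>Markov maps\<close>

context vn_state
begin

lemma gns_norm:
  assumes gns: "gns_representation M \<phi> \<pi> \<Omega>" and x: "x \<in> M"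
  shows "norm (blinfun_apply (\<pi> x) \<Omega>) = norm2 \<phi> x"
proof -
  have \<pi>x: "\<pi> x \<in> bounded_ops"
    using gns x by (auto simp: gns_representation_def)
  have "complex_of_real ((norm (blinfun_apply (\<pi> x) \<Omega>))\<^sup>2) =
      cinner (blinfun_apply (\<pi> (adj x o\<^sub>L x)) \<Omega>) \<Omega>"
    using gns x \<pi>x by (simp add: gns_representation_def adj_in cinner_adj_left cinner_self)
  also have "\<dots> = \<phi> (adj x o\<^sub>L x)"
    using gns compose_in[OF adj_in[OF x] x] unfolding gns_representation_def by blast
  also have "\<dots> = complex_of_real ((norm2 \<phi> x)\<^sup>2)"
    by (rule phi_self[OF x])
  finally have "(norm (blinfun_apply (\<pi> x) \<Omega>))\<^sup>2 = (norm2 \<phi> x)\<^sup>2"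
    using of_real_eq_iff by blast
  then show ?thesis
    by (rule power2_eq_imp_eq) (simp_all add: norm2_nonneg x)
qed

lemma gns_diff:
  assumes gns: "gns_representation M \<phi> \<pi> \<Omega>" and x: "x \<in> M" "y \<in> M"
  shows "\<pi> (x - y) = \<pi> x - \<pi> y"
proof -
  have "\<pi> (x - y + y) = \<pi> (x - y) + \<pi> y"
    using gns x by (simp only: gns_representation_def clinear_on_def diff_in)
  then show ?thesis
    by simp
qed

lemma gns_apply_dense:
  assumes gns: "gns_representation M \<phi> \<pi> \<Omega>" and e: "0 < e"
  obtains a where "a \<in> M" "norm (\<zeta> - blinfun_apply (\<pi> a) \<Omega>) < e"
proof -
  have "\<zeta> \<in> closure {blinfun_apply (\<pi> x) \<Omega> | x. x \<in> M}"
    using gns by (simp add: gns_representation_def)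
  then obtain \<eta> where "\<eta> \<in> {blinfun_apply (\<pi> x) \<Omega> | x. x \<in> M}" "dist \<eta> \<zeta> < e"
    using e unfolding closure_approachable by blast
  then show ?thesis
    using that by (auto simp: dist_norm norm_minus_commute)
qed

text \<open>On the dense vectors \<pi>(a) \<Omega> the estimate is \<open>norm2_compose_le\<close>,
  and the vectors satisfying it form a closed set.\<close>

lemma gns_contractive:
  assumes gns: "gns_representation M \<phi> \<pi> \<Omega>" and x: "x \<in> M"
  shows "norm (blinfun_apply (\<pi> x) \<zeta>) \<le> norm x * norm \<zeta>"
proof -
  define C where "C = {\<zeta>. norm (blinfun_apply (\<pi> x) \<zeta>) \<le> norm x * norm \<zeta>}"
  have "closed C"
    unfolding C_def by (intro closed_Collect_le continuous_intros)
  moreover have "{blinfun_apply (\<pi> a) \<Omega> | a. a \<in> M} \<subseteq> C"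
  proof clarify
    fix a assume a: "a \<in> M"
    have "blinfun_apply (\<pi> x) (blinfun_apply (\<pi> a) \<Omega>) = blinfun_apply (\<pi> (x o\<^sub>L a)) \<Omega>"
      using gns x a by (simp add: gns_representation_def)
    then show "blinfun_apply (\<pi> a) \<Omega> \<in> C"
      using norm2_compose_le[OF x a] gns_norm[OF gns compose_in[OF x a]] gns_norm[OF gns a]
      by (simp add: C_def)
  qed
  ultimately have "closure {blinfun_apply (\<pi> a) \<Omega> | a. a \<in> M} \<subseteq> C"
    by (intro closure_minimal)
  then show ?thesis
    using gns by (auto simp: gns_representation_def C_def)
qed

text \<open>If \<open>z\<^sub>n\<close> is bounded and tends to 0 in the 2-norm, then so does \<open>z\<^sub>n\<^sup>* z\<^sub>n\<close>, hence
  \<open>z\<^sub>n\<^sup>* z\<^sub>n\<close> tends to 0 weakly and \<open>\<parallel>z\<^sub>n a\<parallel>\<^sub>2\<^sup>2 = \<phi>(a\<^sup>* z\<^sub>n\<^sup>* z\<^sub>n a)\<close> tends to 0 by normality.\<close>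

lemma norm2_compose_tendsto_zero:
  assumes z: "\<And>n. z n \<in> M" "\<And>n. norm (z n) \<le> K" and lim: "(\<lambda>n. norm2 \<phi> (z n)) \<longlonglongrightarrow> 0"
    and a: "a \<in> M"
  shows "(\<lambda>n. norm2 \<phi> (z n o\<^sub>L a)) \<longlonglongrightarrow> 0"
proof -
  have K: "0 \<le> K"
    using z(2)[of 0] norm_ge_zero order_trans by blast
  define w where "w n = adj (z n) o\<^sub>L z n" for n
  have w: "w n \<in> M" for n
    unfolding w_def by (intro mem_intros z)
  have adj_z: "norm (adj (z n)) \<le> K" for n
    using norm_adj_le[OF in_bounded_ops[OF z(1)]] z(2) order_trans by blast
  have norm_w: "norm (w n) \<le> K * K" for n
    unfolding w_def
    by (rule order_trans[OF norm_blinfun_compose]) (intro mult_mono adj_z z(2) K norm_ge_zero)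
  have "(\<lambda>n. K * norm2 \<phi> (z n)) \<longlonglongrightarrow> K * 0"
    by (intro tendsto_intros lim)
  moreover have "norm2 \<phi> (w n) \<le> K * norm2 \<phi> (z n)" for n
    unfolding w_def
    by (rule order_trans[OF norm2_compose_le[OF adj_in[OF z(1)] z(1)]])
      (intro mult_right_mono adj_z norm2_nonneg z(1))
  ultimately have "(\<lambda>n. norm2 \<phi> (w n)) \<longlonglongrightarrow> 0"
    by - (rule Lim_null_comparison[of _ "\<lambda>n. K * norm2 \<phi> (z n)"], simp_all add: norm2_nonneg w)
  then have "wot_tendsto w 0 sequentially"
    by (rule norm2_tendsto_imp_wot_tendsto[OF w norm_w])
  then have "wot_tendsto (\<lambda>n. adj a o\<^sub>L w n o\<^sub>L a) (adj a o\<^sub>L 0 o\<^sub>L a) sequentially"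
    by (rule wot_tendsto_compose) (simp add: a adj_in in_bounded_ops)
  then have "(\<lambda>n. \<phi> (adj a o\<^sub>L w n o\<^sub>L a)) \<longlonglongrightarrow> \<phi> (adj a o\<^sub>L 0 o\<^sub>L a)"
  proof (rule normal_tendsto[OF normal])
    have "norm (adj a o\<^sub>L w n o\<^sub>L a) \<le> norm (adj a) * (K * K) * norm a" for n
    proof -
      have "norm (adj a o\<^sub>L w n o\<^sub>L a) \<le> norm (adj a o\<^sub>L w n) * norm a"
        by (rule norm_blinfun_compose)
      also have "norm (adj a o\<^sub>L w n) \<le> norm (adj a) * norm (w n)"
        by (rule norm_blinfun_compose)
      also have "norm (w n) \<le> K * K"
        by (rule norm_w)
      finally show ?thesis
        by (simp add: mult_left_mono mult_right_mono)
    qed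
    then show "\<forall>\<^sub>F n in sequentially. adj a o\<^sub>L w n o\<^sub>L a \<in> M \<and>
        norm (adj a o\<^sub>L w n o\<^sub>L a) \<le> norm (adj a) * (K * K) * norm a"
      by (intro always_eventually allI conjI mem_intros a w)
  qed (intro mem_intros a)
  moreover have "adj a o\<^sub>L 0 o\<^sub>L a = 0"
    by (rule blinfun_eqI) simp
  moreover have "\<phi> (adj a o\<^sub>L w n o\<^sub>L a) = complex_of_real ((norm2 \<phi> (z n o\<^sub>L a))\<^sup>2)" for n
    using phi_self[OF compose_in[OF z(1) a], of n] z(1) a
    by (simp add: adj_compose in_bounded_ops w_def compose_assoc)
  ultimately have "(\<lambda>n. complex_of_real ((norm2 \<phi> (z n o\<^sub>L a))\<^sup>2)) \<longlonglongrightarrow> complex_of_real 0"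
    by (simp add: phi_zero del: of_real_power)
  then have "(\<lambda>n. (norm2 \<phi> (z n o\<^sub>L a))\<^sup>2) \<longlonglongrightarrow> 0"
    by (rule tendsto_of_real_iff[THEN iffD1])
  then have "(\<lambda>n. sqrt ((norm2 \<phi> (z n o\<^sub>L a))\<^sup>2)) \<longlonglongrightarrow> sqrt 0"
    by (rule tendsto_real_sqrt)
  then show ?thesis
    using norm2_nonneg[OF compose_in[OF z(1) a]] by simp
qed

text \<open>The vector \<zeta> is replaced by some \<pi>(a) \<Omega>. The error is uniformly small
  by contractivity of \<pi> on the bounded sequence, and the main term is the 2-norm of
  \<open>z n o\<^sub>L a\<close>, which tends to 0.\<close>

lemma gns_apply_tendsto_zero:
  assumes gns: "gns_representation M \<phi> \<pi> \<Omega>"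
    and z: "\<And>n. z n \<in> M" "\<And>n. norm (z n) \<le> K" and lim: "(\<lambda>n. norm2 \<phi> (z n)) \<longlonglongrightarrow> 0"
  shows "(\<lambda>n. blinfun_apply (\<pi> (z n)) \<zeta>) \<longlonglongrightarrow> 0"
proof (rule tendstoI)
  fix e :: real assume e: "0 < e"
  have K: "0 \<le> K"
    using z(2)[of 0] norm_ge_zero order_trans by blast
  \<comment> \<open>The divisor K + 1 also covers K = 0; after multiplication by the norm bound the
    error stays below e / 2.\<close>
  obtain a where a: "a \<in> M" "norm (\<zeta> - blinfun_apply (\<pi> a) \<Omega>) < e / (2 * (K + 1))"
    using gns_apply_dense[OF gns, of "e / (2 * (K + 1))" \<zeta>] e K by auto
  have "eventually (\<lambda>n. norm2 \<phi> (z n o\<^sub>L a) < e / 2) sequentially"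
    using order_tendstoD(2)[OF norm2_compose_tendsto_zero[OF z lim a(1)] half_gt_zero[OF e]] .
  then show "eventually (\<lambda>n. dist (blinfun_apply (\<pi> (z n)) \<zeta>) 0 < e) sequentially"
  proof eventually_elim
    case (elim n)
    let ?d = "\<zeta> - blinfun_apply (\<pi> a) \<Omega>"
    have "blinfun_apply (\<pi> (z n o\<^sub>L a)) \<Omega> = blinfun_apply (\<pi> (z n)) (blinfun_apply (\<pi> a) \<Omega>)"
      using gns z(1) a(1) by (simp add: gns_representation_def)
    then have "blinfun_apply (\<pi> (z n)) \<zeta> =
        blinfun_apply (\<pi> (z n)) ?d + blinfun_apply (\<pi> (z n o\<^sub>L a)) \<Omega>"
      by (simp add: blinfun.diff_right)
    then have "norm (blinfun_apply (\<pi> (z n)) \<zeta>) \<le>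
        norm (blinfun_apply (\<pi> (z n)) ?d) + norm (blinfun_apply (\<pi> (z n o\<^sub>L a)) \<Omega>)"
      by (metis norm_triangle_ineq)
    moreover have "norm (blinfun_apply (\<pi> (z n)) ?d) \<le> (K + 1) * norm ?d"
    proof -
      have "norm (z n) \<le> K + 1"
        using z(2)[of n] by linarith
      then show ?thesis
        using gns_contractive[OF gns z(1), of n ?d] by (meson mult_right_mono norm_ge_zero order_trans)
    qed
    moreover have "(K + 1) * norm ?d < e / 2"
      using a(2) K by (simp add: field_simps)
    moreover have "norm (blinfun_apply (\<pi> (z n o\<^sub>L a)) \<Omega>) < e / 2"
      using elim gns_norm[OF gns compose_in[OF z(1) a(1)]] by simp
    ultimately show ?case
      by (simp add: dist_norm)
  qed
qed

text \<open>The formula is phrased for differences because 2-norm convergence is about the 2-norm of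
  \<sigma>_t y - \<sigma>_t l, which \<open>gns_norm\<close> reads off from \<pi> of that
  difference.\<close>

lemma modular_diff:
  assumes mod: "modular_automorphism_group M \<phi> \<pi> \<Omega> \<sigma>"
  obtains U where "\<And>t x y. x \<in> M \<Longrightarrow> y \<in> M \<Longrightarrow>
    \<pi> (\<sigma> t x - \<sigma> t y) = U t o\<^sub>L \<pi> (x - y) o\<^sub>L U (- t)"
proof -
  have gns: "gns_representation M \<phi> \<pi> \<Omega>"
    using mod by (simp add: modular_automorphism_group_def)
  obtain U where U: "\<And>t x. x \<in> M \<Longrightarrow> \<sigma> t x \<in> M"
    "\<And>t x. x \<in> M \<Longrightarrow> \<pi> (\<sigma> t x) = U t o\<^sub>L \<pi> x o\<^sub>L U (- t)"
    using mod unfolding modular_automorphism_group_def by blast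
  have "\<pi> (\<sigma> t x - \<sigma> t y) = U t o\<^sub>L \<pi> (x - y) o\<^sub>L U (- t)" if "x \<in> M" "y \<in> M" for t x y
    using that by (simp add: gns_diff[OF gns] U compose_diff_left compose_diff_right)
  then show ?thesis
    using that by blast
qed

lemma modular_in: "modular_automorphism_group M \<phi> \<pi> \<Omega> \<sigma> \<Longrightarrow> x \<in> M \<Longrightarrow> \<sigma> t x \<in> M"
  by (auto simp: modular_automorphism_group_def)

text \<open>The bound \<open>\<parallel>\<sigma>\<^sub>t(z)\<parallel>\<^sub>2 \<le> \<parallel>U\<^sub>t\<parallel> \<parallel>\<pi>(z) U\<^sub>-\<^sub>t \<Omega>\<parallel>\<close> and strong convergence on bounded sets replace the
  invariance of the 2-norm under the modular group, so no spectral theory of \<open>\<Delta>\<close> enters.\<close>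

lemma modular_norm2_lim:
  assumes mod: "modular_automorphism_group M \<phi> \<pi> \<Omega> \<sigma>"
    and y: "norm2_lim y l" and bound: "\<And>n. norm (y n) \<le> K"
  shows "norm2_lim (\<lambda>n. \<sigma> t (y n)) (\<sigma> t l)"
proof -
  have gns: "gns_representation M \<phi> \<pi> \<Omega>"
    using mod by (simp add: modular_automorphism_group_def)
  obtain U where U: "\<And>t x y. x \<in> M \<Longrightarrow> y \<in> M \<Longrightarrow>
      \<pi> (\<sigma> t x - \<sigma> t y) = U t o\<^sub>L \<pi> (x - y) o\<^sub>L U (- t)"
    using modular_diff[OF mod] by blast
  have M: "y n \<in> M" "l \<in> M" for n
    using y by (simp_all add: norm2_lim_def)
  have "(\<lambda>n. blinfun_apply (\<pi> (y n - l)) (blinfun_apply (U (- t)) \<Omega>)) \<longlonglongrightarrow> 0"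
  proof (rule gns_apply_tendsto_zero[OF gns])
    show "norm (y n - l) \<le> K + norm l" for n
      using norm_triangle_ineq4[of "y n" l] bound[of n] by simp
  qed (use M y in \<open>simp_all add: diff_in norm2_lim_def\<close>)
  then have "(\<lambda>n. norm (blinfun_apply (U t) (blinfun_apply (\<pi> (y n - l)) (blinfun_apply (U (- t)) \<Omega>))))
      \<longlonglongrightarrow> norm (blinfun_apply (U t) 0)"
    by (intro tendsto_intros)
  moreover have "norm (blinfun_apply (U t) (blinfun_apply (\<pi> (y n - l)) (blinfun_apply (U (- t)) \<Omega>))) =
      norm2 \<phi> (\<sigma> t (y n) - \<sigma> t l)" for n
    using gns_norm[OF gns diff_in[OF modular_in[OF mod M(1)] modular_in[OF mod M(2)]], of t n t]
      U[OF M(1,2), of t n] by simp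
  ultimately show ?thesis
    using modular_in[OF mod] M by (simp add: norm2_lim_def)
qed

text \<open>Both sides have the same image under \<pi>, and \<pi> is injective on \<open>M\<close>:
  the length of \<pi>(x) \<Omega> is the 2-norm of x, which is faithful. The lemma allows scaling
  into the ball.\<close>

lemma modular_scaleR:
  assumes mod: "modular_automorphism_group M \<phi> \<pi> \<Omega> \<sigma>" and x: "x \<in> M"
  shows "\<sigma> t (r *\<^sub>R x) = r *\<^sub>R \<sigma> t x"
proof -
  have gns: "gns_representation M \<phi> \<pi> \<Omega>"
    using mod by (simp add: modular_automorphism_group_def)
  obtain U where U: "\<And>t x. x \<in> M \<Longrightarrow> \<pi> (\<sigma> t x) = U t o\<^sub>L \<pi> x o\<^sub>L U (- t)"
    using mod unfolding modular_automorphism_group_def by blast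
  have scale: "\<pi> (r *\<^sub>R y) = r *\<^sub>R \<pi> y" if "y \<in> M" for y
    using gns that by (simp add: gns_representation_def clinear_on_def scaleR_eq_scaleC)
  have \<sigma>: "\<sigma> t (r *\<^sub>R x) \<in> M" "\<sigma> t x \<in> M" "r *\<^sub>R \<sigma> t x \<in> M"
    using modular_in[OF mod] x by (simp_all add: scaleR_in)
  have "\<pi> (\<sigma> t (r *\<^sub>R x)) = \<pi> (r *\<^sub>R \<sigma> t x)"
    by (rule blinfun_eqI)
      (simp add: U scale x scaleR_in \<sigma> blinfun.scaleR_left blinfun.scaleR_right)
  then have "norm2 \<phi> (\<sigma> t (r *\<^sub>R x) - r *\<^sub>R \<sigma> t x) = 0"
    using gns_norm[OF gns diff_in[OF \<sigma>(1,3)]] by (simp add: gns_diff[OF gns \<sigma>(1,3)])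
  then show ?thesis
    using norm2_eq_zero_iff[OF diff_in[OF \<sigma>(1,3)]] by simp
qed

end

section \<open>Closedness of the set of Markov maps\<close>

context vn_state_pair
begin

text \<open>The limit is already the restriction of a state-preserving ucp map \<Phi>. Each instance
  of equivariance involves two points, u and \<sigma>_t u; Markov maps approximating f at both
  satisfy it, and continuity of the modular automorphism of \<rho> on bounded sequences carries it
  to the limit.\<close>

lemma limit_of_markov_maps:
  assumes mod\<^sub>\<phi>: "modular_automorphism_group M \<phi> \<pi>\<^sub>\<phi> \<Omega>\<^sub>\<phi> \<sigma>\<^sub>\<phi>"
    and mod\<^sub>\<rho>: "modular_automorphism_group N \<rho> \<pi>\<^sub>\<rho> \<Omega>\<^sub>\<rho> \<sigma>\<^sub>\<rho>"
    and f: "f \<in> L.lip_top closure_of (restrictions_to_ball M (markov_maps M \<phi> \<sigma>\<^sub>\<phi> N \<rho> \<sigma>\<^sub>\<rho>))"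
  shows "f \<in> restrictions_to_ball M (markov_maps M \<phi> \<sigma>\<^sub>\<phi> N \<rho> \<sigma>\<^sub>\<rho>)"
proof -
  have sub: "markov_maps M \<phi> \<sigma>\<^sub>\<phi> N \<rho> \<sigma>\<^sub>\<rho> \<subseteq> state_preserving_ucp M \<phi> N \<rho>"
    by (auto simp: markov_maps_def)
  have "f \<in> L.lip_top closure_of (restrictions_to_ball M (state_preserving_ucp M \<phi> N \<rho>))"
    using f unfolding restrictions_to_ball_def by (rule subsetD[OF closure_of_mono[OF image_mono[OF sub]]])
  then obtain \<Phi> where \<Phi>: "\<Phi> \<in> state_preserving_ucp M \<phi> N \<rho>" "f = restrict \<Phi> (unit_ball M)"
    using limit_is_restriction by (auto simp: restrictions_to_ball_def)
  note ucp = state_preserving_ucp[OF \<Phi>(1)]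
  have scale: "\<Phi> (r *\<^sub>R x) = r *\<^sub>R \<Phi> x" if "x \<in> M" for r x
    using ucp_scaleC[OF ucp that] by (simp add: scaleR_eq_scaleC)
  have "\<Phi> (\<sigma>\<^sub>\<phi> t x) = \<sigma>\<^sub>\<rho> t (\<Phi> x)" if x: "x \<in> M" for t x
  proof -
    have \<sigma>x: "\<sigma>\<^sub>\<phi> t x \<in> M"
      by (rule A.modular_in[OF mod\<^sub>\<phi> x])
    \<comment> \<open>Approximation is available only on the ball, so one radius has to dominate
      both \<open>x\<close> and its image under the modular automorphism.\<close>
    define R where "R = 1 + norm x + norm (\<sigma>\<^sub>\<phi> t x)"
    have R: "0 < R" "norm x \<le> R" "norm (\<sigma>\<^sub>\<phi> t x) \<le> R"
      by (simp_all add: R_def add_pos_nonneg)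
    define u where "u = (1 / R) *\<^sub>R x"
    have \<sigma>u: "\<sigma>\<^sub>\<phi> t u = (1 / R) *\<^sub>R \<sigma>\<^sub>\<phi> t x"
      unfolding u_def by (rule A.modular_scaleR[OF mod\<^sub>\<phi> x])
    have u: "u \<in> M" "u \<in> unit_ball M" "\<sigma>\<^sub>\<phi> t u \<in> unit_ball M"
      using R x \<sigma>x unfolding \<sigma>u by (simp_all add: u_def unit_ball_def A.scaleR_in)
    obtain \<Psi> where \<Psi>: "\<And>n. \<Psi> n \<in> markov_maps M \<phi> \<sigma>\<^sub>\<phi> N \<rho> \<sigma>\<^sub>\<rho>"
      "\<And>v. v \<in> {u, \<sigma>\<^sub>\<phi> t u} \<Longrightarrow> B.norm2_lim (\<lambda>n. \<Psi> n v) (f v)"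
      using closure_approximation[OF sub f, of "{u, \<sigma>\<^sub>\<phi> t u}"] u by auto
    have "norm (\<Psi> n u) \<le> 1" for n
      using ucp_unit_ball[OF state_preserving_ucp u(2), of "\<Psi> n"] \<Psi>(1)[of n] sub
      by (auto simp: unit_ball_def)
    then have "B.norm2_lim (\<lambda>n. \<sigma>\<^sub>\<rho> t (\<Psi> n u)) (\<sigma>\<^sub>\<rho> t (f u))"
      using \<Psi>(2) by (intro B.modular_norm2_lim[OF mod\<^sub>\<rho>]) simp_all
    moreover have "\<sigma>\<^sub>\<rho> t (\<Psi> n u) = \<Psi> n (\<sigma>\<^sub>\<phi> t u)" for n
      using \<Psi>(1)[of n] u(1) by (simp add: markov_maps_def)
    ultimately have "f (\<sigma>\<^sub>\<phi> t u) = \<sigma>\<^sub>\<rho> t (f u)"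
      using \<Psi>(2)[of "\<sigma>\<^sub>\<phi> t u"] B.norm2_lim_unique by simp
    then have "\<Phi> (\<sigma>\<^sub>\<phi> t u) = \<sigma>\<^sub>\<rho> t (\<Phi> u)"
      using u by (simp add: \<Phi>(2))
    then have "(1 / R) *\<^sub>R \<Phi> (\<sigma>\<^sub>\<phi> t x) = (1 / R) *\<^sub>R \<sigma>\<^sub>\<rho> t (\<Phi> x)"
      unfolding \<sigma>u
      by (simp add: u_def scale x \<sigma>x B.modular_scaleR[OF mod\<^sub>\<rho> ucp_in[OF ucp x]])
    then show ?thesis
      using R by simp
  qed
  then have "\<Phi> \<in> markov_maps M \<phi> \<sigma>\<^sub>\<phi> N \<rho> \<sigma>\<^sub>\<rho>"
    using \<Phi>(1) by (simp add: markov_maps_def)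
  then show ?thesis
    unfolding restrictions_to_ball_def \<Phi>(2) by (rule imageI)
qed

lemma closedin_markov_maps:
  assumes "modular_automorphism_group M \<phi> \<pi>\<^sub>\<phi> \<Omega>\<^sub>\<phi> \<sigma>\<^sub>\<phi>"
    and "modular_automorphism_group N \<rho> \<pi>\<^sub>\<rho> \<Omega>\<^sub>\<rho> \<sigma>\<^sub>\<rho>"
  shows "closedin L.lip_top (restrictions_to_ball M (markov_maps M \<phi> \<sigma>\<^sub>\<phi> N \<rho> \<sigma>\<^sub>\<rho>))"
proof -
  have "markov_maps M \<phi> \<sigma>\<^sub>\<phi> N \<rho> \<sigma>\<^sub>\<rho> \<subseteq> state_preserving_ucp M \<phi> N \<rho>"
    by (auto simp: markov_maps_def)
  then show ?thesis
    using limit_of_markov_maps[OF assms] restrictions_subset_lip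
    by (simp add: closure_of_subset_eq[symmetric] L.topspace_lip subset_iff)
qed

end

theorem proposition3p3:
  fixes M :: "('h::complex_hilbert_space \<Rightarrow>\<^sub>L 'h) set"
    and N :: "('g::complex_hilbert_space \<Rightarrow>\<^sub>L 'g) set"
    and \<phi> :: "('h \<Rightarrow>\<^sub>L 'h) \<Rightarrow> complex" and \<rho> :: "('g \<Rightarrow>\<^sub>L 'g) \<Rightarrow> complex"
    and \<pi>\<^sub>\<phi> :: "('h \<Rightarrow>\<^sub>L 'h) \<Rightarrow> ('k::complex_hilbert_space \<Rightarrow>\<^sub>L 'k)" and \<Omega>\<^sub>\<phi> :: 'k
    and \<pi>\<^sub>\<rho> :: "('g \<Rightarrow>\<^sub>L 'g) \<Rightarrow> ('l::complex_hilbert_space \<Rightarrow>\<^sub>L 'l)" and \<Omega>\<^sub>\<rho> :: 'l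
    and \<sigma>\<^sub>\<phi> :: "real \<Rightarrow> ('h \<Rightarrow>\<^sub>L 'h) \<Rightarrow> ('h \<Rightarrow>\<^sub>L 'h)"
    and \<sigma>\<^sub>\<rho> :: "real \<Rightarrow> ('g \<Rightarrow>\<^sub>L 'g) \<Rightarrow> ('g \<Rightarrow>\<^sub>L 'g)"
  assumes "von_neumann_algebra M" and "separable_predual M" and "faithful_normal_state M \<phi>"
    and "von_neumann_algebra N" and "separable_predual N" and "faithful_normal_state N \<rho>"
  shows "closedin (lip1_topology M \<phi> N \<rho>)
      (restrictions_to_ball M (state_preserving_ucp M \<phi> N \<rho>)) \<and>
    Polish_space (subtopology (lip1_topology M \<phi> N \<rho>)
      (restrictions_to_ball M (state_preserving_ucp M \<phi> N \<rho>))) \<and>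
    (modular_automorphism_group M \<phi> \<pi>\<^sub>\<phi> \<Omega>\<^sub>\<phi> \<sigma>\<^sub>\<phi> \<and> modular_automorphism_group N \<rho> \<pi>\<^sub>\<rho> \<Omega>\<^sub>\<rho> \<sigma>\<^sub>\<rho> \<longrightarrow>
      closedin
        (subtopology (lip1_topology M \<phi> N \<rho>)
          (restrictions_to_ball M (state_preserving_ucp M \<phi> N \<rho>)))
        (restrictions_to_ball M (markov_maps M \<phi> \<sigma>\<^sub>\<phi> N \<rho> \<sigma>\<^sub>\<rho>)) \<and>
      Polish_space (subtopology (lip1_topology M \<phi> N \<rho>)
        (restrictions_to_ball M (markov_maps M \<phi> \<sigma>\<^sub>\<phi> N \<rho> \<sigma>\<^sub>\<rho>))))"
proof -
  interpret vn_state_pair M \<phi> N \<rho>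
    using assms by unfold_locales
  have Polish: "Polish_space (subtopology L.lip_top S)" if "closedin L.lip_top S" for S
    using that B.mcomplete_ball A.separable_ball B.separable_ball assms
    by (intro L.Polish_closedin_lip)
  have "closedin (subtopology L.lip_top (restrictions_to_ball M (state_preserving_ucp M \<phi> N \<rho>)))
      (restrictions_to_ball M (markov_maps M \<phi> \<sigma>\<^sub>\<phi> N \<rho> \<sigma>\<^sub>\<rho>))"
    if "closedin L.lip_top (restrictions_to_ball M (markov_maps M \<phi> \<sigma>\<^sub>\<phi> N \<rho> \<sigma>\<^sub>\<rho>))"
    using that by (rule closedin_subset_topspace) (auto simp: restrictions_to_ball_def markov_maps_def)
  then show ?thesis
    unfolding lip1_topology_eq
    using closedin_state_preserving_ucp closedin_markov_maps Polish by blast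
qed

end
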